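(* Let $\alpha>2$, $\beta>2$, $\nu>1$, $\theta>0$, $\sigma^2>0$, $0<\epsilon<1$, $0<\omega\le 1$, $z_m,z_s>0$ and an integer $K\ge0$ be fixed. Let $\mu>0$ be such that $$\Pr\left(\sum_{Y\in \Phi(1)} \left[|U_Y|^{-\alpha}\, 1\{Y \notin \{Y_0\}\cup\mathcal{C}\}-\theta^{-1} |U_0|^{-\alpha}\,1\{Y = Y_0\}\right]+ \mu > 0\right)=\epsilon ,$$ where $\Phi(1)$ is the base-station process of density $1$. Consider the hybrid network described in the context, with mobiles having infinite energy storage, and let $\mathcal{F}_h$ be its feasibility region under the outage constraint $P_{\mathsf{out}}\le\epsilon$, i.e. the set of triples $(q,\lambda_b,\lambda_p)$ (power-beacon transmission power, base-station density, power-beacon density) for which there is a mobile-transmission power $p>0$ with $\mathbb{E}[P]\ge\omega p$ and $P_{\mathsf{out}}(\lambda_b,p)\le\epsilon$. 1. For isotropic microwave power transfer, $$\mathcal{F}_h = \left\{(q, \lambda_b, \lambda_p)\in \mathbb{R}^3_+ \;\middle|\; q\lambda_p \lambda_b^{\alpha/2} \geq \left(1-\frac{2}{\beta}\right)\frac{\sigma^2\omega \nu^{\beta-2}}{\pi\mu}\right\}.$$ 2. For directed microwave power transfer, $$\left\{(q, \lambda_b, \lambda_p)\in \mathbb{R}_+^3 \;\middle|\; \lambda_p \geq \frac{1}{\pi\nu^2}\log\frac{z_m q\lambda_b^{\alpha/2}}{z_m q\lambda_b^{\alpha/2}-\kappa},\ \left(z_m q\right)^{2/\alpha}\lambda_b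 \geq \kappa^{2/\alpha}\right\}\subset \mathcal{F}_h,\qquad \kappa = \frac{\omega \sigma^2\nu^\beta}{\mu}$$ (where the logarithm is read as $+\infty$ when its denominator vanishes).
   Context: $\mathbb{R}_+$ is the set of nonnegative reals. Cellular (uplink) network: base stations form a homogeneous Poisson point process on $\mathbb{R}^2$ with density $\lambda_b$. Considered from a typical base station $Y_0$ at the origin (Palm version), the process $\Phi=\Phi(\lambda_b)$ consists of the point $Y_0=0$ together with a homogeneous Poisson point process of density $\lambda_b$. Each base station $Y\in\Phi$ serves exactly one active mobile $U_Y$; given $\Phi$, the mobiles $U_Y$ are independent and $U_Y$ is uniform in the Voronoi cell of $Y$. Write $U_0=U_{Y_0}$. Let $\mathcal{C}\subset\Phi\setminus\{Y_0\}$ be the set of the $K$ base stations whose active mobiles are the $K$ interfering mobiles ($U_Y$ with $Y\ne Y_0$) nearest to $Y_0$; their interference at $Y_0$ is perfectly canceled. All mobiles transmit with power $p$; with noise variance $\sigma^2$ and interference $I=\sum_{Y\in\Phi\setminus(\{Y_0\}\cup\mathcal{C})}p|U_Y|^{-\alpha}$, the outage probability is $$P_{\mathsf{out}}(\lambda_b,p)=\Pr\left(\frac{p|U_0|^{-\alpha}}{I+\sigma^2}<\theta\right).$$ Power-beacon network: power beacons form a homogeneous Poisson point process $\Psi$ on $\mathbb{R}^2$ with density $\lambda_p$, independent of base stations and mobiles. The raw power $P$ received by the mobile $U_0$ is - for isotropic microwave power transfer: $P=q\sum_{T\in\Psi}[\max(|T-U_0|,\nu)]^{-\beta}$; - for directed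 microwave power transfer: $P=z_m q\max(|U_0-T_0|,\nu)^{-\beta}+z_s q\sum_{T\in\Psi\setminus\{T_0\}}\max(|U_0-T|,\nu)^{-\beta}$, where $T_0$ is the point of $\Psi$ nearest to $U_0$ and $z_m,z_s$ are the main-lobe and side-lobe responses. Infinite energy storage: a mobile has duty cycle $\omega$ (the probability that it transmits a packet in a given slot); with infinite energy storage, an active mobile can transmit with fixed power $p$ (with probability one) when $\mathbb{E}[P]\ge\omega p$, i.e. powers up to $\mathbb{E}[P]/\omega$ can be sustained. This is the condition used in the definition of $\mathcal{F}_h$. *)

theory Defs
  imports "HOL-Probability.Probability"
begin

type_synonym point = "real ^ 2"

section \<open>Poisson point processes in the plane\<close>

text \<open>Locally finite sets of points, with the sigma-algebra generated by the counting maps.\<close>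

definition point_configs :: "point set measure" where
  "point_configs =
     sigma {c. \<forall>B. bounded B \<longrightarrow> finite (c \<inter> B)}
       {{c. (\<forall>B. bounded B \<longrightarrow> finite (c \<inter> B)) \<and> card (c \<inter> A) = k} | A k.
          A \<in> sets borel \<and> bounded A}"

text \<open>For density 0 the second conjunct says, with \<open>0 ^ 0 = 1\<close>, that the process is
  almost surely empty.\<close>

definition poisson_process :: "'w measure \<Rightarrow> real \<Rightarrow> ('w \<Rightarrow> point set) \<Rightarrow> bool" where
  "poisson_process M dens N \<longleftrightarrow>
     N \<in> M \<rightarrow>\<^sub>M point_configs \<and>
     (\<forall>B \<in> sets borel. bounded B \<longrightarrow>
        (\<forall>k. measure M {x \<in> space M. card (N x \<inter> B) = k} =
              (dens * measure lborel B) ^ k / fact k * exp (- (dens * measure lborel B)))) \<and>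
     (\<forall>\<B>. finite \<B> \<and> disjoint \<B> \<and> (\<forall>B\<in>\<B>. B \<in> sets borel \<and> bounded B) \<longrightarrow>
        prob_space.indep_vars M (\<lambda>_. count_space UNIV) (\<lambda>B x. card (N x \<inter> B)) \<B>)"

section \<open>The uplink network seen from a typical base station\<close>

text \<open>The base stations are labelled \<open>Y 0 = 0, Y 1, Y 2, \<dots>\<close> in order of increasing distance from
  the origin. Almost surely the points of a Poisson process of positive density are infinitely many
  and have distinct nonzero norms, so the labelling is determined by the set \<open>\<Phi>\<close> of base stations
  and loses no information; conditioning on \<open>\<Phi>\<close> is conditioning on the sequence \<open>Y\<close>.
  The mobile served by \<open>Y n\<close> is \<open>U n\<close>.\<close>

definition voronoi_cell :: "(nat \<Rightarrow> point) \<Rightarrow> nat \<Rightarrow> point set" where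
  "voronoi_cell y n = {u. \<forall>m. dist u (y n) \<le> dist u (y m)}"

definition sigma_stations :: "'w measure \<Rightarrow> (nat \<Rightarrow> 'w \<Rightarrow> point) \<Rightarrow> 'w measure" where
  "sigma_stations M Y = vimage_algebra (space M) (\<lambda>x n. Y n x) (\<Pi>\<^sub>M n\<in>UNIV. borel)"

definition uplink_network ::
    "'w measure \<Rightarrow> real \<Rightarrow> (nat \<Rightarrow> 'w \<Rightarrow> point) \<Rightarrow> (nat \<Rightarrow> 'w \<Rightarrow> point) \<Rightarrow> bool" where
  "uplink_network M dens Y U \<longleftrightarrow>
     (\<forall>n. Y n \<in> borel_measurable M) \<and>
     (\<forall>n. U n \<in> borel_measurable M) \<and>
     (AE x in M. Y 0 x = 0 \<and> strict_mono (\<lambda>n. norm (Y n x))) \<and>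
     poisson_process M dens (\<lambda>x. {Y n x | n. n \<ge> 1}) \<and>
     (\<forall>n B. (\<forall>i<n. B i \<in> sets borel) \<longrightarrow>
        (AE x in M.
           nn_cond_exp M (sigma_stations M Y) (indicator {z \<in> space M. \<forall>i<n. U i z \<in> B i}) x =
           (\<Prod>i<n. emeasure (uniform_measure lborel (voronoi_cell (\<lambda>m. Y m x) i)) (B i))))"

text \<open>Labels of the stations of the \<open>K\<close> interfering mobiles nearest to the origin: fewer than \<open>K\<close>
  interfering mobiles are strictly nearer. Almost surely the mobiles are locally finite and there
  are no ties, so there are exactly \<open>K\<close> such labels.\<close>

definition cancelled :: "nat \<Rightarrow> (nat \<Rightarrow> point) \<Rightarrow> nat set" where
  "cancelled K u =
     {n. n \<noteq> 0 \<and> finite {m. m \<noteq> 0 \<and> norm (u m) < norm (u n)} \<and>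
         card {m. m \<noteq> 0 \<and> norm (u m) < norm (u n)} < K}"

text \<open>The value \<open>0 powr (- \<alpha>) = 0\<close> is immaterial here and below, since almost surely no mobile is
  at the origin.\<close>

definition interference :: "nat \<Rightarrow> real \<Rightarrow> real \<Rightarrow> (nat \<Rightarrow> point) \<Rightarrow> ennreal" where
  "interference K \<alpha> p u =
     (\<Sum>\<^sub>\<infinity>n \<in> UNIV - ({0} \<union> cancelled K u). ennreal (p * norm (u n) powr (- \<alpha>)))"

definition outage_probability ::
    "'w measure \<Rightarrow> (nat \<Rightarrow> 'w \<Rightarrow> point) \<Rightarrow> nat \<Rightarrow> real \<Rightarrow> real \<Rightarrow> real \<Rightarrow> real \<Rightarrow> real" where
  "outage_probability M U K \<alpha> \<theta> noise p =
     measure M {x \<in> space M.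
       ennreal (p * norm (U 0 x) powr (- \<alpha>)) /
         (interference K \<alpha> p (\<lambda>n. U n x) + ennreal noise) < ennreal \<theta>}"

section \<open>The power-beacon network\<close>

text \<open>Raw power received by a mobile at \<open>u\<close> from beacons \<open>\<Psi>\<close> transmitting with power \<open>q\<close>.\<close>

definition isotropic_power ::
    "real \<Rightarrow> real \<Rightarrow> real \<Rightarrow> point \<Rightarrow> point set \<Rightarrow> ennreal" where
  "isotropic_power \<nu> \<beta> q u \<Psi> =
     ennreal q * (\<Sum>\<^sub>\<infinity>T\<in>\<Psi>. ennreal (max (dist T u) \<nu> powr (- \<beta>)))"

definition directed_power ::
    "real \<Rightarrow> real \<Rightarrow> real \<Rightarrow> real \<Rightarrow> real \<Rightarrow> point \<Rightarrow> point set \<Rightarrow> ennreal" where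
  "directed_power zm zs \<nu> \<beta> q u \<Psi> =
     (if \<Psi> = {} then 0
      else let T0 = arg_min_on (\<lambda>T. dist u T) \<Psi> in
        ennreal (zm * q * max (dist u T0) \<nu> powr (- \<beta>)) +
        ennreal (zs * q) * (\<Sum>\<^sub>\<infinity>T\<in>\<Psi> - {T0}. ennreal (max (dist u T) \<nu> powr (- \<beta>))))"

section \<open>The hybrid network and its feasibility region\<close>

text \<open>A realization, on one probability space, of the uplink network for every base-station density
  and of the beacon process for every beacon density. No joint law is assumed for different
  densities of the same process.\<close>

definition hybrid_network ::
    "'w measure \<Rightarrow> (real \<Rightarrow> nat \<Rightarrow> 'w \<Rightarrow> point) \<Rightarrow> (real \<Rightarrow> nat \<Rightarrow> 'w \<Rightarrow> point) \<Rightarrow>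
      (real \<Rightarrow> 'w \<Rightarrow> point set) \<Rightarrow> bool" where
  "hybrid_network M Y U \<Psi> \<longleftrightarrow>
     prob_space M \<and>
     (\<forall>lb>0. uplink_network M lb (Y lb) (U lb)) \<and>
     (\<forall>lp\<ge>0. poisson_process M lp (\<Psi> lp)) \<and>
     (\<forall>lb>0. \<forall>lp\<ge>0.
        prob_space.indep_set M
          (sets (vimage_algebra (space M) (\<Psi> lp) point_configs))
          (sets (vimage_algebra (space M) (\<lambda>x. (\<lambda>n. Y lb n x, \<lambda>n. U lb n x))
            ((\<Pi>\<^sub>M n\<in>UNIV. borel) \<Otimes>\<^sub>M (\<Pi>\<^sub>M n\<in>UNIV. borel)))))"

text \<open>Feasible triples \<open>(q, lb, lp)\<close> of beacon power, base-station density and beacon density, for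
  mobiles with infinite energy storage and duty cycle \<open>\<omega>\<close>. The power-transfer scheme enters through
  the received power \<open>P q u \<psi>\<close>. The base-station density must be positive for the network to exist:
  for density 0 the only Voronoi cell is the whole plane, which carries no uniform law.\<close>

definition feasibility_region ::
    "'w measure \<Rightarrow> (real \<Rightarrow> nat \<Rightarrow> 'w \<Rightarrow> point) \<Rightarrow> (real \<Rightarrow> 'w \<Rightarrow> point set) \<Rightarrow>
      (real \<Rightarrow> point \<Rightarrow> point set \<Rightarrow> ennreal) \<Rightarrow>
      nat \<Rightarrow> real \<Rightarrow> real \<Rightarrow> real \<Rightarrow> real \<Rightarrow> real \<Rightarrow> (real \<times> real \<times> real) set" where
  "feasibility_region M U \<Psi> P K \<alpha> \<theta> noise \<omega> \<epsilon> =
     {(q, lb, lp). q \<ge> 0 \<and> lb > 0 \<and> lp \<ge> 0 \<and>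
        (\<exists>p>0. (\<integral>\<^sup>+x. P q (U lb 0 x) (\<Psi> lp x) \<partial>M) \<ge> ennreal (\<omega> * p) \<and>
               outage_probability M (U lb) K \<alpha> \<theta> noise p \<le> \<epsilon>)}"

end

theory Submission
  imports Defs
begin

text \<open>Scaling space by \<open>1 / sqrt lb\<close> turns the network of density 1 into the one of density \<open>lb\<close>, so
  the outage probability at density \<open>lb\<close> and power \<open>p\<close> is \<open>F (\<sigma>\<^sup>2 / (p * lb powr (\<alpha> / 2)))\<close>, where
  \<open>F t\<close> is the probability that the margin of density 1 plus \<open>t\<close> is positive and \<open>F \<mu> = \<epsilon>\<close>. The
  function \<open>F\<close> is increasing, and strictly so at \<open>\<mu>\<close>: given everything but \<open>U 0\<close>, the mobile \<open>U 0\<close> is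
  uniform in a convex cell around the origin, so whenever it can lie far enough out to be in outage at
  level \<open>\<mu>\<close> it also lies with positive probability in the annulus where outage begins strictly between
  \<open>\<mu>\<close> and \<open>t\<close>. Hence the constraint on the outage is exactly \<open>p \<ge> \<sigma>\<^sup>2 / (\<mu> * lb powr (\<alpha> / 2))\<close>, and
  feasibility is a lower bound on the mean received power. That mean is given by Campbell's formula in
  the isotropic case and is bounded below by the probability of a beacon within distance \<open>\<nu>\<close> in the
  directed case.\<close>

text \<open>No joint law links the networks of different densities, so the scaling can only be an
  identity of laws. Hence \<open>uplink_network\<close> must be shown to determine the law of the
  mobiles: the density fixes the law of the point set, ordering by distance makes the stations
  functions of that set, and the conditional law fixes the mobiles given the stations. The dilated
  network of density 1 is then a second network of density \<open>lb\<close> on the same space.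
  Strictness rests on two facts. The choice of cancelled mobiles ignores \<open>U 0\<close>, so
  moving \<open>U 0\<close> changes the signal only. The interference is almost surely finite; were
  it infinite, outage would occur at every noise level and there would be no annulus. In the
  directed case the nearest beacon, once within \<open>\<nu>\<close>, contributes
  \<open>zm * q * \<nu> powr (- \<beta>)\<close>. The constant \<open>\<kappa>\<close> is the value
  of \<open>zm * q * lb powr (\<alpha> / 2)\<close> at which this equals the required mean
  \<open>\<omega> * \<sigma>\<^sup>2 / (\<mu> * lb powr (\<alpha> / 2))\<close>, and the logarithm
  comes from solving for \<open>lp\<close> in the probability that such a beacon exists.\<close>

text \<open>Turns the unordered sums of the definitions into integrals against counting measure, to
  which monotone convergence and Fubini apply.\<close>

lemma infsum_ennreal_eq_nn_integral:
  fixes f :: "'a \<Rightarrow> ennreal"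
  assumes "countable A"
  shows "infsum f A = (\<integral>\<^sup>+x. f x \<partial>count_space A)"
proof (rule antisym)
  have SUP: "infsum f A = (SUP F\<in>{F. finite F \<and> F \<subseteq> A}. sum f F)"
    by (rule nonneg_infsum_complete) simp
  have sum_eq: "sum f F = (\<integral>\<^sup>+x. f x * indicator F x \<partial>count_space A)" if "finite F" "F \<subseteq> A" for F
    using that
    by (subst nn_integral_indicator_finite)
       (auto simp: emeasure_count_space intro!: sum.cong)
  show "infsum f A \<le> (\<integral>\<^sup>+x. f x \<partial>count_space A)"
    unfolding SUP
  proof (rule SUP_least, clarify)
    fix F assume F: "finite F" "F \<subseteq> A"
    show "sum f F \<le> (\<integral>\<^sup>+x. f x \<partial>count_space A)"
      unfolding sum_eq[OF F] by (intro nn_integral_mono) (simp split: split_indicator)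
  qed
  show "(\<integral>\<^sup>+x. f x \<partial>count_space A) \<le> infsum f A"
  proof (cases "A = {}")
    case True
    then show ?thesis by (simp add: nn_integral_empty)
  next
    case False
    \<comment> \<open>The enumeration may repeat values; since \<open>F n\<close> is an image set,
      no term is counted twice.\<close>
    define F where "F n = from_nat_into A ` {..n::nat}" for n
    have F: "finite (F n)" "F n \<subseteq> A" for n
      using from_nat_into[OF False] by (auto simp: F_def)
    have inc: "incseq (\<lambda>n x. f x * indicator (F n) x)"
    proof (intro incseq_SucI le_funI)
      fix n x
      show "f x * indicator (F n) x \<le> f x * indicator (F (Suc n)) x"
        unfolding F_def by (auto split: split_indicator)
    qed
    have eq: "f x = (SUP n. f x * indicator (F n) x)" if x: "x \<in> A" for x
    proof (rule antisym)
      obtain n where "from_nat_into A n = x"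
        using from_nat_into_surj[OF assms x] by blast
      then have "f x = f x * indicator (F n) x"
        by (auto simp: F_def)
      then show "f x \<le> (SUP n. f x * indicator (F n) x)"
        by (metis SUP_upper UNIV_I)
      show "(SUP n. f x * indicator (F n) x) \<le> f x"
        by (intro SUP_least) (simp split: split_indicator)
    qed
    have "(\<integral>\<^sup>+x. f x \<partial>count_space A) = (\<integral>\<^sup>+x. (SUP n. f x * indicator (F n) x) \<partial>count_space A)"
      by (intro nn_integral_cong) (simp add: eq[symmetric])
    also have "\<dots> = (SUP n. \<integral>\<^sup>+x. f x * indicator (F n) x \<partial>count_space A)"
      by (rule nn_integral_monotone_convergence_SUP[OF inc]) simp
    also have "\<dots> = (SUP n. sum f (F n))"
      by (simp add: sum_eq[OF F])
    also have "\<dots> \<le> infsum f A"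
      unfolding SUP using F by (intro SUP_mono) auto
    finally show ?thesis .
  qed
qed

section \<open>Point configurations\<close>

lemma space_point_configs: "space point_configs = {c. \<forall>B. bounded B \<longrightarrow> finite (c \<inter> B)}"
  unfolding point_configs_def by (rule space_measure_of) auto

lemma finite_config_Int: "c \<in> space point_configs \<Longrightarrow> bounded B \<Longrightarrow> finite (c \<inter> B)"
  by (simp add: space_point_configs)

lemma countable_config:
  assumes "c \<in> space point_configs"
  shows "countable c"
proof -
  have "c = (\<Union>n::nat. c \<inter> cball 0 n)"
    by (auto simp: real_arch_simple)
  also have "countable \<dots>"
    using assms by (intro countable_UN) (auto intro!: countable_finite finite_config_Int)
  finally show ?thesis .
qed

lemma measurable_card_config:
  assumes "A \<in> sets borel" "bounded A"
  shows "(\<lambda>c. card (c \<inter> A)) \<in> point_configs \<rightarrow>\<^sub>M count_space UNIV"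
proof (subst measurable_count_space_eq2_countable, safe)
  fix k
  have "(\<lambda>c. card (c \<inter> A)) -` {k} \<inter> space point_configs =
    {c. (\<forall>B. bounded B \<longrightarrow> finite (c \<inter> B)) \<and> card (c \<inter> A) = k}"
    by (auto simp: space_point_configs)
  also have "\<dots> \<in> sets point_configs"
    unfolding point_configs_def using assms by (intro in_measure_of) auto
  finally show "(\<lambda>c. card (c \<inter> A)) -` {k} \<inter> space point_configs \<in> sets point_configs" .
qed auto

lemma measurable_into_point_configs:
  assumes "\<And>x. x \<in> space M \<Longrightarrow> f x \<in> space point_configs"
    and "\<And>A. A \<in> sets borel \<Longrightarrow> bounded A \<Longrightarrow> (\<lambda>x. card (f x \<inter> A)) \<in> M \<rightarrow>\<^sub>M count_space UNIV"
  shows "f \<in> M \<rightarrow>\<^sub>M point_configs"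
  unfolding point_configs_def
proof (rule measurable_measure_of, goal_cases)
  case 2
  then show ?case using assms(1) by (auto simp: space_point_configs)
next
  case (3 y)
  then obtain A k where A: "A \<in> sets borel" "bounded A"
    and y: "y = {c. (\<forall>B. bounded B \<longrightarrow> finite (c \<inter> B)) \<and> card (c \<inter> A) = k}" by auto
  have "f -` y \<inter> space M = (\<lambda>x. card (f x \<inter> A)) -` {k} \<inter> space M"
    using assms(1) by (auto simp: y space_point_configs)
  then show ?case
    using measurable_sets[OF assms(2)[OF A], of "{k}"] by simp
qed auto

lemma emeasure_config_eq_card:
  assumes "c \<in> space point_configs" "bounded A"
  shows "emeasure (count_space UNIV) (c \<inter> A) = of_nat (card (c \<inter> A))"
  using finite_config_Int[OF assms] by simp

lemma emeasure_config_eq_SUP: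
  "emeasure (count_space UNIV) (c \<inter> A) =
    (SUP n::nat. emeasure (count_space UNIV) (c \<inter> (A \<inter> cball (0::point) n)))"
proof -
  have "(\<Union>n::nat. c \<inter> (A \<inter> cball 0 n)) = c \<inter> A"
    by (auto simp: real_arch_simple)
  moreover have "incseq (\<lambda>n::nat. c \<inter> (A \<inter> cball (0::point) n))"
    by (intro incseq_SucI) auto
  ultimately show ?thesis
    by (subst SUP_emeasure_incseq) auto
qed

text \<open>A Dynkin argument on rectangles. The set whose points are counted moves with
  \<open>w\<close>, as a random observer requires. The fixed bounded window \<open>B\<close> keeps
  all counts finite, so that the complement step may subtract.\<close>

lemma borel_measurable_section_count:
  assumes E: "E \<in> sets (W \<Otimes>\<^sub>M borel)" and B: "B \<in> sets borel" "bounded B"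
  shows "(\<lambda>(w, c). emeasure (count_space UNIV) (c \<inter> (Pair w -` E \<inter> B)))
    \<in> borel_measurable (W \<Otimes>\<^sub>M point_configs)"
  using Int_stable_pair_measure_generator pair_measure_closed E unfolding sets_pair_measure
proof (induction rule: sigma_sets_induct_disjoint)
  let ?P = "W \<Otimes>\<^sub>M point_configs"
  have cnt: "(\<lambda>(w, c). emeasure (count_space UNIV) (c \<inter> A)) \<in> borel_measurable ?P"
    if A: "A \<in> sets borel" "bounded A" for A
  proof -
    have "(\<lambda>x. card (snd x \<inter> A)) \<in> ?P \<rightarrow>\<^sub>M count_space UNIV"
      by (rule measurable_compose[OF measurable_snd measurable_card_config[OF A]])
    then have "(\<lambda>x. ennreal (real (card (snd x \<inter> A)))) \<in> borel_measurable ?P"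
      by (rule measurable_compose) simp
    then show ?thesis
    proof (rule measurable_cong[THEN iffD1, rotated])
      fix x assume "x \<in> space ?P"
      then have "snd x \<in> space point_configs"
        by (auto simp: space_pair_measure)
      then show "ennreal (real (card (snd x \<inter> A))) = (case x of (w, c) \<Rightarrow> emeasure (count_space UNIV) (c \<inter> A))"
        by (simp only: emeasure_config_eq_card[OF _ A(2)] split_beta ennreal_of_nat_eq_real_of_nat)
    qed
  qed
  {
    case (basic E)
    then obtain A C where E: "E = A \<times> C" and A[measurable]: "A \<in> sets W" and C: "C \<in> sets borel"
      by auto
    have "(\<lambda>x. emeasure (count_space UNIV) (snd x \<inter> (C \<inter> B))) \<in> borel_measurable ?P"
      by (rule cnt[unfolded split_beta, OF sets.Int[OF C B(1)] bounded_subset[OF B(2) Int_lower2]])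
    have "(\<lambda>x. indicator A (fst x) :: ennreal) \<in> borel_measurable ?P"
      by measurable
    then have "(\<lambda>x. indicator A (fst x) * emeasure (count_space UNIV) (snd x \<inter> (C \<inter> B)))
      \<in> borel_measurable ?P"
      by (rule borel_measurable_times_ennreal) fact
    also have "(\<lambda>x. indicator A (fst x) * emeasure (count_space UNIV) (snd x \<inter> (C \<inter> B))) =
      (\<lambda>(w, c). emeasure (count_space UNIV) (c \<inter> (Pair w -` E \<inter> B)))"
    proof (rule ext, clarify)
      fix w and c :: "point set"
      show "indicator A (fst (w, c)) * emeasure (count_space UNIV) (snd (w, c) \<inter> (C \<inter> B)) =
        emeasure (count_space UNIV) (c \<inter> (Pair w -` E \<inter> B))"
        by (cases "w \<in> A") (simp_all add: E)
    qed
    finally show ?case .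
  next
    case empty
    then show ?case by simp
  next
    case (compl E)
    have "(\<lambda>x. emeasure (count_space UNIV) (snd x \<inter> B) -
        emeasure (count_space UNIV) (snd x \<inter> (Pair (fst x) -` E \<inter> B))) \<in> borel_measurable ?P"
      by (rule borel_measurable_minus_ennreal[OF cnt[OF B, unfolded split_beta]
            compl(2)[unfolded split_beta]])
    then show ?case
    proof (rule measurable_cong[THEN iffD1, rotated])
      fix x assume x: "x \<in> space ?P"
      have fin: "finite (snd x \<inter> B)"
        using x B by (auto simp: space_pair_measure finite_config_Int)
      have fin': "finite (snd x \<inter> (Pair (fst x) -` E \<inter> B))"
        by (rule finite_subset[OF _ fin]) blast
      have eq: "snd x \<inter> (Pair (fst x) -` (space W \<times> space borel - E) \<inter> B) =
        (snd x \<inter> B) - (snd x \<inter> (Pair (fst x) -` E \<inter> B))"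
        using x by (auto simp: space_pair_measure)
      show "emeasure (count_space UNIV) (snd x \<inter> B) -
        emeasure (count_space UNIV) (snd x \<inter> (Pair (fst x) -` E \<inter> B)) =
        (case x of (w, c) \<Rightarrow> emeasure (count_space UNIV)
          (c \<inter> (Pair w -` (space W \<times> space borel - E) \<inter> B)))"
        unfolding split_beta eq
        by (rule emeasure_Diff[symmetric]) (use fin' in auto)
    qed
  next
    case (union E)
    have "(\<lambda>x. \<Sum>i. emeasure (count_space UNIV) (snd x \<inter> (Pair (fst x) -` E i \<inter> B)))
      \<in> borel_measurable ?P"
      by (rule borel_measurable_suminf_order) (rule union(3)[unfolded split_beta])
    also have "(\<lambda>x. \<Sum>i. emeasure (count_space UNIV) (snd x \<inter> (Pair (fst x) -` E i \<inter> B))) =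
      (\<lambda>(w, c). emeasure (count_space UNIV) (c \<inter> (Pair w -` (\<Union>i. E i) \<inter> B)))"
    proof (rule ext, clarify)
      fix w c
      have "disjoint_family (\<lambda>i. c \<inter> (Pair w -` E i \<inter> B))"
        using union(1) by (auto simp: disjoint_family_on_def)
      then have "(\<Sum>i. emeasure (count_space UNIV) (c \<inter> (Pair w -` E i \<inter> B))) =
        emeasure (count_space UNIV) (\<Union>i. c \<inter> (Pair w -` E i \<inter> B))"
        by (intro suminf_emeasure) auto
      also have "(\<Union>i. c \<inter> (Pair w -` E i \<inter> B)) = c \<inter> (Pair w -` (\<Union>i. E i) \<inter> B)"
        by auto
      finally show "(\<Sum>i. emeasure (count_space UNIV) (snd (w, c) \<inter> (Pair (fst (w, c)) -` E i \<inter> B))) =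
        emeasure (count_space UNIV) (c \<inter> (Pair w -` (\<Union>i. E i) \<inter> B))" by simp
    qed
    finally show ?case .
  }
qed

lemma nn_integral_config_indicator:
  "(\<integral>\<^sup>+T. indicator A T \<partial>count_space c) = emeasure (count_space UNIV) (c \<inter> A)"
proof -
  have "(\<integral>\<^sup>+T. indicator A T \<partial>count_space c) = (\<integral>\<^sup>+T. indicator (c \<inter> A) T \<partial>count_space c)"
    by (rule nn_integral_cong) (simp split: split_indicator)
  also have "\<dots> = emeasure (count_space c) (c \<inter> A)"
    by (rule nn_integral_indicator) simp
  finally show ?thesis by (simp add: emeasure_count_space)
qed

text \<open>Joint measurability in the observer \<open>w\<close> and the configuration is what
  allows the two to be separated by independence. Indicators are exhausted by the windows
  \<open>cball 0 n\<close>; the rest is the usual approximation by simple functions.\<close>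

lemma borel_measurable_config_sum:
  fixes f :: "'a \<times> point \<Rightarrow> ennreal"
  assumes "f \<in> borel_measurable (W \<Otimes>\<^sub>M borel)"
  shows "(\<lambda>(w, c). \<integral>\<^sup>+T. f (w, T) \<partial>count_space c) \<in> borel_measurable (W \<Otimes>\<^sub>M point_configs)"
  using assms
proof (induction rule: borel_measurable_induct)
  case (cong f g)
  have "(\<integral>\<^sup>+T. f (w, T) \<partial>count_space c) = (\<integral>\<^sup>+T. g (w, T) \<partial>count_space c)" if "w \<in> space W" for w c
    by (intro nn_integral_cong cong(3)) (simp add: space_pair_measure that)
  then show ?case
    by (intro measurable_cong[THEN iffD1, OF _ cong(4)]) (auto simp: space_pair_measure)
next
  case (set E)
  have "(\<lambda>x. SUP n::nat. emeasure (count_space UNIV) (snd x \<inter> (Pair (fst x) -` E \<inter> cball 0 n)))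
    \<in> borel_measurable (W \<Otimes>\<^sub>M point_configs)"
    using borel_measurable_section_count[OF set, of "cball 0 (real n)" for n]
    by (intro borel_measurable_SUP) (auto simp: split_beta)
  also have "(\<lambda>x. SUP n::nat. emeasure (count_space UNIV) (snd x \<inter> (Pair (fst x) -` E \<inter> cball 0 n))) =
    (\<lambda>(w, c). \<integral>\<^sup>+T. indicator E (w, T) \<partial>count_space c)"
  proof (rule ext, clarify)
    fix w and c :: "point set"
    have "(\<integral>\<^sup>+T. indicator E (w, T) \<partial>count_space c) = (\<integral>\<^sup>+T. indicator (Pair w -` E) T \<partial>count_space c)"
      by (intro nn_integral_cong) (auto split: split_indicator)
    then show "(SUP n::nat. emeasure (count_space UNIV) (snd (w, c) \<inter> (Pair (fst (w, c)) -` E \<inter> cball 0 n))) =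
      (\<integral>\<^sup>+T. indicator E (w, T) \<partial>count_space c)"
      by (simp only: nn_integral_config_indicator emeasure_config_eq_SUP[symmetric] fst_conv snd_conv)
  qed
  finally show ?case .
next
  case (mult f c)
  then have [measurable]: "(\<lambda>x. \<integral>\<^sup>+T. f (fst x, T) \<partial>count_space (snd x)) \<in> borel_measurable (W \<Otimes>\<^sub>M point_configs)"
    by (simp add: split_beta)
  show ?case by (simp add: nn_integral_cmult split_beta)
next
  case (add f g)
  then have [measurable]: "(\<lambda>x. \<integral>\<^sup>+T. f (fst x, T) \<partial>count_space (snd x)) \<in> borel_measurable (W \<Otimes>\<^sub>M point_configs)"
    "(\<lambda>x. \<integral>\<^sup>+T. g (fst x, T) \<partial>count_space (snd x)) \<in> borel_measurable (W \<Otimes>\<^sub>M point_configs)"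
    by (simp_all add: split_beta)
  show ?case by (simp add: nn_integral_add split_beta)
next
  case (seq F)
  have "incseq (\<lambda>i T. F i (w, T))" for w
    using seq(3) by (auto simp: incseq_def le_fun_def)
  then have eq: "(\<integral>\<^sup>+T. (SUP i. F i (w, T)) \<partial>count_space c) = (SUP i. \<integral>\<^sup>+T. F i (w, T) \<partial>count_space c)" for w c
    by (rule nn_integral_monotone_convergence_SUP) simp
  have "(\<lambda>x. SUP i. \<integral>\<^sup>+T. F i (fst x, T) \<partial>count_space (snd x)) \<in> borel_measurable (W \<Otimes>\<^sub>M point_configs)"
    using seq(5) by (intro borel_measurable_SUP) (auto simp: split_beta)
  then show ?case by (simp add: eq split_beta image_comp)
qed

section \<open>Poisson processes\<close>

lemma poisson_process_measurable: "poisson_process M l N \<Longrightarrow> N \<in> M \<rightarrow>\<^sub>M point_configs"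
  by (simp add: poisson_process_def)

lemma poisson_process_config:
  "poisson_process M l N \<Longrightarrow> x \<in> space M \<Longrightarrow> N x \<in> space point_configs"
  by (rule measurable_space[OF poisson_process_measurable])

lemma poisson_process_measurable_card:
  assumes "poisson_process M l N" "A \<in> sets borel" "bounded A"
  shows "(\<lambda>x. card (N x \<inter> A)) \<in> M \<rightarrow>\<^sub>M count_space UNIV"
  by (rule measurable_compose[OF poisson_process_measurable[OF assms(1)]
        measurable_card_config[OF assms(2,3)]])

lemma poisson_process_card:
  assumes "poisson_process M l N" "A \<in> sets borel" "bounded A"
  shows "measure M {x \<in> space M. card (N x \<inter> A) = k} =
    (l * measure lborel A) ^ k / fact k * exp (- (l * measure lborel A))"
  using assms by (simp add: poisson_process_def)

text \<open>For \<open>k \<ge> 1\<close> the factor \<open>k\<close> cancels against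
  \<open>fact k\<close>, which leaves a shifted exponential series.\<close>

lemma poisson_mean_sums: "(\<lambda>k. real k * (a ^ k / fact k * exp (- a))) sums a" for a :: real
proof -
  have "(\<lambda>k. a ^ k / fact k) sums exp a"
    using exp_converges[of a] by (simp add: field_simps scaleR_conv_of_real)
  then have "(\<lambda>k. a * exp (- a) * (a ^ k / fact k)) sums (a * exp (- a) * exp a)"
    by (rule sums_mult)
  moreover have "a * exp (- a) * (a ^ k / fact k) =
      real (Suc k) * (a ^ Suc k / fact (Suc k) * exp (- a))" for k
    by (simp add: divide_simps)
  moreover have "a * exp (- a) * exp a = a"
    by (simp add: mult.assoc flip: exp_add)
  ultimately have "(\<lambda>k. real (Suc k) * (a ^ Suc k / fact (Suc k) * exp (- a))) sums a"
    by (simp only:)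
  then show ?thesis
    by (subst (asm) sums_Suc_iff) simp
qed

lemma (in prob_space) poisson_process_mean:
  assumes P: "poisson_process M l N" and l: "0 \<le> l" and A: "A \<in> sets borel" "bounded A"
  shows "(\<integral>\<^sup>+x. emeasure (count_space UNIV) (N x \<inter> A) \<partial>M) = ennreal l * emeasure lborel A"
proof -
  note card [measurable] = poisson_process_measurable_card[OF P A]
  let ?a = "l * measure lborel A"
  let ?X = "\<lambda>k. {x \<in> space M. card (N x \<inter> A) = k}"
  have a: "0 \<le> ?a" using l by simp
  have X [measurable]: "?X k \<in> sets M" for k
    by measurable
  have "(\<integral>\<^sup>+x. emeasure (count_space UNIV) (N x \<inter> A) \<partial>M) =
    (\<integral>\<^sup>+x. (\<Sum>k. ennreal (real k) * indicator (?X k) x) \<partial>M)"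
  proof (rule nn_integral_cong)
    fix x assume x: "x \<in> space M"
    have "(\<Sum>k. ennreal (real k) * indicator (?X k) x) =
      (\<Sum>k\<in>{card (N x \<inter> A)}. ennreal (real k) * indicator (?X k) x)"
      by (rule suminf_finite) (auto split: split_indicator)
    then show "emeasure (count_space UNIV) (N x \<inter> A) = (\<Sum>k. ennreal (real k) * indicator (?X k) x)"
      using x emeasure_config_eq_card[OF poisson_process_config[OF P x] A(2)]
      by (simp add: ennreal_of_nat_eq_real_of_nat)
  qed
  also have "\<dots> = (\<Sum>k. ennreal (real k) * emeasure M (?X k))"
    by (subst nn_integral_suminf) (simp_all add: nn_integral_cmult_indicator)
  also have "\<dots> = (\<Sum>k. ennreal (real k * (?a ^ k / fact k * exp (- ?a))))"
    using a by (simp only: emeasure_eq_measure poisson_process_card[OF P A] ennreal_mult' of_nat_0_le_iff)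
  also have "\<dots> = ennreal ?a"
    using a by (intro suminf_ennreal_eq poisson_mean_sums) simp
  also have "\<dots> = ennreal l * emeasure lborel A"
    using l A emeasure_bounded_finite[of A] by (simp add: ennreal_mult emeasure_eq_ennreal_measure less_top)
  finally show ?thesis .
qed

lemma poisson_process_measurable_sum:
  fixes g :: "point \<Rightarrow> ennreal"
  assumes P: "poisson_process M l N" and g: "g \<in> borel_measurable borel"
  shows "(\<lambda>x. \<integral>\<^sup>+T. g T \<partial>count_space (N x)) \<in> borel_measurable M"
proof -
  have "(\<lambda>y. g (snd y)) \<in> borel_measurable (M \<Otimes>\<^sub>M borel)"
    by (rule measurable_compose[OF measurable_snd g])
  from borel_measurable_config_sum[OF this]
  have "(\<lambda>y. \<integral>\<^sup>+T. g T \<partial>count_space (snd y)) \<in> borel_measurable (M \<Otimes>\<^sub>M point_configs)"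
    unfolding split_beta snd_conv .
  from measurable_compose[OF measurable_Pair[OF measurable_ident_sets[OF refl]
        poisson_process_measurable[OF P]] this]
  show ?thesis unfolding snd_conv .
qed

text \<open>Linearity and monotone convergence reduce Campbell's formula to mean counts. These are
  known for bounded sets, so a general set is exhausted by its intersections with
  \<open>cball 0 n\<close>.\<close>

lemma (in prob_space) poisson_process_Campbell:
  assumes P: "poisson_process M l N" and l: "0 \<le> l"
    and f: "f \<in> borel_measurable borel"
  shows "(\<integral>\<^sup>+x. (\<integral>\<^sup>+T. f T \<partial>count_space (N x)) \<partial>M) = ennreal l * (\<integral>\<^sup>+T. f T \<partial>lborel)"
proof -
  note meas = poisson_process_measurable_sum[OF P]
  show ?thesis using f
  proof (induction rule: borel_measurable_induct)
    case (cong f g)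
    then have "f = g" by (simp add: fun_eq_iff)
    with cong show ?case by simp
  next
    case (set A)
    have cnt: "(\<lambda>x. emeasure (count_space UNIV) (N x \<inter> (A \<inter> cball 0 (real n)))) \<in> borel_measurable M" for n
      by (rule meas[of "indicator (A \<inter> cball 0 (real n))", unfolded nn_integral_config_indicator])
         (intro borel_measurable_indicator sets.Int set borel_closed closed_cball)
    have inc: "incseq (\<lambda>(n::nat) x. emeasure (count_space UNIV) (N x \<inter> (A \<inter> cball 0 (real n))))"
      by (intro incseq_SucI le_funI emeasure_mono) auto
    have "(\<integral>\<^sup>+x. (\<integral>\<^sup>+T. indicator A T \<partial>count_space (N x)) \<partial>M) =
      (\<integral>\<^sup>+x. (SUP n::nat. emeasure (count_space UNIV) (N x \<inter> (A \<inter> cball 0 (real n)))) \<partial>M)"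
      by (simp only: nn_integral_config_indicator emeasure_config_eq_SUP[symmetric])
    also have "\<dots> = (SUP n::nat. \<integral>\<^sup>+x. emeasure (count_space UNIV) (N x \<inter> (A \<inter> cball 0 (real n))) \<partial>M)"
      by (rule nn_integral_monotone_convergence_SUP[OF inc cnt])
    also have "\<dots> = (SUP n::nat. ennreal l * emeasure lborel (A \<inter> cball 0 (real n)))"
      using set by (subst poisson_process_mean[OF P l]) (simp_all add: bounded_Int)
    also have "\<dots> = ennreal l * (SUP n::nat. emeasure lborel (A \<inter> cball 0 (real n)))"
      by (rule SUP_mult_left_ennreal[symmetric])
    also have "(SUP n::nat. emeasure lborel (A \<inter> cball 0 (real n))) =
        emeasure lborel (\<Union>n::nat. A \<inter> cball 0 (real n))"
      using set by (intro SUP_emeasure_incseq) (auto intro!: incseq_SucI)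
    also have "(\<Union>n::nat. A \<inter> cball 0 (real n)) = A"
      by (auto simp: real_arch_simple)
    finally show ?case using set by simp
  next
    case (mult f c)
    then show ?case by (simp add: nn_integral_cmult meas mult.left_commute)
  next
    case (add f g)
    then show ?case by (simp add: nn_integral_add meas distrib_left)
  next
    case (seq F)
    have inc: "incseq (\<lambda>i x. \<integral>\<^sup>+T. F i T \<partial>count_space (N x))"
      using seq(3) by (auto simp: incseq_def le_fun_def intro!: nn_integral_mono)
    have "(\<integral>\<^sup>+x. (\<integral>\<^sup>+T. (SUP i. F i T) \<partial>count_space (N x)) \<partial>M) =
        (\<integral>\<^sup>+x. (SUP i. \<integral>\<^sup>+T. F i T \<partial>count_space (N x)) \<partial>M)"
      using seq(3) by (simp add: nn_integral_monotone_convergence_SUP)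
    also have "\<dots> = (SUP i. \<integral>\<^sup>+x. (\<integral>\<^sup>+T. F i T \<partial>count_space (N x)) \<partial>M)"
      using seq(1) by (intro nn_integral_monotone_convergence_SUP[OF inc] meas) simp
    also have "\<dots> = (SUP i. ennreal l * (\<integral>\<^sup>+T. F i T \<partial>lborel))"
      by (simp only: seq(5))
    also have "\<dots> = ennreal l * (SUP i. \<integral>\<^sup>+T. F i T \<partial>lborel)"
      by (rule SUP_mult_left_ennreal[symmetric])
    also have "(SUP i. \<integral>\<^sup>+T. F i T \<partial>lborel) = (\<integral>\<^sup>+T. (SUP i. F i T) \<partial>lborel)"
      using seq(1,3) by (intro nn_integral_monotone_convergence_SUP[symmetric]) auto
    finally show ?case by (simp add: image_comp)
  qed
qed

section \<open>The integral of the truncated path loss over the plane\<close>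

lemma powr_tail_integral:
  fixes r c :: real
  assumes "0 < r" "c < -1"
  shows "(\<integral>\<^sup>+t. ennreal (t powr c) * indicator {r..} t \<partial>lborel) = ennreal (r powr (c + 1) / (- c - 1))"
proof -
  have lim: "((\<lambda>t. t powr (c + 1) / (c + 1)) \<longlongrightarrow> 0 / (c + 1)) at_top"
    using assms by (intro tendsto_divide tendsto_neg_powr tendsto_const filterlim_ident) auto
  have "(\<integral>\<^sup>+t. ennreal (t powr c) * indicator {r..} t \<partial>lborel) =
      ennreal (0 / (c + 1) - r powr (c + 1) / (c + 1))"
  proof (rule nn_integral_FTC_atLeast[OF _ _ _ lim])
    fix t assume "r \<le> t"
    then have "((\<lambda>t. t powr (c + 1) / (c + 1)) has_real_derivative
        (c + 1) * t powr (c + 1 - 1) / (c + 1)) (at t)"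
      using assms by (intro DERIV_cdivide has_real_derivative_powr) simp
    then show "((\<lambda>t. t powr (c + 1) / (c + 1)) has_real_derivative t powr c) (at t)"
      using assms by simp
  qed (use assms in auto)
  also have "0 / (c + 1) - r powr (c + 1) / (c + 1) = r powr (c + 1) / (- c - 1)"
    using assms by (simp add: field_simps)
  finally show ?thesis .
qed

lemma emeasure_cball_point:
  fixes u :: point
  assumes "0 \<le> r"
  shows "emeasure lborel (cball u r) = ennreal (pi * r\<^sup>2)"
  using emeasure_cball[OF assms, of u] by (simp add: unit_ball_vol_2)

text \<open>The constant is the contribution of the disc of radius \<open>\<nu>\<close> plus that of
  its complement: \<open>pi * \<nu> powr (2 - \<beta>) + 2 * pi * \<nu> powr (2 - \<beta>) /
  (\<beta> - 2)\<close>.\<close>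

lemma nn_integral_truncated_path_loss:
  fixes u :: point
  assumes \<nu>: "0 < \<nu>" and \<beta>: "2 < \<beta>"
  shows "(\<integral>\<^sup>+T. ennreal (max (dist T u) \<nu> powr (- \<beta>)) \<partial>lborel) =
    ennreal (pi * \<nu> powr (2 - \<beta>) / (1 - 2 / \<beta>))"
proof -
  \<comment> \<open>layer cake: the path loss is an integral of indicators of discs\<close>
  let ?g = "\<lambda>T r. ennreal (\<beta> * r powr (- \<beta> - 1)) * indicator {(T, r). dist T u \<le> r \<and> \<nu> \<le> r} (T, r)"
  have layer: "ennreal (max (dist T u) \<nu> powr (- \<beta>)) = (\<integral>\<^sup>+r. ?g T r \<partial>lborel)" for T
  proof -
    let ?m = "max (dist T u) \<nu>"
    have "(\<integral>\<^sup>+r. ?g T r \<partial>lborel) =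
        (\<integral>\<^sup>+r. ennreal \<beta> * (ennreal (r powr (- \<beta> - 1)) * indicator {?m..} r) \<partial>lborel)"
      using \<beta> by (intro nn_integral_cong) (auto simp: ennreal_mult split: split_indicator)
    also have "\<dots> = ennreal \<beta> * ennreal (?m powr (- \<beta> - 1 + 1) / (- (- \<beta> - 1) - 1))"
      using \<nu> \<beta> by (subst nn_integral_cmult) (simp_all add: powr_tail_integral)
    also have "\<dots> = ennreal (?m powr (- \<beta>))"
      using \<beta> by (simp flip: ennreal_mult)
    finally show ?thesis ..
  qed
  have "(\<integral>\<^sup>+T. ennreal (max (dist T u) \<nu> powr (- \<beta>)) \<partial>lborel) = (\<integral>\<^sup>+T. \<integral>\<^sup>+r. ?g T r \<partial>lborel \<partial>lborel)"
    by (simp only: layer)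
  also have "\<dots> = (\<integral>\<^sup>+r. \<integral>\<^sup>+T. ?g T r \<partial>lborel \<partial>lborel)"
    by (rule lborel_pair.Fubini'[symmetric]) measurable
  also have "\<dots> = (\<integral>\<^sup>+r. ennreal (\<beta> * pi) * (ennreal (r powr (1 - \<beta>)) * indicator {\<nu>..} r) \<partial>lborel)"
  proof (rule nn_integral_cong)
    fix r :: real
    show "(\<integral>\<^sup>+T. ?g T r \<partial>lborel) = ennreal (\<beta> * pi) * (ennreal (r powr (1 - \<beta>)) * indicator {\<nu>..} r)"
    proof (cases "\<nu> \<le> r")
      case True
      have "(\<integral>\<^sup>+T. ?g T r \<partial>lborel) = (\<integral>\<^sup>+T. ennreal (\<beta> * r powr (- \<beta> - 1)) * indicator (cball u r) T \<partial>lborel)"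
        using True by (intro nn_integral_cong) (auto simp: dist_commute split: split_indicator)
      also have "\<dots> = ennreal (\<beta> * r powr (- \<beta> - 1)) * ennreal (pi * r\<^sup>2)"
        using True \<nu> by (simp add: nn_integral_cmult_indicator emeasure_cball_point)
      also have "\<dots> = ennreal (\<beta> * pi * (r powr (- \<beta> - 1) * r powr 2))"
        using True \<nu> \<beta> by (simp flip: ennreal_mult add: mult_ac powr_numeral)
      also have "r powr (- \<beta> - 1) * r powr 2 = r powr (1 - \<beta>)"
        by (simp flip: powr_add)
      finally show ?thesis using True \<beta> by (simp add: ennreal_mult)
    qed simp
  qed
  also have "\<dots> = ennreal (\<beta> * pi) * ennreal (\<nu> powr (2 - \<beta>) / (\<beta> - 2))"
    using \<nu> \<beta> by (subst nn_integral_cmult) (simp_all add: powr_tail_integral)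
  also have "\<dots> = ennreal (pi * \<nu> powr (2 - \<beta>) / (1 - 2 / \<beta>))"
    using \<beta> by (simp flip: ennreal_mult add: field_simps)
  finally show ?thesis .
qed

text \<open>In \<open>poisson_process\<close> the counts are indexed by the sets themselves. A
  dilation replaces each set by its preimage, so independence over the preimages has to be read as
  independence over the original sets.\<close>

lemma (in prob_space) indep_vars_reindex:
  assumes inj: "inj_on g I" and indep: "indep_vars M' X (g ` I)"
  shows "indep_vars (\<lambda>i. M' (g i)) (\<lambda>i. X (g i)) I"
  unfolding indep_vars_def2
proof
  let ?F = "\<lambda>i. {X i -` A \<inter> space M |A. A \<in> sets (M' i)}"
  show "\<forall>i\<in>I. random_variable (M' (g i)) (X (g i))"
    using indep by (simp add: indep_vars_def2)
  have F: "indep_sets ?F (g ` I)"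
    using indep by (simp add: indep_vars_def2)
  show "indep_sets (\<lambda>i. ?F (g i)) I"
  proof (rule indep_setsI)
    show "?F (g i) \<subseteq> events" if "i \<in> I" for i
      using F that by (auto simp: indep_sets_def)
    fix A J assume J: "J \<noteq> {}" "J \<subseteq> I" "finite J" and A: "\<forall>j\<in>J. A j \<in> ?F (g j)"
    have injJ: "inj_on g J" using inj J(2) by (rule inj_on_subset)
    define A' where "A' k = A (the_inv_into J g k)" for k
    have A': "A' (g j) = A j" if "j \<in> J" for j
      using that injJ by (simp add: A'_def the_inv_into_f_f)
    have "prob (\<Inter>k\<in>g ` J. A' k) = (\<Prod>k\<in>g ` J. prob (A' k))"
      using J A A' by (intro indep_setsD[OF F]) auto
    then show "prob (\<Inter>j\<in>J. A j) = (\<Prod>j\<in>J. prob (A j))"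
      using A' by (simp add: prod.reindex[OF injJ])
  qed
qed

section \<open>Uniqueness of the law of a Poisson process\<close>

lemma (in prob_space) poisson_process_card_vector:
  assumes P: "poisson_process M l N"
    and B: "finite \<B>" "\<B> \<noteq> {}" "disjoint \<B>" "\<And>B. B \<in> \<B> \<Longrightarrow> B \<in> sets borel \<and> bounded B"
  shows "distr M (\<Pi>\<^sub>M B\<in>\<B>. count_space UNIV) (\<lambda>x. \<lambda>B\<in>\<B>. card (N x \<inter> B)) =
    (\<Pi>\<^sub>M B\<in>\<B>. distr M (count_space UNIV) (\<lambda>x. card (N x \<inter> B)))"
proof -
  have "indep_vars (\<lambda>_. count_space UNIV) (\<lambda>B x. card (N x \<inter> B)) \<B>"
    using P B by (auto simp: poisson_process_def)
  then show ?thesis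
    using B by (subst indep_vars_iff_distr_eq_PiM'[symmetric])
      (auto intro: poisson_process_measurable_card[OF P])
qed

lemma poisson_process_card_distr_unique:
  assumes "prob_space M" "prob_space M'" "poisson_process M l N" "poisson_process M' l N'"
    and B: "B \<in> sets borel" "bounded B"
  shows "distr M (count_space UNIV) (\<lambda>x. card (N x \<inter> B)) =
    distr M' (count_space UNIV) (\<lambda>x. card (N' x \<inter> B))"
proof (rule measure_eqI_countable[where A = UNIV])
  interpret M: prob_space M by fact
  interpret M': prob_space M' by fact
  fix k :: nat
  have eq: "(\<lambda>x. card (C x \<inter> B)) -` {k} \<inter> S = {x \<in> S. card (C x \<inter> B) = k}" for C :: "'x \<Rightarrow> point set" and S
    by auto
  show "emeasure (distr M (count_space UNIV) (\<lambda>x. card (N x \<inter> B))) {k} =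
      emeasure (distr M' (count_space UNIV) (\<lambda>x. card (N' x \<inter> B))) {k}"
    by (simp add: emeasure_distr poisson_process_measurable_card[OF assms(3) B]
        poisson_process_measurable_card[OF assms(4) B] eq M.emeasure_eq_measure M'.emeasure_eq_measure
        poisson_process_card[OF assms(3) B] poisson_process_card[OF assms(4) B])
qed auto

text \<open>The product is countable and its singletons are measurable, so every subset is. This is
  what permits arbitrary predicates on count vectors below.\<close>

lemma sets_PiM_count_space_finite:
  assumes "finite I" "A \<subseteq> space (\<Pi>\<^sub>M i\<in>I. count_space (UNIV :: 'b::countable set))"
  shows "A \<in> sets (\<Pi>\<^sub>M i\<in>I. count_space (UNIV :: 'b set))"
proof (rule sets.countable)
  show "countable A"
    using assms by (intro countable_subset[OF _ countable_PiE]) (auto simp: space_PiM)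
  fix f assume "f \<in> A"
  then have "f \<in> extensional I"
    using assms(2) by (auto simp: space_PiM PiE_iff)
  then have "{f} = (\<Pi>\<^sub>E i\<in>I. {f i})"
    by (auto simp: PiE_singleton)
  also have "\<dots> \<in> sets (\<Pi>\<^sub>M i\<in>I. count_space (UNIV :: 'b set))"
    using assms(1) by (intro sets_PiM_I_finite) auto
  finally show "{f} \<in> sets (\<Pi>\<^sub>M i\<in>I. count_space (UNIV :: 'b set))" .
qed

text \<open>The definition of a Poisson process gives independence only for disjoint sets, so counts on
  overlapping sets \<open>\<A>\<close> are written as sums of counts on the atoms of the partition generated by \<open>\<A>\<close>.\<close>

definition atom :: "'a set set \<Rightarrow> 'a set set \<Rightarrow> 'a set" where
  "atom \<A> J = {p \<in> \<Union>\<A>. {A \<in> \<A>. p \<in> A} = J}"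

lemma disjoint_atoms: "disjoint (atom \<A> ` \<J>)"
  by (auto simp: disjoint_def atom_def)

lemma eq_Union_atoms:
  assumes "A \<in> \<A>"
  shows "A = \<Union>{B \<in> atom \<A> ` Pow \<A>. B \<subseteq> A}"
proof
  show "A \<subseteq> \<Union>{B \<in> atom \<A> ` Pow \<A>. B \<subseteq> A}"
  proof
    fix p assume p: "p \<in> A"
    let ?B = "atom \<A> {A \<in> \<A>. p \<in> A}"
    have "p \<in> ?B" using p assms by (auto simp: atom_def)
    moreover have "?B \<subseteq> A" using p assms by (auto simp: atom_def)
    moreover have "?B \<in> atom \<A> ` Pow \<A>" by (rule imageI) simp
    ultimately show "p \<in> \<Union>{B \<in> atom \<A> ` Pow \<A>. B \<subseteq> A}" by (intro UnionI CollectI conjI)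
  qed
qed auto

lemma sets_atom:
  assumes "finite \<A>" "\<A> \<subseteq> sets M"
  shows "atom \<A> J \<in> sets M"
proof (cases "J \<subseteq> \<A>")
  case True
  \<comment> \<open>The case split is needed because \<open>\<Inter>{}\<close> is the whole space,
    while atoms only partition the union of the family.\<close>
  have "atom \<A> J = (if J = {} then {} else (\<Inter>J - \<Union>(\<A> - J)))"
    using True by (auto simp: atom_def)
  also have "\<dots> \<in> sets M"
  proof (cases "J = {}")
    case False
    have "finite J" using True assms(1) by (rule finite_subset)
    then have "\<Inter>J \<in> sets M"
      using sets.finite_INT[of J "\<lambda>A. A" M] False True assms(2) by auto
    moreover have "\<Union>(\<A> - J) \<in> sets M"
      using assms by (intro sets.finite_Union) auto
    ultimately show ?thesis using False by simp
  qed simp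
  finally show ?thesis .
next
  case False
  then have "atom \<A> J = {}" by (auto simp: atom_def)
  then show ?thesis by simp
qed

lemma card_config_eq_sum_atoms:
  assumes c: "c \<in> space point_configs" and A: "finite \<A>" "\<And>A. A \<in> \<A> \<Longrightarrow> bounded A" "A \<in> \<A>"
  shows "card (c \<inter> A) = (\<Sum>B\<in>{B \<in> atom \<A> ` Pow \<A>. B \<subseteq> A}. card (c \<inter> B))"
proof -
  let ?\<B> = "{B \<in> atom \<A> ` Pow \<A>. B \<subseteq> A}"
  have "c \<inter> A = (\<Union>B\<in>?\<B>. c \<inter> B)"
    by (subst eq_Union_atoms[OF A(3)]) (rule Int_Union)
  also have "card \<dots> = (\<Sum>B\<in>?\<B>. card (c \<inter> B))"
  proof (rule card_UN_disjoint)
    show "finite ?\<B>" using A(1) by simp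
    show "\<forall>B\<in>?\<B>. finite (c \<inter> B)"
      using finite_config_Int[OF c A(2)[OF A(3)]] by (auto intro: finite_subset[rotated])
    show "\<forall>B\<in>?\<B>. \<forall>B'\<in>?\<B>. B \<noteq> B' \<longrightarrow> (c \<inter> B) \<inter> (c \<inter> B') = {}"
      using disjoint_atoms[of \<A> "Pow \<A>"] unfolding disjoint_def by blast
  qed
  finally show ?thesis .
qed

text \<open>An arbitrary predicate \<open>Q\<close> on the count vector, rather than one value per
  set, makes the class stable under intersection even when the two families of sets overlap.\<close>

definition config_cylinder ::
    "point set set \<Rightarrow> ((point set \<Rightarrow> nat) \<Rightarrow> bool) \<Rightarrow> point set set" where
  "config_cylinder \<A> Q = {c \<in> space point_configs. Q (\<lambda>A\<in>\<A>. card (c \<inter> A))}"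

lemma measurable_card_config_vector:
  assumes "\<And>A. A \<in> \<A> \<Longrightarrow> A \<in> sets borel \<and> bounded A"
  shows "(\<lambda>c. \<lambda>A\<in>\<A>. card (c \<inter> A)) \<in> point_configs \<rightarrow>\<^sub>M (\<Pi>\<^sub>M A\<in>\<A>. count_space UNIV)"
  using assms by (intro measurable_restrict measurable_card_config) auto

lemma sets_config_cylinder:
  assumes "finite \<A>" "\<And>A. A \<in> \<A> \<Longrightarrow> A \<in> sets borel \<and> bounded A"
  shows "config_cylinder \<A> Q \<in> sets point_configs"
proof -
  let ?S = "{f \<in> space (\<Pi>\<^sub>M A\<in>\<A>. count_space UNIV). Q f}"
  have "config_cylinder \<A> Q = (\<lambda>c. \<lambda>A\<in>\<A>. card (c \<inter> A)) -` ?S \<inter> space point_configs"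
    using measurable_space[OF measurable_card_config_vector[OF assms(2)]]
    by (auto simp: config_cylinder_def)
  also have "\<dots> \<in> sets point_configs"
    by (rule measurable_sets[OF measurable_card_config_vector[OF assms(2)]
          sets_PiM_count_space_finite[OF assms(1)]]) auto
  finally show ?thesis .
qed

text \<open>Rewritten in terms of the disjoint atoms, the counts are independent, so the probability
  depends only on the laws of the single counts.\<close>

lemma (in prob_space) poisson_process_cylinder:
  assumes P: "poisson_process M l N" and A: "finite \<A>" "\<And>A. A \<in> \<A> \<Longrightarrow> A \<in> sets borel \<and> bounded A"
  defines "\<B> \<equiv> atom \<A> ` Pow \<A>"
  shows "emeasure (distr M point_configs N) (config_cylinder \<A> Q) =
    emeasure (\<Pi>\<^sub>M B\<in>\<B>. distr M (count_space UNIV) (\<lambda>x. card (N x \<inter> B)))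
      {f \<in> \<Pi>\<^sub>E B\<in>\<B>. UNIV. Q (\<lambda>A\<in>\<A>. \<Sum>B\<in>{B \<in> \<B>. B \<subseteq> A}. f B)}"
    (is "_ = emeasure _ ?S")
proof -
  have \<B>: "finite \<B>" "\<B> \<noteq> {}" "disjoint \<B>" "\<And>B. B \<in> \<B> \<Longrightarrow> B \<in> sets borel \<and> bounded B"
  proof -
    show "finite \<B>" "\<B> \<noteq> {}" "disjoint \<B>"
      using A(1) disjoint_atoms by (auto simp: \<B>_def)
    fix B assume "B \<in> \<B>"
    then obtain J where J: "B = atom \<A> J" by (auto simp: \<B>_def)
    have "bounded (\<Union>\<A>)" using A by (intro bounded_Union) auto
    then have "bounded B" by (rule bounded_subset) (auto simp: J atom_def)
    moreover have "B \<in> sets borel"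
      unfolding J using A by (intro sets_atom) auto
    ultimately show "B \<in> sets borel \<and> bounded B" by simp
  qed
  note N = poisson_process_measurable[OF P]
  have vec: "(\<lambda>x. \<lambda>B\<in>\<B>. card (N x \<inter> B)) \<in> M \<rightarrow>\<^sub>M (\<Pi>\<^sub>M B\<in>\<B>. count_space UNIV)"
    by (rule measurable_compose[OF N measurable_card_config_vector[OF \<B>(4)]])
  have S: "?S \<in> sets (\<Pi>\<^sub>M B\<in>\<B>. count_space UNIV)"
    by (rule sets_PiM_count_space_finite[OF \<B>(1)]) (auto simp: space_PiM)
  have "emeasure (distr M point_configs N) (config_cylinder \<A> Q) =
    emeasure M (N -` config_cylinder \<A> Q \<inter> space M)"
    by (rule emeasure_distr[OF N sets_config_cylinder[OF A]])
  also have "N -` config_cylinder \<A> Q \<inter> space M =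
    (\<lambda>x. \<lambda>B\<in>\<B>. card (N x \<inter> B)) -` ?S \<inter> space M"
  proof -
    have "N x \<in> config_cylinder \<A> Q \<longleftrightarrow> (\<lambda>B\<in>\<B>. card (N x \<inter> B)) \<in> ?S" if x: "x \<in> space M" for x
    proof -
      note c = poisson_process_config[OF P x]
      have "(\<lambda>A\<in>\<A>. card (N x \<inter> A)) =
          (\<lambda>A\<in>\<A>. \<Sum>B\<in>{B \<in> \<B>. B \<subseteq> A}. (\<lambda>B\<in>\<B>. card (N x \<inter> B)) B)"
      proof (rule restrict_ext)
        fix A' assume A': "A' \<in> \<A>"
        show "card (N x \<inter> A') = (\<Sum>B\<in>{B \<in> \<B>. B \<subseteq> A'}. (\<lambda>B\<in>\<B>. card (N x \<inter> B)) B)"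
          unfolding card_config_eq_sum_atoms[OF c A(1) conjunct2[OF A(2)] A', simplified] \<B>_def
          by (rule sum.cong) auto
      qed
      then show ?thesis using c by (auto simp: config_cylinder_def)
    qed
    then show ?thesis by auto
  qed
  also have "emeasure M \<dots> =
      emeasure (distr M (\<Pi>\<^sub>M B\<in>\<B>. count_space UNIV) (\<lambda>x. \<lambda>B\<in>\<B>. card (N x \<inter> B))) ?S"
    by (rule emeasure_distr[OF vec S, symmetric])
  also have "distr M (\<Pi>\<^sub>M B\<in>\<B>. count_space UNIV) (\<lambda>x. \<lambda>B\<in>\<B>. card (N x \<inter> B)) =
      (\<Pi>\<^sub>M B\<in>\<B>. distr M (count_space UNIV) (\<lambda>x. card (N x \<inter> B)))"
    by (rule poisson_process_card_vector[OF P \<B>])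
  finally show ?thesis .
qed

lemma sets_point_configs_eq_cylinders:
  "sets point_configs = sigma_sets (space point_configs)
    {config_cylinder \<A> Q | \<A> Q. finite \<A> \<and> (\<forall>A\<in>\<A>. A \<in> sets borel \<and> bounded A)}"
    (is "_ = sigma_sets _ ?E")
proof
  let ?G = "{{c. (\<forall>B. bounded B \<longrightarrow> finite (c \<inter> B)) \<and> card (c \<inter> A) = k} | A k.
    A \<in> sets borel \<and> bounded (A :: point set)}"
  have "sets point_configs = sigma_sets (space point_configs) ?G"
    unfolding space_point_configs unfolding point_configs_def by (rule sets_measure_of) auto
  also have "\<dots> \<subseteq> sigma_sets (space point_configs) ?E"
  proof (rule sigma_sets_mono')
    show "?G \<subseteq> ?E"
    proof clarify
      fix A :: "point set" and k assume A: "A \<in> sets borel" "bounded A"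
      have "{c. (\<forall>B. bounded B \<longrightarrow> finite (c \<inter> B)) \<and> card (c \<inter> A) = k} =
          config_cylinder {A} (\<lambda>f. f A = k)"
        by (simp add: config_cylinder_def space_point_configs)
      then show "\<exists>\<A> Q. {c. (\<forall>B. bounded B \<longrightarrow> finite (c \<inter> B)) \<and> card (c \<inter> A) = k} =
          config_cylinder \<A> Q \<and> finite \<A> \<and> (\<forall>A\<in>\<A>. A \<in> sets borel \<and> bounded A)"
        using A by (intro exI[of _ "{A}"] exI[of _ "\<lambda>f. f A = k"]) simp
    qed
  qed
  finally show "sets point_configs \<subseteq> sigma_sets (space point_configs) ?E" .
  show "sigma_sets (space point_configs) ?E \<subseteq> sets point_configs"
    by (rule sets.sigma_sets_subset) (auto intro!: sets_config_cylinder)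
qed

text \<open>Cylinders form a generator stable under intersection, and their probabilities are
  determined by the laws of single counts, which the density prescribes.\<close>

lemma poisson_process_distr_unique:
  assumes "prob_space M" "prob_space M'" "poisson_process M l N" "poisson_process M' l N'"
  shows "distr M point_configs N = distr M' point_configs N'"
proof (rule measure_eqI_generator_eq[where A = "\<lambda>_. space point_configs" and \<Omega> = "space point_configs"])
  interpret M: prob_space M by fact
  interpret M': prob_space M' by fact
  let ?E = "{config_cylinder \<A> Q | \<A> Q. finite \<A> \<and> (\<forall>A\<in>\<A>. A \<in> sets borel \<and> bounded A)}"
  show "Int_stable ?E"
  proof (rule Int_stableI, clarify)
    fix \<A> \<A>' :: "point set set" and Q Q'
    assume A: "finite \<A>" "\<forall>A\<in>\<A>. A \<in> sets borel \<and> bounded A"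
      "finite \<A>'" "\<forall>A\<in>\<A>'. A \<in> sets borel \<and> bounded A"
    have "(\<lambda>A\<in>\<C>. (\<lambda>A\<in>\<A> \<union> \<A>'. card (c \<inter> A)) A) = (\<lambda>A\<in>\<C>. card (c \<inter> A))"
      if "\<C> = \<A> \<or> \<C> = \<A>'" for \<C> c
      using that by (intro restrict_ext) auto
    then have "config_cylinder \<A> Q \<inter> config_cylinder \<A>' Q' =
      config_cylinder (\<A> \<union> \<A>') (\<lambda>f. Q (\<lambda>A\<in>\<A>. f A) \<and> Q' (\<lambda>A\<in>\<A>'. f A))"
      by (auto simp: config_cylinder_def simp del: restrict_apply)
    then show "\<exists>\<A>'' Q''. config_cylinder \<A> Q \<inter> config_cylinder \<A>' Q' = config_cylinder \<A>'' Q'' \<and>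
        finite \<A>'' \<and> (\<forall>A\<in>\<A>''. A \<in> sets borel \<and> bounded A)"
      using A by (intro exI[of _ "\<A> \<union> \<A>'"]
          exI[of _ "\<lambda>f. Q (\<lambda>A\<in>\<A>. f A) \<and> Q' (\<lambda>A\<in>\<A>'. f A)"]) auto
  qed
  show "?E \<subseteq> Pow (space point_configs)"
    by (auto simp: config_cylinder_def)
  fix X assume "X \<in> ?E"
  then obtain \<A> Q where X: "X = config_cylinder \<A> Q"
    and A: "finite \<A>" "\<And>A. A \<in> \<A> \<Longrightarrow> A \<in> sets borel \<and> bounded A" by auto
  have "(\<Pi>\<^sub>M B\<in>atom \<A> ` Pow \<A>. distr M (count_space UNIV) (\<lambda>x. card (N x \<inter> B))) =
    (\<Pi>\<^sub>M B\<in>atom \<A> ` Pow \<A>. distr M' (count_space UNIV) (\<lambda>x. card (N' x \<inter> B)))"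
  proof (rule PiM_cong[OF refl], clarify)
    fix J assume "J \<subseteq> \<A>"
    have "bounded (\<Union>\<A>)" using A by (intro bounded_Union) auto
    then have "bounded (atom \<A> J)" by (rule bounded_subset) (auto simp: atom_def)
    moreover have "atom \<A> J \<in> sets borel"
      using A by (intro sets_atom) auto
    ultimately show "distr M (count_space UNIV) (\<lambda>x. card (N x \<inter> atom \<A> J)) =
        distr M' (count_space UNIV) (\<lambda>x. card (N' x \<inter> atom \<A> J))"
      by (intro poisson_process_card_distr_unique[OF assms])
  qed
  then show "emeasure (distr M point_configs N) X = emeasure (distr M' point_configs N') X"
    unfolding X
    by (simp add: M.poisson_process_cylinder[OF assms(3) A] M'.poisson_process_cylinder[OF assms(4) A])
next
  have "config_cylinder {} (\<lambda>_. True) = space point_configs"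
    by (simp add: config_cylinder_def)
  then show "range (\<lambda>_. space point_configs) \<subseteq>
    {config_cylinder \<A> Q | \<A> Q. finite \<A> \<and> (\<forall>A\<in>\<A>. A \<in> sets borel \<and> bounded A)}"
    by (intro image_subsetI CollectI exI[of _ "{}"] exI[of _ "\<lambda>_. True"]) simp
  show "emeasure (distr M point_configs N) (space point_configs) \<noteq> \<infinity>"
    using prob_space.emeasure_space_1[OF prob_space.prob_space_distr[OF assms(1)
          poisson_process_measurable[OF assms(3)]]] by simp
qed (simp_all add: sets_point_configs_eq_cylinders)

section \<open>Dilation of a Poisson process\<close>

lemma emeasure_lborel_vimage_scaleR:
  fixes A :: "point set"
  assumes s: "s \<noteq> 0" and A: "A \<in> sets borel"
  shows "emeasure lborel A = ennreal (s\<^sup>2) * emeasure lborel ((\<lambda>p. s *\<^sub>R p) -` A)"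
proof -
  have "emeasure lborel A =
      emeasure (density (distr lborel borel (\<lambda>p::point. 0 + s *\<^sub>R p)) (\<lambda>_. ennreal (\<bar>s\<bar> ^ DIM(point)))) A"
    by (subst lborel_affine[OF s, of 0]) (rule refl)
  also have "\<dots> = ennreal (\<bar>s\<bar> ^ DIM(point)) * emeasure lborel ((\<lambda>p. s *\<^sub>R p) -` A)"
    using A by (subst emeasure_density_const) (simp_all add: emeasure_distr)
  finally show ?thesis by simp
qed

lemma card_scaleR_image_Int:
  fixes c A :: "point set"
  assumes "s \<noteq> 0"
  shows "card ((\<lambda>p. s *\<^sub>R p) ` c \<inter> A) = card (c \<inter> (\<lambda>p. s *\<^sub>R p) -` A)"
proof -
  have "(\<lambda>p. s *\<^sub>R p) ` c \<inter> A = (\<lambda>p. s *\<^sub>R p) ` (c \<inter> (\<lambda>p. s *\<^sub>R p) -` A)"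
    by auto
  then show ?thesis
    using assms by (simp add: card_image inj_on_def)
qed

lemma bounded_vimage_scaleR:
  fixes A :: "point set"
  assumes "s \<noteq> 0" "bounded A"
  shows "bounded ((\<lambda>p. s *\<^sub>R p) -` A)"
proof -
  have "(\<lambda>p. s *\<^sub>R p) -` A \<subseteq> (\<lambda>p. inverse s *\<^sub>R p) ` A"
    using assms(1) by (auto intro!: image_eqI[where x = "s *\<^sub>R p" for p])
  then show ?thesis
    using bounded_scaling[OF assms(2)] bounded_subset by blast
qed

text \<open>Counting dilated points in \<open>A\<close> is counting original points in the preimage
  of \<open>A\<close>, whose area is that of \<open>A\<close> divided by
  \<open>s\<^sup>2\<close>.\<close>

lemma poisson_process_scaleR:
  assumes M: "prob_space M" and P: "poisson_process M l N" and s: "s > 0"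
  shows "poisson_process M (l / s\<^sup>2) (\<lambda>x. (\<lambda>p. s *\<^sub>R p) ` N x)"
proof -
  interpret prob_space M by fact
  let ?v = "\<lambda>A::point set. (\<lambda>p. s *\<^sub>R p) -` A"
  let ?N = "\<lambda>x. (\<lambda>p. s *\<^sub>R p) ` N x"
  have v: "?v A \<in> sets borel" "bounded (?v A)" if "A \<in> sets borel" "bounded A" for A
    using that s measurable_sets_borel[of "\<lambda>p. s *\<^sub>R p" borel A] by (auto intro!: bounded_vimage_scaleR)
  have card: "card (?N x \<inter> A) = card (N x \<inter> ?v A)" for x A
    using s by (intro card_scaleR_image_Int) simp
  have "?N \<in> M \<rightarrow>\<^sub>M point_configs"
  proof (rule measurable_into_point_configs)
    fix x assume x: "x \<in> space M"
    have "finite (?N x \<inter> B)" if "bounded B" for B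
    proof -
      have "?N x \<inter> B = (\<lambda>p. s *\<^sub>R p) ` (N x \<inter> ?v B)" by auto
      then show ?thesis
        using finite_config_Int[OF poisson_process_config[OF P x] bounded_vimage_scaleR[OF _ that]] s
        by simp
    qed
    then show "?N x \<in> space point_configs" by (simp add: space_point_configs)
  next
    fix A :: "point set" assume A: "A \<in> sets borel" "bounded A"
    show "(\<lambda>x. card (?N x \<inter> A)) \<in> M \<rightarrow>\<^sub>M count_space UNIV"
      unfolding card by (rule poisson_process_measurable_card[OF P v[OF A]])
  qed
  moreover have "measure M {x \<in> space M. card (?N x \<inter> B) = k} =
      (l / s\<^sup>2 * measure lborel B) ^ k / fact k * exp (- (l / s\<^sup>2 * measure lborel B))"
    if B: "B \<in> sets borel" "bounded B" for B k
  proof -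
    have "measure lborel B = s\<^sup>2 * measure lborel (?v B)"
      using emeasure_lborel_vimage_scaleR[of s B] s B by (simp add: measure_def enn2real_mult)
    then have "l / s\<^sup>2 * measure lborel B = l * measure lborel (?v B)"
      using s by simp
    then show ?thesis
      unfolding card poisson_process_card[OF P v[OF B]] by (simp only:)
  qed
  moreover have "indep_vars (\<lambda>_. count_space UNIV) (\<lambda>B x. card (?N x \<inter> B)) \<B>"
    if \<B>: "finite \<B>" "disjoint \<B>" "\<forall>B\<in>\<B>. B \<in> sets borel \<and> bounded B" for \<B>
    unfolding card
  proof (rule indep_vars_reindex[where g = ?v and M' = "\<lambda>_. count_space UNIV" and X = "\<lambda>B x. card (N x \<inter> B)"])
    \<comment> \<open>Preimages under a surjection determine the set, so the family of preimages can
      be indexed by the original sets.\<close>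
    have "surj (\<lambda>p::point. s *\<^sub>R p)"
      using s by (intro surjI[where f = "\<lambda>p. inverse s *\<^sub>R p"]) simp
    then show "inj_on ?v \<B>"
      by (metis inj_onI surj_image_vimage_eq)
    have "disjoint (?v ` \<B>)"
      using \<B>(2) by (auto simp: disjoint_def) 
    then show "indep_vars (\<lambda>_. count_space UNIV) (\<lambda>B x. card (N x \<inter> B)) (?v ` \<B>)"
      using P \<B> v by (auto simp: poisson_process_def)
  qed
  ultimately show ?thesis
    by (simp add: poisson_process_def)
qed

section \<open>The law of the uplink network\<close>

abbreviation seq_space :: "(nat \<Rightarrow> point) measure" where
  "seq_space \<equiv> \<Pi>\<^sub>M n\<in>UNIV. borel"

text \<open>Labels increase with distance, so the labels of the stations in a ball around the
  origin, label 0 left out, form such a set.\<close>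

lemma down_closed_eq_atLeastAtMost:
  fixes S :: "nat set"
  assumes "finite S" "S \<subseteq> {1..}" "\<And>k m. m \<in> S \<Longrightarrow> 1 \<le> k \<Longrightarrow> k \<le> m \<Longrightarrow> k \<in> S"
  shows "S = {1..card S}"
proof (cases "S = {}")
  case False
  have "S = {1..Max S}"
  proof
    show "S \<subseteq> {1..Max S}" using assms(1,2) by auto
    show "{1..Max S} \<subseteq> S" using assms(3)[OF Max_in[OF assms(1) False]] by auto
  qed
  then have "card S = Max S" by (metis card_atLeastAtMost diff_Suc_1)
  then show ?thesis using \<open>S = {1..Max S}\<close> by simp
qed simp

text \<open>The event \<open>Y n \<in> A\<close> in terms of counts: for suitable rational radii \<open>a < b\<close>, the point \<open>Y n\<close> is
  the only one with norm in \<open>[a, b)\<close>. This shows that the law of the process determines that of \<open>Y\<close>.\<close>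

definition station_event :: "nat \<Rightarrow> point set \<Rightarrow> point set set" where
  "station_event n A = {c \<in> space point_configs. \<exists>a\<in>\<rat>. \<exists>b\<in>\<rat>.
     card (c \<inter> ball 0 a) = n - 1 \<and> card (c \<inter> ball 0 b) = n \<and>
     card (c \<inter> (A \<inter> (ball 0 b - ball 0 a))) = 1}"

lemma sets_station_event:
  assumes "A \<in> sets borel"
  shows "station_event n A \<in> sets point_configs"
proof -
  let ?E = "\<lambda>B k. {c \<in> space point_configs. card (c \<inter> B) = k}"
  have E: "?E B k \<in> sets point_configs" if "B \<in> sets borel" "bounded B" for B k
  proof -
    have "?E B k = (\<lambda>c. card (c \<inter> B)) -` {k} \<inter> space point_configs" by auto
    then show ?thesis using measurable_sets[OF measurable_card_config[OF that], of "{k}"] by simp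
  qed
  have eq: "station_event n A = (\<Union>a\<in>\<rat>. \<Union>b\<in>\<rat>. ?E (ball 0 a) (n - 1) \<inter> ?E (ball 0 b) n \<inter>
      ?E (A \<inter> (ball 0 b - ball 0 a)) 1)"
    by (auto simp: station_event_def)
  have bnd: "bounded (A \<inter> (ball 0 b - ball 0 a))" for a b :: real
    by (rule bounded_subset[OF bounded_ball]) auto
  show ?thesis
    unfolding eq
    by (intro sets.countable_UN'' countable_rat sets.Int E bnd assms sets.Diff bounded_ball
        borel_open open_ball)
qed

lemma in_station_event_iff:
  fixes y :: "nat \<Rightarrow> point"
  assumes mono: "strict_mono (\<lambda>n. norm (y n))" and c: "c = {y n | n. n \<ge> 1}"
    and fin: "c \<in> space point_configs" and n: "1 \<le> n"
  shows "c \<in> station_event n A \<longleftrightarrow> y n \<in> A"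
proof -
  let ?S = "\<lambda>a. {m. 1 \<le> m \<and> norm (y m) < a}"
  have inj: "inj y"
    using strict_mono_imp_inj_on[OF mono] by (metis injD injI)
  have ball: "c \<inter> ball 0 a = y ` ?S a" for a
    by (auto simp: c)
  have card: "card (c \<inter> ball 0 a) = card (?S a)" for a
    unfolding ball by (rule card_image[OF inj_on_subset[OF inj]]) simp
  have S: "?S a = {1..card (c \<inter> ball 0 a)}" for a
    unfolding card
  proof (rule down_closed_eq_atLeastAtMost)
    have "finite (y ` ?S a)"
      using finite_config_Int[OF fin bounded_ball, of 0 a] unfolding ball .
    then show "finite (?S a)"
      by (rule finite_imageD[OF _ inj_on_subset[OF inj]]) simp
    show "k \<in> ?S a" if "m \<in> ?S a" "1 \<le> k" "k \<le> m" for k m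
      using that strict_mono_less_eq[OF mono, of k m] by auto
  qed auto
  \<comment> \<open>Any radii with these two counts isolate \<open>y n\<close>, so it does not
    matter which witnesses the existential in \<open>station_event\<close> provides.\<close>
  have iff: "card (c \<inter> (A \<inter> (ball 0 b - ball 0 a))) = 1 \<longleftrightarrow> y n \<in> A"
    if ab: "card (c \<inter> ball 0 a) = n - 1" "card (c \<inter> ball 0 b) = n" for a b
  proof -
    have a: "c \<inter> ball 0 a = y ` {1..n - 1}"
      using ball[of a] unfolding S[of a] ab(1) .
    have "c \<inter> ball 0 b = y ` {1..n}"
      using ball[of b] unfolding S[of b] ab(2) .
    also have "{1..n} = insert n {1..n - 1}" using n by auto
    finally have "c \<inter> ball 0 b = insert (y n) (y ` {1..n - 1})" by simp
    moreover have "y n \<notin> y ` {1..n - 1}" using n by (simp add: inj_image_mem_iff[OF inj])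
    ultimately have "(c \<inter> ball 0 b) - (c \<inter> ball 0 a) = {y n}"
      by (simp add: a insert_Diff_if)
    moreover have "c \<inter> (A \<inter> (ball 0 b - ball 0 a)) = A \<inter> ((c \<inter> ball 0 b) - (c \<inter> ball 0 a))"
      by blast
    ultimately have "c \<inter> (A \<inter> (ball 0 b - ball 0 a)) = (if y n \<in> A then {y n} else {})"
      by simp
    then show ?thesis by simp
  qed
  \<comment> \<open>For \<open>n = 1\<close> the lower bound is the norm of \<open>y 0\<close>,
    which is not listed in \<open>c\<close>; the count \<open>n - 1 = 0\<close> agrees with
    this.\<close>
  obtain a where a: "a \<in> \<rat>" "norm (y (n - 1)) < a" "a < norm (y n)"
  proof -
    have "norm (y (n - 1)) < norm (y n)"
      using n by (intro strict_monoD[OF mono]) simp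
    from Rats_dense_in_real[OF this] show thesis
      by (elim bexE conjE) (rule that)
  qed
  obtain b where b: "b \<in> \<rat>" "norm (y n) < b" "b < norm (y (Suc n))"
  proof -
    have "norm (y n) < norm (y (Suc n))"
      by (intro strict_monoD[OF mono]) simp
    from Rats_dense_in_real[OF this] show thesis
      by (elim bexE conjE) (rule that)
  qed
  have "?S a = {1..n - 1}"
  proof (intro set_eqI iffI)
    fix m assume "m \<in> ?S a"
    then show "m \<in> {1..n - 1}"
      using a(3) strict_mono_less[OF mono, of m n] by auto
  next
    fix m assume "m \<in> {1..n - 1}"
    then show "m \<in> ?S a"
      using a(2) strict_mono_less_eq[OF mono, of m "n - 1"] by auto
  qed
  moreover have "?S b = {1..n}"
  proof (intro set_eqI iffI)
    fix m assume "m \<in> ?S b"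
    then show "m \<in> {1..n}"
      using b(3) strict_mono_less[OF mono, of m "Suc n"] by auto
  next
    fix m assume "m \<in> {1..n}"
    then show "m \<in> ?S b"
      using b(2) strict_mono_less_eq[OF mono, of m n] by auto
  qed
  ultimately have ab: "card (c \<inter> ball 0 a) = n - 1" "card (c \<inter> ball 0 b) = n"
    unfolding card by simp_all
  show ?thesis
  proof
    assume "c \<in> station_event n A"
    then show "y n \<in> A" unfolding station_event_def using iff by blast
  next
    assume "y n \<in> A"
    then show "c \<in> station_event n A"
      unfolding station_event_def using fin a(1) b(1) ab iff[OF ab] by blast
  qed
qed

lemma measurable_seq:
  "(\<And>n. f n \<in> borel_measurable M) \<Longrightarrow> (\<lambda>x n. f n x) \<in> M \<rightarrow>\<^sub>M seq_space"
  by (rule measurable_PiM_single') auto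

lemma uplink_measurable:
  assumes "uplink_network M l Y U"
  shows "Y n \<in> borel_measurable M" "U n \<in> borel_measurable M"
    "(\<lambda>x n. Y n x) \<in> M \<rightarrow>\<^sub>M seq_space" "(\<lambda>x n. U n x) \<in> M \<rightarrow>\<^sub>M seq_space"
  using assms by (auto simp: uplink_network_def intro!: measurable_seq)

lemma seq_cylinder:
  "prod_emb UNIV (\<lambda>_. borel) J (\<Pi>\<^sub>E j\<in>J. A j) = {y. \<forall>j\<in>J. y j \<in> A j}"
  by (auto simp: prod_emb_def)

lemma sets_seq_cylinder:
  assumes "finite J" "\<forall>j\<in>J. A j \<in> sets borel"
  shows "{y :: 'i \<Rightarrow> 'a::topological_space. \<forall>j\<in>J. y j \<in> A j} \<in> sets (\<Pi>\<^sub>M n\<in>UNIV. borel)"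
  unfolding seq_cylinder[symmetric] using assms by (intro sets_PiM_I) auto

text \<open>Station 0 is almost surely the origin and contributes a condition free of randomness.
  The other stations are read off the point set, which lists only labels from 1 on. Hence the law of
  the point set determines that of the sequence.\<close>

lemma stations_cylinder:
  assumes "uplink_network M l Y U" and J: "finite J" "\<forall>j\<in>J. A j \<in> sets borel"
  shows "emeasure (distr M seq_space (\<lambda>x n. Y n x)) {y. \<forall>j\<in>J. y j \<in> A j} =
    emeasure (distr M point_configs (\<lambda>x. {Y n x | n. n \<ge> 1}))
      {c \<in> space point_configs. \<forall>j\<in>J. if j = 0 then 0 \<in> A j else c \<in> station_event j (A j)}"
    (is "_ = emeasure (distr M _ ?N) ?S")
proof -
  note Y = uplink_measurable(3)[OF assms(1)]
  have P: "poisson_process M l ?N" and AE: "AE x in M. Y 0 x = 0 \<and> strict_mono (\<lambda>n. norm (Y n x))"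
    using assms(1) by (auto simp: uplink_network_def)
  note N = poisson_process_measurable[OF P]
  have S: "?S \<in> sets point_configs"
  proof -
    have "{c \<in> space point_configs. if j = 0 then 0 \<in> A j else c \<in> station_event j (A j)} \<in> sets point_configs"
      if "j \<in> J" for j
    proof (cases "j = 0")
      case False
      have "{c \<in> space point_configs. c \<in> station_event j (A j)} = station_event j (A j)"
        by (auto simp: station_event_def)
      then show ?thesis using sets_station_event[of "A j" j] J(2) that False by simp
    qed auto
    then show ?thesis by (rule sets.sets_Collect_finite_All[OF _ J(1)])
  qed
  have "emeasure (distr M seq_space (\<lambda>x n. Y n x)) {y. \<forall>j\<in>J. y j \<in> A j} =
      emeasure M ((\<lambda>x n. Y n x) -` {y. \<forall>j\<in>J. y j \<in> A j} \<inter> space M)"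
    by (rule emeasure_distr[OF Y sets_seq_cylinder[OF J]])
  also have "\<dots> = emeasure M (?N -` ?S \<inter> space M)"
  proof (rule emeasure_eq_AE)
    show "AE x in M. x \<in> (\<lambda>x n. Y n x) -` {y. \<forall>j\<in>J. y j \<in> A j} \<inter> space M \<longleftrightarrow> x \<in> ?N -` ?S \<inter> space M"
      using AE AE_space
    proof eventually_elim
      case (elim x)
      note c = poisson_process_config[OF P elim(2)]
      have "?N x \<in> station_event j (A j) \<longleftrightarrow> Y j x \<in> A j" if "j \<noteq> 0" for j
        using in_station_event_iff[OF conjunct2[OF elim(1)] refl c] that by simp
      then show ?case using elim c by auto
    qed
    show "(\<lambda>x n. Y n x) -` {y. \<forall>j\<in>J. y j \<in> A j} \<inter> space M \<in> sets M"
      by (rule measurable_sets[OF Y sets_seq_cylinder[OF J]])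
    show "?N -` ?S \<inter> space M \<in> sets M"
      by (rule measurable_sets[OF N S])
  qed
  also have "\<dots> = emeasure (distr M point_configs ?N) ?S"
    by (rule emeasure_distr[OF N S, symmetric])
  finally show ?thesis .
qed

lemma stations_distr_unique:
  assumes "prob_space M" "prob_space M'" "uplink_network M l Y U" "uplink_network M' l Y' U'"
  shows "distr M seq_space (\<lambda>x n. Y n x) = distr M' seq_space (\<lambda>x n. Y' n x)"
proof (rule measure_eqI_PiM_infinite)
  fix A :: "nat \<Rightarrow> point set" and J :: "nat set"
  assume "finite J" and "\<And>i. i \<in> J \<Longrightarrow> A i \<in> sets borel"
  then have J: "finite J" "\<forall>i\<in>J. A i \<in> sets borel" by auto
  have "distr M point_configs (\<lambda>x. {Y n x | n. n \<ge> 1}) = distr M' point_configs (\<lambda>x. {Y' n x | n. n \<ge> 1})"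
    by (rule poisson_process_distr_unique[OF assms(1,2)])
       (use assms in \<open>auto simp: uplink_network_def\<close>)
  then show "emeasure (distr M seq_space (\<lambda>x n. Y n x)) (prod_emb UNIV (\<lambda>n. borel) J (Pi\<^sub>E J A)) =
      emeasure (distr M' seq_space (\<lambda>x n. Y' n x)) (prod_emb UNIV (\<lambda>n. borel) J (Pi\<^sub>E J A))"
    unfolding seq_cylinder stations_cylinder[OF assms(3) J] stations_cylinder[OF assms(4) J]
    by (simp only:)
next
  show "finite_measure (distr M seq_space (\<lambda>x n. Y n x))"
    by (intro finite_measure.finite_measure_distr prob_space.finite_measure assms
        uplink_measurable[OF assms(3)])
qed simp_all

section \<open>Voronoi cells and the law of the mobiles given the stations\<close>

definition cell_prob :: "(nat \<Rightarrow> point) \<Rightarrow> nat \<Rightarrow> point set \<Rightarrow> ennreal" where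
  "cell_prob y i B = emeasure (uniform_measure lborel (voronoi_cell y i)) B"

lemma closed_voronoi_cell: "closed (voronoi_cell y i)"
  unfolding voronoi_cell_def by (intro closed_Collect_all closed_Collect_le continuous_intros)

lemma sets_voronoi_cell [simp, measurable]: "voronoi_cell y i \<in> sets borel"
  by (rule borel_closed[OF closed_voronoi_cell])

lemma cell_prob_eq:
  "B \<in> sets borel \<Longrightarrow>
    cell_prob y i B = emeasure lborel (voronoi_cell y i \<inter> B) / emeasure lborel (voronoi_cell y i)"
  unfolding cell_prob_def by (rule emeasure_uniform_measure) auto

lemma measurable_coordinate: "(\<lambda>y. y n) \<in> borel_measurable (\<Pi>\<^sub>M n\<in>UNIV. borel)"
  by (rule measurable_component_singleton) simp

lemma sets_voronoi_graph:
  "{x. snd x \<in> voronoi_cell (fst x) i} \<in> sets (seq_space \<Otimes>\<^sub>M borel)"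
proof -
  note measurable_compose[OF measurable_fst measurable_coordinate, measurable]
  have "{x \<in> space (seq_space \<Otimes>\<^sub>M borel). \<forall>m. dist (snd x) (fst x i) \<le> dist (snd x) (fst x m)}
      \<in> sets (seq_space \<Otimes>\<^sub>M borel)"
    by measurable
  then show ?thesis
    by (simp add: voronoi_cell_def space_pair_measure space_PiM)
qed

lemma borel_measurable_cell_volume:
  assumes B: "B \<in> sets borel"
  shows "(\<lambda>y. emeasure lborel (voronoi_cell y i \<inter> B)) \<in> borel_measurable seq_space"
proof -
  let ?G = "{x. snd x \<in> voronoi_cell (fst x) i} \<inter> (UNIV \<times> B)"
  have "UNIV \<times> B \<in> sets (seq_space \<Otimes>\<^sub>M borel)"
    using B by (intro pair_measureI) (auto simp: space_PiM intro: sets.top[of seq_space, simplified])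
  then have "?G \<in> sets (seq_space \<Otimes>\<^sub>M lborel)"
    using sets_voronoi_graph[of i] by (simp cong: sets_pair_measure_cong)
  from lborel.measurable_emeasure_Pair[OF this]
  have "(\<lambda>y. emeasure lborel (Pair y -` ?G)) \<in> borel_measurable seq_space" .
  moreover have "Pair y -` ?G = voronoi_cell y i \<inter> B" for y by auto
  ultimately show ?thesis by simp
qed

lemma borel_measurable_cell_prob:
  assumes B: "B \<in> sets borel"
  shows "(\<lambda>y. cell_prob y i B) \<in> borel_measurable seq_space"
  unfolding cell_prob_eq[OF B]
  using borel_measurable_cell_volume[OF B, of i] borel_measurable_cell_volume[of UNIV i]
  by (intro borel_measurable_divide_ennreal) simp_all

lemma uplink_cond_exp:
  assumes "uplink_network M l Y U" and B: "\<And>i. i < n \<Longrightarrow> B i \<in> sets borel"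
  shows "AE x in M. nn_cond_exp M (sigma_stations M Y) (indicator {x \<in> space M. \<forall>i<n. U i x \<in> B i}) x =
    (\<Prod>i<n. cell_prob (\<lambda>n. Y n x) i (B i))"
proof -
  have "\<forall>n B. (\<forall>i<n. B i \<in> sets borel) \<longrightarrow>
      (AE x in M. nn_cond_exp M (sigma_stations M Y) (indicator {x \<in> space M. \<forall>i<n. U i x \<in> B i}) x =
        (\<Prod>i<n. cell_prob (\<lambda>n. Y n x) i (B i)))"
    using assms(1) unfolding uplink_network_def cell_prob_def by (elim conjE)
  then show ?thesis using B by simp
qed

text \<open>The defining property of conditional expectation, tested against a function
  \<open>f\<close> of the stations. From here on the conditional law is used in this integrated
  form.\<close>

lemma uplink_disintegration:
  assumes M: "prob_space M" and net: "uplink_network M l Y U"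
    and f: "f \<in> borel_measurable seq_space" and B: "\<And>i. i < n \<Longrightarrow> B i \<in> sets borel"
  shows "(\<integral>\<^sup>+x. f (\<lambda>n. Y n x) * indicator {x \<in> space M. \<forall>i<n. U i x \<in> B i} x \<partial>M) =
    (\<integral>\<^sup>+x. f (\<lambda>n. Y n x) * (\<Prod>i<n. cell_prob (\<lambda>n. Y n x) i (B i)) \<partial>M)"
proof -
  interpret prob_space M by fact
  let ?F = "sigma_stations M Y"
  note Y = uplink_measurable(3)[OF net]
  have "subalgebra M ?F"
    unfolding subalgebra_def sigma_stations_def
    using Y by (auto simp: sets_vimage_algebra2 space_PiM measurable_def)
  then interpret finite_measure_subalgebra M ?F
    by unfold_locales
  have fY: "(\<lambda>x. f (\<lambda>n. Y n x)) \<in> borel_measurable ?F"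
    unfolding sigma_stations_def
    by (rule measurable_compose[OF measurable_vimage_algebra1 f]) (simp add: space_PiM)
  have ind: "indicator {x \<in> space M. \<forall>i<n. U i x \<in> B i} \<in> borel_measurable M"
  proof (rule borel_measurable_indicator)
    have B': "{x \<in> space M. U i x \<in> B i} \<in> sets M" if "i \<in> {..<n}" for i
    proof -
      have "{x \<in> space M. U i x \<in> B i} = U i -` B i \<inter> space M" by auto
      then show ?thesis
        using measurable_sets[OF uplink_measurable(2)[OF net, of i] B[of i]] that by simp
    qed
    have "{x \<in> space M. \<forall>i<n. U i x \<in> B i} = {x \<in> space M. \<forall>i\<in>{..<n}. U i x \<in> B i}"
      by blast
    also have "\<dots> \<in> sets M"
      by (rule sets.sets_Collect_finite_All[OF B' finite_lessThan])
    finally show "{x \<in> space M. \<forall>i<n. U i x \<in> B i} \<in> sets M" .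
  qed
  have "(\<integral>\<^sup>+x. f (\<lambda>n. Y n x) * indicator {x \<in> space M. \<forall>i<n. U i x \<in> B i} x \<partial>M) =
    (\<integral>\<^sup>+x. f (\<lambda>n. Y n x) * nn_cond_exp M ?F (indicator {x \<in> space M. \<forall>i<n. U i x \<in> B i}) x \<partial>M)"
    by (rule nn_cond_exp_intg[OF fY ind, symmetric])
  also have "\<dots> = (\<integral>\<^sup>+x. f (\<lambda>n. Y n x) * (\<Prod>i<n. cell_prob (\<lambda>n. Y n x) i (B i)) \<partial>M)"
  proof (rule nn_integral_cong_AE)
    have "AE x in M. nn_cond_exp M ?F (indicator {x \<in> space M. \<forall>i<n. U i x \<in> B i}) x =
        (\<Prod>i<n. cell_prob (\<lambda>n. Y n x) i (B i))"
      by (rule uplink_cond_exp[OF net B])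
    then show "AE x in M. f (\<lambda>n. Y n x) * nn_cond_exp M ?F (indicator {x \<in> space M. \<forall>i<n. U i x \<in> B i}) x =
        f (\<lambda>n. Y n x) * (\<Prod>i<n. cell_prob (\<lambda>n. Y n x) i (B i))"
      by eventually_elim simp
  qed
  finally show ?thesis .
qed

text \<open>The network definition speaks of initial segments of mobiles, so a cylinder over
  \<open>J\<close> is padded with \<open>UNIV\<close> off \<open>J\<close>. For empty
  \<open>J\<close> the value of \<open>Max J\<close> is immaterial.\<close>

lemma mobiles_cylinder:
  assumes M: "prob_space M" and net: "uplink_network M l Y U"
    and J: "finite J" "\<forall>j\<in>J. A j \<in> sets borel"
  defines "B \<equiv> \<lambda>i. if i \<in> J then A i else UNIV"
  shows "emeasure (distr M seq_space (\<lambda>x n. U n x)) {u. \<forall>j\<in>J. u j \<in> A j} =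
    (\<integral>\<^sup>+y. (\<Prod>i<Suc (Max J). cell_prob y i (B i)) \<partial>distr M seq_space (\<lambda>x n. Y n x))"
proof -
  let ?n = "Suc (Max J)"
  have B: "B i \<in> sets borel" for i using J by (simp add: B_def)
  have Jn: "j < ?n" if "j \<in> J" for j using that J(1) by (simp add: less_Suc_eq_le)
  have prod: "(\<lambda>y. \<Prod>i<?n. cell_prob y i (B i)) \<in> borel_measurable seq_space"
    by (intro borel_measurable_prod_ennreal borel_measurable_cell_prob B)
  note U = uplink_measurable(4)[OF net]
  have set: "(\<lambda>x n. U n x) -` {u. \<forall>j\<in>J. u j \<in> A j} \<inter> space M = {x \<in> space M. \<forall>i<?n. U i x \<in> B i}"
    using Jn by (auto simp: B_def)
  have "emeasure (distr M seq_space (\<lambda>x n. U n x)) {u. \<forall>j\<in>J. u j \<in> A j} =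
      emeasure M {x \<in> space M. \<forall>i<?n. U i x \<in> B i}"
    unfolding set[symmetric] by (rule emeasure_distr[OF U sets_seq_cylinder[OF J]])
  also have "\<dots> = (\<integral>\<^sup>+x. 1 * indicator {x \<in> space M. \<forall>i<?n. U i x \<in> B i} x \<partial>M)"
    unfolding mult_1
    by (rule nn_integral_indicator[symmetric]) (rule measurable_sets[OF U sets_seq_cylinder[OF J], unfolded set])
  also have "\<dots> = (\<integral>\<^sup>+x. 1 * (\<Prod>i<?n. cell_prob (\<lambda>n. Y n x) i (B i)) \<partial>M)"
    by (rule uplink_disintegration[OF M net, where f = "\<lambda>_. 1"]) (simp, rule B)
  also have "\<dots> = (\<integral>\<^sup>+y. (\<Prod>i<?n. cell_prob y i (B i)) \<partial>distr M seq_space (\<lambda>x n. Y n x))"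
    unfolding mult_1 by (rule nn_integral_distr[OF uplink_measurable(3)[OF net], symmetric])
      (simp only: measurable_distr_eq1 prod)
  finally show ?thesis .
qed

text \<open>The cylinder formula involves only cell probabilities and the law of the stations, and
  the latter is fixed by the density.\<close>

lemma mobiles_distr_unique:
  assumes "prob_space M" "prob_space M'" "uplink_network M l Y U" "uplink_network M' l Y' U'"
  shows "distr M seq_space (\<lambda>x n. U n x) = distr M' seq_space (\<lambda>x n. U' n x)"
proof (rule measure_eqI_PiM_infinite)
  fix A :: "nat \<Rightarrow> point set" and J :: "nat set"
  assume "finite J" and "\<And>i. i \<in> J \<Longrightarrow> A i \<in> sets borel"
  then have J: "finite J" "\<forall>i\<in>J. A i \<in> sets borel" by auto
  show "emeasure (distr M seq_space (\<lambda>x n. U n x)) (prod_emb UNIV (\<lambda>n. borel) J (Pi\<^sub>E J A)) =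
      emeasure (distr M' seq_space (\<lambda>x n. U' n x)) (prod_emb UNIV (\<lambda>n. borel) J (Pi\<^sub>E J A))"
    unfolding seq_cylinder mobiles_cylinder[OF assms(1,3) J] mobiles_cylinder[OF assms(2,4) J]
      stations_distr_unique[OF assms] by (rule refl)
next
  show "finite_measure (distr M seq_space (\<lambda>x n. U n x))"
    by (intro finite_measure.finite_measure_distr prob_space.finite_measure assms
        uplink_measurable[OF assms(3)])
qed simp_all

section \<open>Dilation of the network\<close>

lemma voronoi_cell_scaleR:
  fixes y :: "nat \<Rightarrow> point"
  assumes "s > 0"
  shows "(\<lambda>p. s *\<^sub>R p) -` voronoi_cell (\<lambda>n. s *\<^sub>R y n) i = voronoi_cell y i"
proof -
  have "dist (s *\<^sub>R u) (s *\<^sub>R v) = s * dist u v" for u v :: point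
    using assms by (simp add: dist_norm flip: scaleR_diff_right)
  then show ?thesis
    using assms by (auto simp: voronoi_cell_def)
qed

lemma cell_prob_scaleR:
  assumes s: "s > 0" and B: "B \<in> sets borel"
  shows "cell_prob (\<lambda>n. s *\<^sub>R y n) i B = cell_prob y i ((\<lambda>p. s *\<^sub>R p) -` B)"
proof -
  let ?v = "\<lambda>A::point set. (\<lambda>p. s *\<^sub>R p) -` A"
  let ?V = "voronoi_cell (\<lambda>n. s *\<^sub>R y n) i"
  have v: "?v B \<in> sets borel"
    using B measurable_sets_borel[of "\<lambda>p. s *\<^sub>R p" borel B] by simp
  have "cell_prob (\<lambda>n. s *\<^sub>R y n) i B = emeasure lborel (?V \<inter> B) / emeasure lborel ?V"
    by (rule cell_prob_eq[OF B])
  also have "\<dots> = (ennreal (s\<^sup>2) * emeasure lborel (?v (?V \<inter> B))) / (ennreal (s\<^sup>2) * emeasure lborel (?v ?V))"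
    using emeasure_lborel_vimage_scaleR[of s "?V \<inter> B"] emeasure_lborel_vimage_scaleR[of s ?V] s B
    by simp
  also have "\<dots> = emeasure lborel (?v (?V \<inter> B)) / emeasure lborel (?v ?V)"
    using s by (simp add: mult.commute[of "ennreal (s\<^sup>2)"] divide_mult_eq)
  also have "\<dots> = cell_prob y i (?v B)"
    by (simp add: voronoi_cell_scaleR[OF s] cell_prob_eq[OF v])
  finally show ?thesis .
qed

text \<open>A dilation is invertible and measurable both ways; the second inclusion is the first one
  for the factor \<open>inverse s\<close> and the dilated stations. Equality of the sigma-algebras
  lets the conditional expectations of both networks be literally the same.\<close>

lemma sigma_stations_scaleR:
  assumes s: "s > 0"
  shows "sigma_stations M (\<lambda>n x. s *\<^sub>R Y n x) = sigma_stations M Y"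
proof -
  have sc: "(\<lambda>y n. t *\<^sub>R y n) \<in> seq_space \<rightarrow>\<^sub>M seq_space" for t :: real
    by (intro measurable_seq borel_measurable_scaleR measurable_coordinate) simp
  have sub: "{(\<lambda>x n. t *\<^sub>R Z n x) -` A \<inter> space M | A. A \<in> sets seq_space} \<subseteq>
      {(\<lambda>x n. Z n x) -` A \<inter> space M | A. A \<in> sets seq_space}" for Z and t :: real
  proof clarify
    fix A assume "A \<in> sets seq_space"
    then have "(\<lambda>y n. t *\<^sub>R y n) -` A \<in> sets seq_space"
      using measurable_sets[OF sc[of t]] by (simp add: space_PiM)
    moreover have "(\<lambda>x n. t *\<^sub>R Z n x) -` A \<inter> space M =
        (\<lambda>x n. Z n x) -` ((\<lambda>y n. t *\<^sub>R y n) -` A) \<inter> space M"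
      by auto
    ultimately show "\<exists>A'. (\<lambda>x n. t *\<^sub>R Z n x) -` A \<inter> space M = (\<lambda>x n. Z n x) -` A' \<inter> space M \<and>
        A' \<in> sets seq_space"
      by blast
  qed
  have "{(\<lambda>x n. s *\<^sub>R Y n x) -` A \<inter> space M | A. A \<in> sets seq_space} =
      {(\<lambda>x n. Y n x) -` A \<inter> space M | A. A \<in> sets seq_space}"
    using sub[of s Y] sub[of "inverse s" "\<lambda>n x. s *\<^sub>R Y n x"] s by simp
  then show ?thesis
    unfolding sigma_stations_def vimage_algebra_def by (simp only:)
qed

lemma uplink_network_scaleR:
  assumes M: "prob_space M" and net: "uplink_network M l Y U" and s: "s > 0"
  shows "uplink_network M (l / s\<^sup>2) (\<lambda>n x. s *\<^sub>R Y n x) (\<lambda>n x. s *\<^sub>R U n x)"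
  unfolding uplink_network_def sigma_stations_scaleR[OF s]
proof (intro conjI allI impI)
  show "(\<lambda>x. s *\<^sub>R Y n x) \<in> borel_measurable M" "(\<lambda>x. s *\<^sub>R U n x) \<in> borel_measurable M" for n
    using uplink_measurable[OF net] by (intro borel_measurable_scaleR; simp)+
  have "AE x in M. Y 0 x = 0 \<and> strict_mono (\<lambda>n. norm (Y n x))"
    using net by (simp add: uplink_network_def)
  then show "AE x in M. s *\<^sub>R Y 0 x = 0 \<and> strict_mono (\<lambda>n. norm (s *\<^sub>R Y n x))"
    by eventually_elim (use s in \<open>simp add: strict_mono_def\<close>)
  have "poisson_process M l (\<lambda>x. {Y n x | n. n \<ge> 1})"
    using net by (simp add: uplink_network_def)
  from poisson_process_scaleR[OF M this s]
  have "poisson_process M (l / s\<^sup>2) (\<lambda>x. (\<lambda>p. s *\<^sub>R p) ` {Y n x | n. n \<ge> 1})" .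
  moreover have "(\<lambda>p. s *\<^sub>R p) ` {Y n x | n. n \<ge> 1} = {s *\<^sub>R Y n x | n. n \<ge> 1}" for x
    by auto
  ultimately show "poisson_process M (l / s\<^sup>2) (\<lambda>x. {s *\<^sub>R Y n x | n. n \<ge> 1})"
    by simp
  fix n and B :: "nat \<Rightarrow> point set" assume B: "\<forall>i<n. B i \<in> sets borel"
  let ?v = "\<lambda>A::point set. (\<lambda>p. s *\<^sub>R p) -` A"
  have v: "?v (B i) \<in> sets borel" if "i < n" for i
    using B that measurable_sets_borel[of "\<lambda>p. s *\<^sub>R p" borel "B i"] by simp
  have "AE x in M. nn_cond_exp M (sigma_stations M Y) (indicator {z \<in> space M. \<forall>i<n. U i z \<in> ?v (B i)}) x =
      (\<Prod>i<n. cell_prob (\<lambda>m. Y m x) i (?v (B i)))"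
    by (rule uplink_cond_exp[OF net v])
  moreover have "(\<Prod>i<n. cell_prob (\<lambda>m. Y m x) i (?v (B i))) = (\<Prod>i<n. cell_prob (\<lambda>m. s *\<^sub>R Y m x) i (B i))" for x
    using B by (intro prod.cong) (simp_all add: cell_prob_scaleR[OF s])
  ultimately show "AE x in M. nn_cond_exp M (sigma_stations M Y) (indicator {z \<in> space M. \<forall>i<n. s *\<^sub>R U i z \<in> B i}) x =
      (\<Prod>i<n. emeasure (uniform_measure lborel (voronoi_cell (\<lambda>m. s *\<^sub>R Y m x) i)) (B i))"
    unfolding vimage_eq cell_prob_def by (simp only:)
qed

section \<open>Resampling one mobile\<close>

text \<open>The uniform law as an explicit density, jointly measurable in stations and point, so
  that it can serve as a kernel on the product with \<open>lborel\<close>.\<close>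

definition cell_density :: "(nat \<Rightarrow> point) \<Rightarrow> nat \<Rightarrow> point \<Rightarrow> ennreal" where
  "cell_density y j u = indicator (voronoi_cell y j) u / emeasure lborel (voronoi_cell y j)"

lemma borel_measurable_cell_density:
  "(\<lambda>x. cell_density (fst x) j (snd x)) \<in> borel_measurable (seq_space \<Otimes>\<^sub>M borel)"
proof -
  have "(\<lambda>x. indicator {x. snd x \<in> voronoi_cell (fst x) j} x :: ennreal) \<in> borel_measurable (seq_space \<Otimes>\<^sub>M borel)"
    by (rule borel_measurable_indicator[OF sets_voronoi_graph])
  moreover have "(\<lambda>x. emeasure lborel (voronoi_cell (fst x) j \<inter> UNIV)) \<in> borel_measurable (seq_space \<Otimes>\<^sub>M borel)"
    by (rule measurable_compose[OF measurable_fst borel_measurable_cell_volume]) simp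
  ultimately have "(\<lambda>x. indicator {x. snd x \<in> voronoi_cell (fst x) j} x / emeasure lborel (voronoi_cell (fst x) j \<inter> UNIV))
      \<in> borel_measurable (seq_space \<Otimes>\<^sub>M borel)"
    by (rule borel_measurable_divide_ennreal)
  moreover have "indicator {x. snd x \<in> voronoi_cell (fst x) j} x / emeasure lborel (voronoi_cell (fst x) j \<inter> UNIV) =
      cell_density (fst x) j (snd x)" for x
    by (simp add: cell_density_def indicator_def)
  ultimately show ?thesis by simp
qed

lemma borel_measurable_cell_density_section: "cell_density y j \<in> borel_measurable borel"
  unfolding cell_density_def[abs_def] by (intro borel_measurable_divide_ennreal) simp_all

lemma nn_integral_cell_density:
  assumes B: "B \<in> sets borel"
  shows "(\<integral>\<^sup>+u. cell_density y j u * indicator B u \<partial>lborel) = cell_prob y j B"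
proof -
  have "(\<integral>\<^sup>+u. cell_density y j u * indicator B u \<partial>lborel) =
      (\<integral>\<^sup>+u. indicator (voronoi_cell y j \<inter> B) u / emeasure lborel (voronoi_cell y j) \<partial>lborel)"
    by (rule nn_integral_cong) (simp add: cell_density_def split: split_indicator)
  also have "\<dots> = cell_prob y j B"
    using B by (subst nn_integral_divide) (simp_all add: cell_prob_eq)
  finally show ?thesis .
qed

lemma cell_prob_UNIV_cases:
  obtains "cell_prob y j UNIV = 0" |
    "cell_prob y j UNIV = 1" "emeasure lborel (voronoi_cell y j) \<noteq> 0" "emeasure lborel (voronoi_cell y j) \<noteq> \<infinity>"
proof -
  have eq: "cell_prob y j UNIV = emeasure lborel (voronoi_cell y j) / emeasure lborel (voronoi_cell y j)"
    using cell_prob_eq[of UNIV y j] by simp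
  show thesis
  proof (cases "emeasure lborel (voronoi_cell y j) = 0 \<or> emeasure lborel (voronoi_cell y j) = \<infinity>")
    case True
    \<comment> \<open>In \<open>ennreal\<close> both \<open>0 / 0\<close> and
      \<open>\<infinity> / \<infinity>\<close> are 0.\<close>
    then have "cell_prob y j UNIV = 0" unfolding eq by (auto simp: divide_ennreal_def)
    then show thesis by (rule that(1))
  next
    case False
    then have "cell_prob y j UNIV = 1" unfolding eq by (auto simp: less_top intro!: ennreal_divide_self)
    with False show thesis by (intro that(2)) auto
  qed
qed

text \<open>The disintegration itself forces almost every cell to have positive finite area: for any other
  cell the uniform measure is the zero measure, with total mass 0.\<close>

lemma AE_cell_prob_UNIV:
  assumes M: "prob_space M" and net: "uplink_network M l Y U"
  shows "AE x in M. cell_prob (\<lambda>n. Y n x) j UNIV = 1"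
proof -
  let ?f = "\<lambda>y. indicator {0} (cell_prob y j UNIV) :: ennreal"
  have f: "?f \<in> borel_measurable seq_space"
    by (rule measurable_compose[OF borel_measurable_cell_prob]) auto
  have fY: "(\<lambda>x. ?f (\<lambda>n. Y n x)) \<in> borel_measurable M"
    by (rule measurable_compose[OF uplink_measurable(3)[OF net] f])
  have "(\<integral>\<^sup>+x. ?f (\<lambda>n. Y n x) \<partial>M) =
      (\<integral>\<^sup>+x. ?f (\<lambda>n. Y n x) * indicator {x \<in> space M. \<forall>i<Suc j. U i x \<in> UNIV} x \<partial>M)"
    by (rule nn_integral_cong) simp
  also have "\<dots> = (\<integral>\<^sup>+x. ?f (\<lambda>n. Y n x) * (\<Prod>i<Suc j. cell_prob (\<lambda>n. Y n x) i UNIV) \<partial>M)"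
    by (rule uplink_disintegration[OF M net f]) simp
  also have "\<dots> = (\<integral>\<^sup>+x. 0 \<partial>M)"
    by (rule nn_integral_cong) (simp add: indicator_def)
  finally have "AE x in M. ?f (\<lambda>n. Y n x) = 0"
    using nn_integral_0_iff_AE[OF fY] by simp
  then show ?thesis
  proof eventually_elim
    case (elim x)
    then show ?case
      by (cases rule: cell_prob_UNIV_cases[of "\<lambda>n. Y n x" j]) auto
  qed
qed

lemma AE_cell_volume:
  assumes M: "prob_space M" and net: "uplink_network M l Y U"
  shows "AE x in M. emeasure lborel (voronoi_cell (\<lambda>n. Y n x) j) \<noteq> 0 \<and>
    emeasure lborel (voronoi_cell (\<lambda>n. Y n x) j) \<noteq> \<infinity>"
  using AE_cell_prob_UNIV[OF assms, of j]
proof eventually_elim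
  case (elim x)
  then show ?case
    by (cases rule: cell_prob_UNIV_cases[of "\<lambda>n. Y n x" j]) auto
qed

text \<open>Stations and mobiles are merged into one family indexed by \<open>nat + nat\<close>, so
  that their joint laws can be compared on the cylinders of a single product space.\<close>

abbreviation sum_space :: "(nat + nat \<Rightarrow> point) measure" where
  "sum_space \<equiv> \<Pi>\<^sub>M i\<in>UNIV. borel"

lemma measurable_case_sum:
  assumes f: "f \<in> N \<rightarrow>\<^sub>M seq_space" and g: "g \<in> N \<rightarrow>\<^sub>M seq_space"
  shows "(\<lambda>x. case_sum (f x) (g x)) \<in> N \<rightarrow>\<^sub>M sum_space"
proof (rule measurable_PiM_single')
  show "(\<lambda>x. case_sum (f x) (g x) i) \<in> borel_measurable N" for i
    using measurable_compose[OF f measurable_coordinate] measurable_compose[OF g measurable_coordinate]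
    by (cases i) simp_all
qed (simp add: PiE_def)

lemma measurable_fun_upd_seq:
  assumes f: "f \<in> N \<rightarrow>\<^sub>M seq_space" and g: "g \<in> borel_measurable N"
  shows "(\<lambda>x. (f x)(j := g x)) \<in> N \<rightarrow>\<^sub>M seq_space"
proof (rule measurable_PiM_single')
  show "(\<lambda>x. ((f x)(j := g x)) i) \<in> borel_measurable N" for i
    using measurable_compose[OF f measurable_coordinate] g by (cases "i = j") simp_all
qed (simp add: PiE_def)

text \<open>On a cylinder the fresh point \<open>snd x\<close> integrates out to
  \<open>cell_prob\<close>. The disintegration turns the conditions on the other mobiles into cell
  probabilities, and then turns the full product back into an event on all mobiles.\<close>

lemma uplink_resample_distr:
  fixes j :: nat
  assumes M: "prob_space M" and net: "uplink_network M l Y U"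
  defines "V \<equiv> \<lambda>x. case_sum (\<lambda>n. Y n (fst x)) ((\<lambda>n. U n (fst x))(j := snd x))"
  defines "R \<equiv> density (M \<Otimes>\<^sub>M lborel) (\<lambda>x. cell_density (\<lambda>n. Y n (fst x)) j (snd x))"
  shows "distr M sum_space (\<lambda>x. case_sum (\<lambda>n. Y n x) (\<lambda>n. U n x)) = distr R sum_space V"
proof (rule measure_eqI_PiM_infinite)
  interpret prob_space M by fact
  note Y = uplink_measurable(3)[OF net] and U = uplink_measurable(4)[OF net]
  note Z = measurable_case_sum[OF Y U]
  have V: "V \<in> R \<rightarrow>\<^sub>M sum_space"
    unfolding V_def R_def measurable_density_eq1
    by (intro measurable_case_sum measurable_fun_upd_seq measurable_compose[OF measurable_fst Y]
        measurable_compose[OF measurable_fst U] measurable_compose[OF measurable_snd measurable_ident_sets]) simp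
  have dens: "(\<lambda>x. cell_density (\<lambda>n. Y n (fst x)) j (snd x)) \<in> borel_measurable (M \<Otimes>\<^sub>M lborel)"
  proof -
    have "(\<lambda>x. (\<lambda>n. Y n (fst x), snd x)) \<in> M \<Otimes>\<^sub>M lborel \<rightarrow>\<^sub>M seq_space \<Otimes>\<^sub>M borel"
      by (intro measurable_Pair measurable_compose[OF measurable_fst Y]
          measurable_compose[OF measurable_snd measurable_ident_sets]) simp
    from measurable_compose[OF this borel_measurable_cell_density] show ?thesis by simp
  qed
  show "finite_measure (distr M sum_space (\<lambda>x. case_sum (\<lambda>n. Y n x) (\<lambda>n. U n x)))"
    by (intro finite_measure_distr Z)
  fix A :: "nat + nat \<Rightarrow> point set" and J :: "(nat + nat) set"
  assume "finite J" and "\<And>i. i \<in> J \<Longrightarrow> A i \<in> sets borel"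
  then have J: "finite J" "\<forall>i\<in>J. A i \<in> sets borel" by auto
  define AY where "AY = {y. \<forall>m\<in>Inl -` J. y m \<in> A (Inl m)}"
  define B where "B i = (if Inr i \<in> J then A (Inr i) else UNIV)" for i
  have fin: "finite (Inl -` J)" "finite (Inr -` J)"
    using J(1) by (auto intro: finite_vimageI)
  have AY: "AY \<in> sets seq_space"
    unfolding AY_def using fin J by (intro sets_seq_cylinder) auto
  have B: "B i \<in> sets borel" for i using J by (simp add: B_def)
  define n where "n = Suc (max j (Max (Inr -` J)))"
  have n: "j < n" "\<And>m. Inr m \<in> J \<Longrightarrow> m < n"
    using Max_ge[OF fin(2)] by (auto simp: n_def less_Suc_eq_le le_max_iff_disj)
  let ?C = "{z. \<forall>i\<in>J. z i \<in> A i}"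
  have C: "?C \<in> sets sum_space" by (rule sets_seq_cylinder[OF J])
  have mem: "case_sum y u \<in> ?C \<longleftrightarrow> y \<in> AY \<and> (\<forall>i<n. u i \<in> B i)" for y u
  proof
    assume C: "case_sum y u \<in> ?C"
    then have "case_sum y u i \<in> A i" if "i \<in> J" for i using that by blast
    from this[of "Inl _"] this[of "Inr _"] show "y \<in> AY \<and> (\<forall>i<n. u i \<in> B i)"
      by (auto simp: AY_def B_def)
  next
    assume *: "y \<in> AY \<and> (\<forall>i<n. u i \<in> B i)"
    have "case_sum y u i \<in> A i" if i: "i \<in> J" for i
    proof (cases i)
      case (Inl m)
      then show ?thesis using * i by (auto simp: AY_def)
    next
      case (Inr m)
      then have "u m \<in> B m" using * i n(2) by blast
      then show ?thesis using i Inr by (simp add: B_def)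
    qed
    then show "case_sum y u \<in> ?C" by blast
  qed
  \<comment> \<open>The old value of mobile \<open>j\<close> is overwritten by the fresh point, so
    it is left unconstrained.\<close>
  define B' where "B' = B(j := UNIV)"
  have B': "B' i \<in> sets borel" for i using B by (simp add: B'_def)
  have upd: "(\<forall>i<n. (u(j := v)) i \<in> B i) \<longleftrightarrow> v \<in> B j \<and> (\<forall>i<n. u i \<in> B' i)" for u v
    using n(1) by (auto simp: B'_def)
  let ?f = "\<lambda>y. indicator AY y * cell_prob y j (B j)"
  have f: "?f \<in> borel_measurable seq_space"
    by (intro borel_measurable_times_ennreal borel_measurable_indicator AY borel_measurable_cell_prob B)
  have indAY: "indicator AY \<in> borel_measurable seq_space"
    by (rule borel_measurable_indicator[OF AY])
  have "emeasure (distr R sum_space V) ?C = emeasure R (V -` ?C \<inter> space R)"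
    by (rule emeasure_distr[OF V C])
  also have "\<dots> = (\<integral>\<^sup>+x. cell_density (\<lambda>n. Y n (fst x)) j (snd x) * indicator (V -` ?C \<inter> space R) x \<partial>(M \<Otimes>\<^sub>M lborel))"
    using measurable_sets[OF V C] unfolding R_def sets_density
    by (rule emeasure_density[OF dens])
  also have "\<dots> = (\<integral>\<^sup>+x. \<integral>\<^sup>+v. cell_density (\<lambda>n. Y n (fst (x, v))) j (snd (x, v)) * indicator (V -` ?C \<inter> space R) (x, v) \<partial>lborel \<partial>M)"
    by (rule lborel.nn_integral_fst[symmetric])
       (use measurable_sets[OF V C] dens in \<open>auto simp: R_def intro!: borel_measurable_times_ennreal borel_measurable_indicator\<close>)
  also have "\<dots> = (\<integral>\<^sup>+x. ?f (\<lambda>n. Y n x) * indicator {x \<in> space M. \<forall>i<n. U i x \<in> B' i} x \<partial>M)"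
  proof (rule nn_integral_cong)
    fix x assume x: "x \<in> space M"
    let ?c = "indicator AY (\<lambda>n. Y n x) * indicator {x \<in> space M. \<forall>i<n. U i x \<in> B' i} x :: ennreal"
    have "(\<integral>\<^sup>+v. cell_density (\<lambda>n. Y n (fst (x, v))) j (snd (x, v)) * indicator (V -` ?C \<inter> space R) (x, v) \<partial>lborel) =
        (\<integral>\<^sup>+v. ?c * (cell_density (\<lambda>n. Y n x) j v * indicator (B j) v) \<partial>lborel)"
    proof (rule nn_integral_cong)
      fix v
      have V': "V (x, v) = case_sum (\<lambda>n. Y n x) ((\<lambda>n. U n x)(j := v))"
        by (simp only: V_def fst_conv snd_conv)
      have "(x, v) \<in> V -` ?C \<inter> space R \<longleftrightarrow> V (x, v) \<in> ?C"
        using x by (simp add: R_def space_pair_measure)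
      then have iff: "(x, v) \<in> V -` ?C \<inter> space R \<longleftrightarrow>
          (\<lambda>n. Y n x) \<in> AY \<and> v \<in> B j \<and> (\<forall>i<n. U i x \<in> B' i)"
        unfolding V' mem upd .
      have "indicator (V -` ?C \<inter> space R) (x, v) = ?c * indicator (B j) v"
        unfolding indicator_def iff using x by auto
      then show "cell_density (\<lambda>n. Y n (fst (x, v))) j (snd (x, v)) * indicator (V -` ?C \<inter> space R) (x, v) =
          ?c * (cell_density (\<lambda>n. Y n x) j v * indicator (B j) v)"
        by (simp add: mult_ac)
    qed
    also have "\<dots> = ?c * (\<integral>\<^sup>+v. cell_density (\<lambda>n. Y n x) j v * indicator (B j) v \<partial>lborel)"
    proof (rule nn_integral_cmult)
      show "(\<lambda>v. cell_density (\<lambda>n. Y n x) j v * indicator (B j) v) \<in> borel_measurable lborel"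
        using B[of j] borel_measurable_cell_density_section by simp
    qed
    also have "\<dots> = ?f (\<lambda>n. Y n x) * indicator {x \<in> space M. \<forall>i<n. U i x \<in> B' i} x"
      by (simp only: nn_integral_cell_density[OF B]) (simp only: mult_ac)
    finally show "(\<integral>\<^sup>+v. cell_density (\<lambda>n. Y n (fst (x, v))) j (snd (x, v)) * indicator (V -` ?C \<inter> space R) (x, v) \<partial>lborel) =
        ?f (\<lambda>n. Y n x) * indicator {x \<in> space M. \<forall>i<n. U i x \<in> B' i} x" .
  qed
  also have "\<dots> = (\<integral>\<^sup>+x. ?f (\<lambda>n. Y n x) * (\<Prod>i<n. cell_prob (\<lambda>n. Y n x) i (B' i)) \<partial>M)"
    by (rule uplink_disintegration[OF M net f B'])
  \<comment> \<open>In the product for \<open>B'\<close> the factor with index \<open>j\<close> is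
    the probability of \<open>UNIV\<close>, almost surely 1, so the probability of
    \<open>B j\<close> coming from the fresh point can take its place.\<close>
  also have "\<dots> = (\<integral>\<^sup>+x. indicator AY (\<lambda>n. Y n x) * (\<Prod>i<n. cell_prob (\<lambda>n. Y n x) i (B i)) \<partial>M)"
  proof (rule nn_integral_cong_AE)
    show "AE x in M. ?f (\<lambda>n. Y n x) * (\<Prod>i<n. cell_prob (\<lambda>n. Y n x) i (B' i)) =
        indicator AY (\<lambda>n. Y n x) * (\<Prod>i<n. cell_prob (\<lambda>n. Y n x) i (B i))"
      using AE_cell_prob_UNIV[OF M net, of j]
    proof eventually_elim
      case (elim x)
      let ?p = "\<lambda>i B. cell_prob (\<lambda>n. Y n x) i B"
      have "(\<Prod>i<n. ?p i (B' i)) = ?p j UNIV * (\<Prod>i\<in>{..<n} - {j}. ?p i (B' i))"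
        using n(1) by (subst prod.remove[of _ j]) (auto simp: B'_def)
      also have "(\<Prod>i\<in>{..<n} - {j}. ?p i (B' i)) = (\<Prod>i\<in>{..<n} - {j}. ?p i (B i))"
        by (rule prod.cong) (auto simp: B'_def)
      finally have "?p j (B j) * (\<Prod>i<n. ?p i (B' i)) = (\<Prod>i<n. ?p i (B i))"
        using n(1) elim prod.remove[of "{..<n}" j "\<lambda>i. ?p i (B i)"] by simp
      then show ?case by (simp add: mult.assoc)
    qed
  qed
  also have "\<dots> = (\<integral>\<^sup>+x. indicator AY (\<lambda>n. Y n x) * indicator {x \<in> space M. \<forall>i<n. U i x \<in> B i} x \<partial>M)"
    by (rule uplink_disintegration[OF M net indAY B, symmetric])
  also have "\<dots> = (\<integral>\<^sup>+x. indicator ((\<lambda>x. case_sum (\<lambda>n. Y n x) (\<lambda>n. U n x)) -` ?C \<inter> space M) x \<partial>M)"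
  proof (rule nn_integral_cong)
    fix x assume "x \<in> space M"
    then show "indicator AY (\<lambda>n. Y n x) * indicator {x \<in> space M. \<forall>i<n. U i x \<in> B i} x =
        (indicator ((\<lambda>x. case_sum (\<lambda>n. Y n x) (\<lambda>n. U n x)) -` ?C \<inter> space M) x :: ennreal)"
      using mem[of "\<lambda>n. Y n x" "\<lambda>n. U n x"] by (simp add: indicator_def)
  qed
  also have "\<dots> = emeasure M ((\<lambda>x. case_sum (\<lambda>n. Y n x) (\<lambda>n. U n x)) -` ?C \<inter> space M)"
    by (rule nn_integral_indicator[OF measurable_sets[OF Z C]])
  also have "\<dots> = emeasure (distr M sum_space (\<lambda>x. case_sum (\<lambda>n. Y n x) (\<lambda>n. U n x))) ?C"
    by (rule emeasure_distr[OF Z C, symmetric])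
  finally show "emeasure (distr M sum_space (\<lambda>x. case_sum (\<lambda>n. Y n x) (\<lambda>n. U n x))) (prod_emb UNIV (\<lambda>i. borel) J (Pi\<^sub>E J A)) =
      emeasure (distr R sum_space V) (prod_emb UNIV (\<lambda>i. borel) J (Pi\<^sub>E J A))"
    unfolding seq_cylinder ..
qed simp_all

text \<open>Conditional independence in the form used below: with the stations and the other mobiles
  frozen, mobile \<open>j\<close> is integrated over its own cell.\<close>

lemma uplink_resample:
  assumes M: "prob_space M" and net: "uplink_network M l Y U"
    and h: "h \<in> borel_measurable (seq_space \<Otimes>\<^sub>M seq_space)"
  shows "(\<integral>\<^sup>+x. h (\<lambda>n. Y n x, \<lambda>n. U n x) \<partial>M) =
    (\<integral>\<^sup>+x. \<integral>\<^sup>+v. cell_density (\<lambda>n. Y n x) j v * h (\<lambda>n. Y n x, (\<lambda>n. U n x)(j := v)) \<partial>lborel \<partial>M)"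
proof -
  interpret prob_space M by fact
  note Y = uplink_measurable(3)[OF net] and U = uplink_measurable(4)[OF net]
  define V where "V x = case_sum (\<lambda>n. Y n (fst x)) ((\<lambda>n. U n (fst x))(j := snd x))" for x
  define k where "k x = cell_density (\<lambda>n. Y n (fst x)) j (snd x)" for x
  have V: "V \<in> M \<Otimes>\<^sub>M lborel \<rightarrow>\<^sub>M sum_space"
    unfolding V_def[abs_def]
    by (intro measurable_case_sum measurable_fun_upd_seq measurable_compose[OF measurable_fst Y]
        measurable_compose[OF measurable_fst U] measurable_compose[OF measurable_snd measurable_ident_sets]) simp
  have k: "k \<in> borel_measurable (M \<Otimes>\<^sub>M lborel)"
  proof -
    have "(\<lambda>x. (\<lambda>n. Y n (fst x), snd x)) \<in> M \<Otimes>\<^sub>M lborel \<rightarrow>\<^sub>M seq_space \<Otimes>\<^sub>M borel"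
      by (intro measurable_Pair measurable_compose[OF measurable_fst Y]
          measurable_compose[OF measurable_snd measurable_ident_sets]) simp
    from measurable_compose[OF this borel_measurable_cell_density] show ?thesis
      unfolding k_def[abs_def] by simp
  qed
  define g where "g z = h (\<lambda>n. z (Inl n), \<lambda>n. z (Inr n))" for z
  have "(\<lambda>z::nat + nat \<Rightarrow> point. (\<lambda>n. z (Inl n), \<lambda>n. z (Inr n))) \<in> sum_space \<rightarrow>\<^sub>M seq_space \<Otimes>\<^sub>M seq_space"
    by (intro measurable_Pair measurable_seq measurable_coordinate)
  then have g: "g \<in> borel_measurable sum_space"
    unfolding g_def[abs_def] by (rule measurable_compose[OF _ h])
  have "(\<integral>\<^sup>+x. h (\<lambda>n. Y n x, \<lambda>n. U n x) \<partial>M) = (\<integral>\<^sup>+x. g (case_sum (\<lambda>n. Y n x) (\<lambda>n. U n x)) \<partial>M)"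
    by (simp add: g_def)
  also have "\<dots> = (\<integral>\<^sup>+z. g z \<partial>distr M sum_space (\<lambda>x. case_sum (\<lambda>n. Y n x) (\<lambda>n. U n x)))"
    by (rule nn_integral_distr[OF measurable_case_sum[OF Y U], symmetric])
      (simp only: measurable_distr_eq1 g)
  also have "\<dots> = (\<integral>\<^sup>+z. g z \<partial>distr (density (M \<Otimes>\<^sub>M lborel) k) sum_space V)"
    unfolding V_def[abs_def] k_def[abs_def] uplink_resample_distr[OF M net, of j] ..
  also have "\<dots> = (\<integral>\<^sup>+x. g (V x) \<partial>density (M \<Otimes>\<^sub>M lborel) k)"
    by (rule nn_integral_distr) (simp_all only: measurable_distr_eq1 measurable_density_eq1 V g)
  also have "\<dots> = (\<integral>\<^sup>+x. k x * g (V x) \<partial>(M \<Otimes>\<^sub>M lborel))"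
    by (rule nn_integral_density[OF k measurable_compose[OF V g]])
  also have "\<dots> = (\<integral>\<^sup>+x. \<integral>\<^sup>+v. k (x, v) * g (V (x, v)) \<partial>lborel \<partial>M)"
    by (rule lborel.nn_integral_fst[symmetric])
       (rule borel_measurable_times_ennreal[OF k measurable_compose[OF V g]])
  also have "\<dots> = (\<integral>\<^sup>+x. \<integral>\<^sup>+v. cell_density (\<lambda>n. Y n x) j v * h (\<lambda>n. Y n x, (\<lambda>n. U n x)(j := v)) \<partial>lborel \<partial>M)"
    by (simp add: k_def g_def V_def fun_upd_def)
  finally show ?thesis .
qed

section \<open>Almost sure location of a mobile\<close>

text \<open>By resampling, the probability of lying outside the cell is an integral of
  \<open>cell_density\<close> over points off the cell, where it vanishes.\<close>

lemma AE_mobile_in_cell: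
  assumes M: "prob_space M" and net: "uplink_network M l Y U"
  shows "AE x in M. U j x \<in> voronoi_cell (\<lambda>n. Y n x) j"
proof -
  let ?h = "\<lambda>z. indicator {x. snd x \<notin> voronoi_cell (fst x) j} (fst z, snd z j) :: ennreal"
  have proj: "(\<lambda>z. (fst z, snd z j)) \<in> seq_space \<Otimes>\<^sub>M seq_space \<rightarrow>\<^sub>M seq_space \<Otimes>\<^sub>M borel"
    by (intro measurable_Pair measurable_fst measurable_compose[OF measurable_snd measurable_coordinate])
  have "{x. snd x \<notin> voronoi_cell (fst x) j} = space (seq_space \<Otimes>\<^sub>M borel) - {x. snd x \<in> voronoi_cell (fst x) j}"
    by (auto simp: space_pair_measure space_PiM)
  then have "{x. snd x \<notin> voronoi_cell (fst x) j} \<in> sets (seq_space \<Otimes>\<^sub>M borel)"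
    using sets_voronoi_graph by (simp only: sets.compl_sets)
  from measurable_compose[OF proj borel_measurable_indicator[OF this]]
  have h: "?h \<in> borel_measurable (seq_space \<Otimes>\<^sub>M seq_space)"
    .
  have "(\<integral>\<^sup>+x. ?h (\<lambda>n. Y n x, \<lambda>n. U n x) \<partial>M) = (\<integral>\<^sup>+x. \<integral>\<^sup>+v. 0 \<partial>(lborel :: point measure) \<partial>M)"
    unfolding uplink_resample[OF M net h, of j]
  proof (intro nn_integral_cong)
    fix x v
    show "cell_density (\<lambda>n. Y n x) j v * ?h (\<lambda>n. Y n x, (\<lambda>n. U n x)(j := v)) = 0"
      by (cases "v \<in> voronoi_cell (\<lambda>n. Y n x) j") (simp_all add: cell_density_def)
  qed
  then have "(\<integral>\<^sup>+x. ?h (\<lambda>n. Y n x, \<lambda>n. U n x) \<partial>M) = 0" by simp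
  moreover have "(\<lambda>x. ?h (\<lambda>n. Y n x, \<lambda>n. U n x)) \<in> borel_measurable M"
    by (rule measurable_compose[OF measurable_Pair[OF uplink_measurable(3,4)[OF net]] h])
  ultimately have "AE x in M. ?h (\<lambda>n. Y n x, \<lambda>n. U n x) = 0"
    by (simp only: nn_integral_0_iff_AE)
  then show ?thesis
    by eventually_elim (simp add: indicator_def split: if_splits)
qed

text \<open>The origin is Lebesgue null, so a resampled mobile misses it. The convention
  \<open>0 powr (- \<alpha>) = 0\<close> would otherwise give a mobile at the origin no signal at
  all.\<close>

lemma AE_mobile_nonzero:
  assumes M: "prob_space M" and net: "uplink_network M l Y U"
  shows "AE x in M. U j x \<noteq> 0"
proof -
  let ?h = "\<lambda>z :: (nat \<Rightarrow> point) \<times> (nat \<Rightarrow> point). indicator {0} (snd z j) :: ennreal"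
  have h: "?h \<in> borel_measurable (seq_space \<Otimes>\<^sub>M seq_space)"
    by (rule measurable_compose[OF measurable_compose[OF measurable_snd measurable_coordinate]]) simp
  have null: "AE v in lborel. v \<noteq> (0 :: point)"
    by (rule AE_lborel_singleton)
  have "(\<integral>\<^sup>+x. ?h (\<lambda>n. Y n x, \<lambda>n. U n x) \<partial>M) = (\<integral>\<^sup>+x. \<integral>\<^sup>+v. 0 \<partial>(lborel :: point measure) \<partial>M)"
    unfolding uplink_resample[OF M net h, of j]
  proof (rule nn_integral_cong, rule nn_integral_cong_AE)
    fix x
    show "AE v in lborel. cell_density (\<lambda>n. Y n x) j v * ?h (\<lambda>n. Y n x, (\<lambda>n. U n x)(j := v)) = 0"
      using null by eventually_elim simp
  qed
  then have "(\<integral>\<^sup>+x. ?h (\<lambda>n. Y n x, \<lambda>n. U n x) \<partial>M) = 0" by simp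
  moreover have "(\<lambda>x. ?h (\<lambda>n. Y n x, \<lambda>n. U n x)) \<in> borel_measurable M"
    by (rule measurable_compose[OF measurable_Pair[OF uplink_measurable(3,4)[OF net]] h])
  ultimately have "AE x in M. ?h (\<lambda>n. Y n x, \<lambda>n. U n x) = 0"
    by (simp only: nn_integral_0_iff_AE)
  then show ?thesis
    by eventually_elim (simp add: indicator_def split: if_splits)
qed

section \<open>Interference and outage\<close>

text \<open>Only interfering mobiles are ranked. Resampling \<open>U 0\<close> therefore changes the
  signal and leaves the interference as it is.\<close>

lemma cancelled_fun_upd: "cancelled K (u(0 := v)) = cancelled K u"
proof -
  have "{m. m \<noteq> 0 \<and> norm ((u(0 := v)) m) < norm ((u(0 := v)) n)} =
      {m. m \<noteq> 0 \<and> norm (u m) < norm (u n)}" if "n \<noteq> 0" for n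
    using that by auto
  then show ?thesis unfolding cancelled_def by auto
qed

lemma cancelled_scaleR: "s > 0 \<Longrightarrow> cancelled K (\<lambda>n. s *\<^sub>R u n) = cancelled K u"
  unfolding cancelled_def by simp

text \<open>Quantifying over finite sets of labels, of which there are countably many, makes
  measurability evident. An infinite set of nearer mobiles also contains \<open>K\<close> of them,
  which covers the finiteness clause.\<close>

lemma in_cancelled_iff:
  "n \<in> cancelled K u \<longleftrightarrow> n \<noteq> 0 \<and>
    \<not> (\<exists>F\<in>{F. finite F}. card F = K \<and> (\<forall>m\<in>F. m \<noteq> 0 \<and> norm (u m) < norm (u n)))"
proof -
  let ?S = "{m. m \<noteq> 0 \<and> norm (u m) < norm (u n)}"
  have "(finite ?S \<and> card ?S < K) \<longleftrightarrow> \<not> (\<exists>F. finite F \<and> card F = K \<and> F \<subseteq> ?S)"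
  proof
    assume "finite ?S \<and> card ?S < K"
    then show "\<not> (\<exists>F. finite F \<and> card F = K \<and> F \<subseteq> ?S)"
      using card_mono[of ?S] by (meson leD)
  next
    assume no: "\<not> (\<exists>F. finite F \<and> card F = K \<and> F \<subseteq> ?S)"
    have "finite ?S"
      using no infinite_arbitrarily_large[of ?S K] by blast
    moreover have "card ?S < K"
    proof (rule ccontr)
      assume "\<not> card ?S < K"
      then obtain F where "F \<subseteq> ?S" "card F = K" "finite F"
        using obtain_subset_with_card_n[of K ?S] by (auto simp: not_less)
      with no show False by blast
    qed
    ultimately show "finite ?S \<and> card ?S < K" by simp
  qed
  then show ?thesis by (simp add: cancelled_def subset_eq)
qed

lemma sets_cancelled: "{u. n \<in> cancelled K u} \<in> sets seq_space"
proof -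
  note measurable_coordinate[measurable]
  have "{u \<in> space seq_space. n \<noteq> 0 \<and>
      \<not> (\<exists>F\<in>{F. finite F}. card F = K \<and> (\<forall>m\<in>F. m \<noteq> 0 \<and> norm (u m) < norm (u n)))} \<in> sets seq_space"
  proof (intro sets.sets_Collect_conj sets.sets_Collect_neg sets.sets_Collect_const)
    have "{u \<in> space seq_space. \<exists>F\<in>{F. finite F}. card F = K \<and> (\<forall>m\<in>F. m \<noteq> 0 \<and> norm (u m) < norm (u n))} =
        (\<Union>F\<in>{F. finite F}. {u \<in> space seq_space. card F = K \<and> (\<forall>m\<in>F. m \<noteq> 0 \<and> norm (u m) < norm (u n))})"
      by auto
    also have "\<dots> \<in> sets seq_space"
    proof (rule sets.countable_UN'')
      show "countable {F :: nat set. finite F}"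
        using countable_Collect_finite[where 'a = nat] by simp
      fix F :: "nat set" assume "F \<in> {F. finite F}"
      then have F: "finite F" by simp
      show "{u \<in> space seq_space. card F = K \<and> (\<forall>m\<in>F. m \<noteq> 0 \<and> norm (u m) < norm (u n))} \<in> sets seq_space"
      proof (intro sets.sets_Collect_conj sets.sets_Collect_const sets.sets_Collect_finite_All[OF _ F])
        show "{u \<in> space seq_space. norm (u m) < norm (u n)} \<in> sets seq_space" for m
          by measurable
      qed
    qed
    finally show "{u \<in> space seq_space. \<exists>F\<in>{F. finite F}. card F = K \<and>
        (\<forall>m\<in>F. m \<noteq> 0 \<and> norm (u m) < norm (u n))} \<in> sets seq_space" .
  qed
  then show ?thesis by (simp add: in_cancelled_iff space_PiM)
qed

lemma interference_eq_suminf: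
  "interference K \<alpha> p u =
    (\<Sum>n. ennreal (p * norm (u n) powr (- \<alpha>)) * indicator (- ({0} \<union> cancelled K u)) n)"
proof -
  have "interference K \<alpha> p u =
      (\<integral>\<^sup>+n. ennreal (p * norm (u n) powr (- \<alpha>)) \<partial>count_space (UNIV - ({0} \<union> cancelled K u)))"
    unfolding interference_def by (rule infsum_ennreal_eq_nn_integral) simp
  also have "\<dots> = (\<integral>\<^sup>+n. ennreal (p * norm (u n) powr (- \<alpha>)) * indicator (- ({0} \<union> cancelled K u)) n \<partial>count_space UNIV)"
    unfolding Compl_eq_Diff_UNIV by (rule nn_integral_count_space_indicator) simp
  finally show ?thesis by (simp only: nn_integral_count_space_nat)
qed

lemma borel_measurable_interference: "interference K \<alpha> p \<in> borel_measurable seq_space"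
proof -
  note measurable_coordinate[measurable]
  have "(\<lambda>u. ennreal (p * norm (u n) powr (- \<alpha>)) * indicator (- ({0} \<union> cancelled K u)) n)
      \<in> borel_measurable seq_space" for n
  proof -
    have ind: "(\<lambda>u. indicator {u. n \<in> cancelled K u} u :: ennreal) \<in> borel_measurable seq_space"
      by (rule borel_measurable_indicator[OF sets_cancelled])
    have "indicator (- ({0} \<union> cancelled K u)) n =
        indicator (- {0}) n * (1 - indicator {u. n \<in> cancelled K u} u :: ennreal)" for u
      by (simp add: indicator_def)
    moreover have "(\<lambda>u. ennreal (p * norm (u n) powr (- \<alpha>)) * (indicator (- {0}) n *
        (1 - indicator {u. n \<in> cancelled K u} u))) \<in> borel_measurable seq_space"
      by (intro borel_measurable_times_ennreal borel_measurable_minus_ennreal borel_measurable_const ind)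
        measurable
    ultimately show ?thesis by (simp only:)
  qed
  then show ?thesis
    unfolding interference_eq_suminf[abs_def] by (rule borel_measurable_suminf_order)
qed

lemma interference_eq_cmult:
  assumes "0 \<le> p"
  shows "interference K \<alpha> p u = ennreal p * interference K \<alpha> 1 u"
  unfolding interference_eq_suminf using assms
  by (subst ennreal_suminf_cmult[symmetric]) (simp add: ennreal_mult mult.assoc)

lemma interference_scaleR:
  assumes "s > 0"
  shows "interference K \<alpha> 1 (\<lambda>n. s *\<^sub>R u n) = ennreal (s powr (- \<alpha>)) * interference K \<alpha> 1 u"
  unfolding interference_eq_suminf cancelled_scaleR[OF assms] using assms
  by (subst ennreal_suminf_cmult[symmetric]) (simp add: powr_mult ennreal_mult mult.assoc)

lemma interference_fun_upd: "interference K \<alpha> p (u(0 := v)) = interference K \<alpha> p u"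
  unfolding interference_eq_suminf cancelled_fun_upd by (intro suminf_cong) (simp add: indicator_def)

text \<open>The outage event after division by the transmission power: \<open>t\<close> is noise
  over power, and the quotient has been cleared. With values in \<open>ennreal\<close>, infinite
  interference counts as outage when \<open>\<theta> > 0\<close>.\<close>

definition outage_set :: "nat \<Rightarrow> real \<Rightarrow> real \<Rightarrow> real \<Rightarrow> (nat \<Rightarrow> point) set" where
  "outage_set K \<alpha> \<theta> t =
    {u. ennreal (norm (u 0) powr (- \<alpha>)) < ennreal \<theta> * (interference K \<alpha> 1 u + ennreal t)}"

lemma sets_outage_set: "outage_set K \<alpha> \<theta> t \<in> sets seq_space"
proof -
  note measurable_coordinate[measurable] borel_measurable_interference[measurable]
  have "{u \<in> space seq_space. ennreal (norm (u 0) powr (- \<alpha>)) < ennreal \<theta> * (interference K \<alpha> 1 u + ennreal t)}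
      \<in> sets seq_space"
    by measurable
  then show ?thesis by (simp add: outage_set_def space_PiM)
qed

text \<open>Signal and interference both acquire the factor \<open>s powr (- \<alpha>)\<close>;
  dividing it out multiplies the noise by \<open>s powr \<alpha>\<close>. The factor is neither 0
  nor \<open>top\<close>, so it cancels in \<open>ennreal\<close>.\<close>

lemma outage_set_scaleR:
  assumes s: "s > 0" and \<theta>: "\<theta> > 0" and t: "t > 0"
  shows "(\<lambda>n. s *\<^sub>R u n) \<in> outage_set K \<alpha> \<theta> t \<longleftrightarrow> u \<in> outage_set K \<alpha> \<theta> (t * s powr \<alpha>)"
proof -
  let ?c = "ennreal (s powr (- \<alpha>))"
  have c: "?c \<noteq> 0" "?c \<noteq> top" using s by simp_all
  have "norm (s *\<^sub>R u 0) powr (- \<alpha>) = s powr (- \<alpha>) * norm (u 0) powr (- \<alpha>)"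
    using s by (simp add: powr_mult)
  then have lhs: "ennreal (norm (s *\<^sub>R u 0) powr (- \<alpha>)) = ?c * ennreal (norm (u 0) powr (- \<alpha>))"
    by (simp add: ennreal_mult)
  have "t = s powr (- \<alpha>) * (t * s powr \<alpha>)"
    using s by (simp add: powr_minus field_simps)
  then have "ennreal t = ?c * ennreal (t * s powr \<alpha>)"
    using t s by (simp add: ennreal_mult[symmetric])
  then have rhs: "ennreal \<theta> * (interference K \<alpha> 1 (\<lambda>n. s *\<^sub>R u n) + ennreal t) =
      ?c * (ennreal \<theta> * (interference K \<alpha> 1 u + ennreal (t * s powr \<alpha>)))"
    unfolding interference_scaleR[OF s] by (simp only: distrib_left mult.left_commute)
  have cancel: "?c * a < ?c * b \<longleftrightarrow> a < b" for a b
    using c ennreal_mult_strict_left_mono[of a b ?c] mult_left_mono[of b a ?c]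
    by (auto simp: zero_less_iff_neq_zero less_top not_less[symmetric])
  show ?thesis
    unfolding outage_set_def mem_Collect_eq lhs rhs cancel ..
qed

lemma outage_probability_eq:
  assumes p: "p > 0" and noise: "noise > 0" and \<theta>: "\<theta> > 0"
  shows "outage_probability M U K \<alpha> \<theta> noise p =
    measure M {x \<in> space M. (\<lambda>n. U n x) \<in> outage_set K \<alpha> \<theta> (noise / p)}"
proof -
  have iff: "ennreal (p * norm (u 0) powr (- \<alpha>)) / (interference K \<alpha> p u + ennreal noise) < ennreal \<theta> \<longleftrightarrow>
      u \<in> outage_set K \<alpha> \<theta> (noise / p)" for u
  proof (cases "interference K \<alpha> 1 u")
    case (real r)
    have pos: "0 < noise + p * r" using p noise real by (intro add_pos_nonneg) simp_all
    from real show ?thesis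
      unfolding interference_eq_cmult[OF less_imp_le[OF p]] outage_set_def
      using p noise \<theta>
      by (simp add: ennreal_mult[symmetric] ennreal_plus[symmetric] divide_ennreal ennreal_less_iff add_pos_nonneg add_nonneg_pos
          del: ennreal_plus) (simp add: field_simps pos)
  next
    \<comment> \<open>Division by \<open>top\<close> gives 0, so the quotient is below
      \<open>\<theta>\<close>; on the other side \<open>\<theta> * top\<close> exceeds the finite
      signal. Both statements hold.\<close>
    case top
    then show ?thesis
      unfolding interference_eq_cmult[OF less_imp_le[OF p]] outage_set_def
      using p \<theta> by (simp add: ennreal_mult_top divide_ennreal_def ennreal_top_mult)
  qed
  show ?thesis unfolding outage_probability_def iff[of "\<lambda>n. U n x" for x] ..
qed

text \<open>If the interference is infinite, the real sum is not summable and takes the junk value 0, and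
  both sides hold.\<close>

lemma infsum_margin_pos_iff:
  assumes \<theta>: "\<theta> > 0" and t: "t > 0"
  shows "(\<Sum>\<^sub>\<infinity>n\<in>UNIV. norm (u n) powr (- \<alpha>) * indicator (- ({0} \<union> cancelled K u)) n
      - inverse \<theta> * norm (u 0) powr (- \<alpha>) * indicator {0} n) + t > 0 \<longleftrightarrow>
    u \<in> outage_set K \<alpha> \<theta> t"
proof -
  define f where "f n = norm (u n) powr (- \<alpha>) * indicator (- ({0} \<union> cancelled K u)) n" for n
  define g where "g n = inverse \<theta> * norm (u 0) powr (- \<alpha>) * indicator {0} n" for n :: nat
  have f0: "0 \<le> f n" for n by (simp add: f_def)
  have I: "interference K \<alpha> 1 u = (\<Sum>n. ennreal (f n))"
    unfolding interference_eq_suminf by (intro suminf_cong) (simp add: f_def indicator_def)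
  have gsum: "(g has_sum inverse \<theta> * norm (u 0) powr (- \<alpha>)) UNIV"
  proof -
    have "(g has_sum g 0) {0}" using has_sum_finite[of "{0}" g] by simp
    then have "(g has_sum g 0) UNIV"
      by (rule has_sum_cong_neutral[THEN iffD1, rotated -1]) (auto simp: g_def)
    then show ?thesis by (simp add: g_def)
  qed
  show ?thesis
  proof (cases "summable f")
    case True
    have fs: "(f has_sum suminf f) UNIV"
      using True f0 by (intro norm_summable_imp_has_sum) (auto simp: summable_sums)
    have "((\<lambda>n. f n - g n) has_sum suminf f - inverse \<theta> * norm (u 0) powr (- \<alpha>)) UNIV"
      using has_sum_add[OF fs has_sum_uminusI[OF gsum]] by simp
    then have "(\<Sum>\<^sub>\<infinity>n\<in>UNIV. f n - g n) = suminf f - inverse \<theta> * norm (u 0) powr (- \<alpha>)"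
      by (rule infsumI)
    moreover have "interference K \<alpha> 1 u = ennreal (suminf f)"
      unfolding I by (rule suminf_ennreal2[OF f0 True])
    ultimately show ?thesis
      using \<theta> t suminf_nonneg[OF True f0]
      unfolding outage_set_def f_def[symmetric] g_def[symmetric] mem_Collect_eq
      by (simp add: ennreal_mult[symmetric] ennreal_plus[symmetric] ennreal_less_iff del: ennreal_plus)
         (simp add: field_simps)
  next
    case False
    have "\<not> (\<lambda>n. f n - g n) summable_on UNIV"
    proof
      assume "(\<lambda>n. f n - g n) summable_on UNIV"
      then have "(\<lambda>n. (f n - g n) + g n) summable_on UNIV"
        using gsum by (intro summable_on_add) (auto simp: summable_on_def)
      then have "f summable_on UNIV" by simp
      then show False using False summable_on_UNIV_nonneg_real_iff[of f] f0 by blast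
    qed
    then have "(\<Sum>\<^sub>\<infinity>n\<in>UNIV. f n - g n) = 0" by (rule infsum_not_exists)
    moreover have "interference K \<alpha> 1 u = top"
      unfolding I using False f0 by (metis summable_suminf_not_top)
    ultimately show ?thesis
      using \<theta> t unfolding outage_set_def f_def[symmetric] g_def[symmetric] mem_Collect_eq
      by (simp add: ennreal_mult_top)
  qed
qed

section \<open>Finiteness of the interference\<close>

text \<open>Up to a random constant, the path loss of each interfering mobile is bounded by the
  truncated path loss of its station. Campbell's formula gives the sum over the stations a finite
  mean because \<open>\<alpha> > 2\<close>.\<close>

lemma AE_interference_finite:
  assumes M: "prob_space M" and net: "uplink_network M l Y U" and l: "0 \<le> l" and \<alpha>: "2 < \<alpha>"
  shows "AE x in M. interference K \<alpha> 1 (\<lambda>n. U n x) < \<infinity>"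
proof -
  interpret prob_space M by fact
  let ?N = "\<lambda>x. {Y n x | n. n \<ge> 1}"
  let ?g = "\<lambda>T::point. ennreal (max (dist T 0) 1 powr (- \<alpha>))"
  have P: "poisson_process M l ?N" and ord: "AE x in M. Y 0 x = 0 \<and> strict_mono (\<lambda>n. norm (Y n x))"
    using net by (auto simp: uplink_network_def)
  have g: "?g \<in> borel_measurable borel" by measurable
  have meas: "(\<lambda>x. \<integral>\<^sup>+T. ?g T \<partial>count_space (?N x)) \<in> borel_measurable M"
    by (rule poisson_process_measurable_sum[OF P g])
  have "(\<integral>\<^sup>+x. (\<integral>\<^sup>+T. ?g T \<partial>count_space (?N x)) \<partial>M) = ennreal l * (\<integral>\<^sup>+T. ?g T \<partial>lborel)"
    by (rule poisson_process_Campbell[OF P l g])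
  also have "\<dots> < \<infinity>"
    using \<alpha> by (subst nn_integral_truncated_path_loss) (simp_all add: ennreal_mult_less_top)
  finally have fin: "AE x in M. (\<integral>\<^sup>+T. ?g T \<partial>count_space (?N x)) \<noteq> \<infinity>"
    by (intro nn_integral_PInf_AE[OF meas]) simp
  have cells: "AE x in M. \<forall>n. U n x \<in> voronoi_cell (\<lambda>n. Y n x) n"
    using AE_mobile_in_cell[OF M net] by (simp add: AE_all_countable)
  show ?thesis
    using fin cells ord
  proof eventually_elim
    case (elim x)
    have mono: "strict_mono (\<lambda>n. norm (Y n x))" and Y0: "Y 0 x = 0" using elim by auto
    have inj: "inj_on (\<lambda>n. Y n x) {1..}"
    proof (rule inj_onI)
      fix i j assume "Y i x = Y j x"
      then show "i = j" using strict_mono_eq[OF mono, of i j] by simp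
    qed
    \<comment> \<open>Station 1 is the nearest one, so \<open>m\<close> passes from the norm to the
      norm truncated at 1: \<open>m * max (norm (Y n x)) 1 \<le> norm (Y n x)\<close> for
      \<open>n \<ge> 1\<close>. That \<open>m\<close> is random does no harm, since finiteness is
      claimed outcome by outcome.\<close>
    define m where "m = min 1 (norm (Y 1 x))"
    have m: "0 < m"
      using strict_monoD[OF mono, of 0 1] by (simp add: m_def Y0)
    define C where "C = (m / 2) powr (- \<alpha>)"
    \<comment> \<open>the mobile is nearer to its own station than to the origin, so \<open>norm (Y n) \<le> 2 * norm (U n)\<close>\<close>
    have bound: "norm (U n x) powr (- \<alpha>) \<le> C * max (norm (Y n x)) 1 powr (- \<alpha>)" if n: "1 \<le> n" for n
    proof -
      have "dist (U n x) (Y n x) \<le> dist (U n x) (Y 0 x)"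
        using elim(2) by (simp add: voronoi_cell_def)
      then have "dist (U n x) (Y n x) \<le> norm (U n x)" by (simp add: Y0)
      then have half: "norm (Y n x) \<le> 2 * norm (U n x)"
        using norm_triangle_ineq2[of "Y n x" "U n x"] by (simp add: dist_norm norm_minus_commute)
      have "norm (Y 1 x) \<le> norm (Y n x)"
        using n strict_mono_less_eq[OF mono, of 1 n] by simp
      then have "m * max (norm (Y n x)) 1 \<le> norm (Y n x)"
      proof (cases "norm (Y n x) \<le> 1")
        case False
        then show ?thesis
          using mult_right_mono[of m 1 "norm (Y n x)"] by (simp add: m_def max_def)
      qed (simp add: m_def max_def)
      then have "m / 2 * max (norm (Y n x)) 1 \<le> norm (U n x)"
        using half by linarith
      then have "norm (U n x) powr (- \<alpha>) \<le> (m / 2 * max (norm (Y n x)) 1) powr (- \<alpha>)"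
        using m \<alpha> by (intro powr_mono2') auto
      also have "\<dots> = C * max (norm (Y n x)) 1 powr (- \<alpha>)"
        using m by (subst powr_mult) (auto simp: C_def)
      finally show ?thesis .
    qed
    have C0: "0 \<le> C" by (simp add: C_def)
    have img: "(\<lambda>n. Y n x) ` {1..} = ?N x" by auto
    \<comment> \<open>For an upper bound the cancelled terms are put back in.\<close>
    have "interference K \<alpha> 1 (\<lambda>n. U n x) \<le> (\<Sum>n. ennreal C * (?g (Y n x) * indicator {1..} n))"
      unfolding interference_eq_suminf
    proof (rule suminf_le)
      fix n
      show "ennreal (1 * norm (U n x) powr (- \<alpha>)) * indicator (- ({0} \<union> cancelled K (\<lambda>n. U n x))) n
          \<le> ennreal C * (?g (Y n x) * indicator {1..} n)"
      proof (cases "n = 0")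
        case False
        then have "ennreal (norm (U n x) powr (- \<alpha>)) \<le> ennreal C * ?g (Y n x)"
          using bound[of n] C0 by (simp add: ennreal_mult[symmetric])
        then show ?thesis using False by (auto simp: indicator_def)
      qed simp
    qed auto
    also have "\<dots> = ennreal C * (\<Sum>n. ?g (Y n x) * indicator {1..} n)"
      by (rule ennreal_suminf_cmult)
    also have "(\<Sum>n. ?g (Y n x) * indicator {1..} n) =
        (\<integral>\<^sup>+n\<in>{1..}. ?g (Y n x) \<partial>count_space UNIV)"
      by (rule nn_integral_count_space_nat[symmetric])
    also have "\<dots> = (\<integral>\<^sup>+T\<in>(\<lambda>n. Y n x) ` {1..}. ?g T \<partial>count_space UNIV)"
      by (rule nn_integral_count_compose_inj[OF inj])
    also have "\<dots> = (\<integral>\<^sup>+T. ?g T \<partial>count_space (?N x))"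
      unfolding img by (rule nn_integral_count_space_indicator[symmetric]) simp
    also have "ennreal C * \<dots> < \<infinity>"
      using elim(1) by (simp add: ennreal_mult_less_top less_top)
    finally show ?case .
  qed
qed

section \<open>Strict monotonicity of the outage probability\<close>

text \<open>With the station at the origin, being nearer to it than to \<open>y m\<close> is a
  linear inequality, so the cell is an intersection of half-planes.\<close>

lemma convex_voronoi_cell:
  assumes "y i = 0"
  shows "convex (voronoi_cell y i)"
proof -
  have "voronoi_cell y i = (\<Inter>m. {u. inner (2 *\<^sub>R y m) u \<le> inner (y m) (y m)})"
  proof -
    have "dist u (y i) \<le> dist u (y m) \<longleftrightarrow> inner (2 *\<^sub>R y m) u \<le> inner (y m) (y m)" for u m
    proof -
      have "dist u (y i) \<le> dist u (y m) \<longleftrightarrow> (norm u)\<^sup>2 \<le> (norm (u - y m))\<^sup>2"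
        by (simp add: assms dist_norm power2_le_iff_abs_le)
      also have "\<dots> \<longleftrightarrow> inner (2 *\<^sub>R y m) u \<le> inner (y m) (y m)"
        by (simp add: power2_norm_eq_inner inner_diff inner_commute)
      finally show ?thesis .
    qed
    then show ?thesis by (auto simp: voronoi_cell_def)
  qed
  then show ?thesis by (simp only:) (intro convex_INT convex_halfspace_le)
qed

text \<open>The triangle inequality puts the disc of half the distance to the nearest other station
  inside the cell.\<close>

lemma zero_in_interior_voronoi_cell:
  fixes y :: "nat \<Rightarrow> point"
  assumes y0: "y 0 = 0" and mono: "strict_mono (\<lambda>n. norm (y n))"
  shows "0 \<in> interior (voronoi_cell y 0)"
proof -
  let ?d = "norm (y 1) / 2"
  have d: "0 < ?d" using strict_monoD[OF mono, of 0 1] by (simp add: y0)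
  have "ball 0 ?d \<subseteq> voronoi_cell y 0"
  proof
    fix u :: point assume u: "u \<in> ball 0 ?d"
    have "norm u \<le> dist u (y m)" for m
    proof (cases "m = 0")
      case False
      then have "norm (y 1) \<le> norm (y m)"
        using strict_mono_less_eq[OF mono, of 1 m] by simp
      then show ?thesis
        using u norm_triangle_ineq2[of "y m" u] by (simp add: dist_norm norm_minus_commute)
    qed (simp add: y0)
    then show "u \<in> voronoi_cell y 0" by (simp add: voronoi_cell_def y0)
  qed
  then show ?thesis using d by (meson centre_in_ball interior_maximal open_ball subsetD)
qed

lemma outage_set_mono: "s \<le> t \<Longrightarrow> outage_set K \<alpha> \<theta> s \<subseteq> outage_set K \<alpha> \<theta> t"
  unfolding outage_set_def
  by (auto elim!: less_le_trans intro!: mult_left_mono add_left_mono ennreal_leI)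

text \<open>Positivity at \<open>s\<close> supplies outcomes in outage at \<open>s\<close>. For them
  \<open>U 0\<close> lies beyond the annulus, and convexity of the cell forces the cell to contain a
  part of the annulus of positive area.\<close>

lemma outage_strict_mono:
  assumes M: "prob_space M" and net: "uplink_network M l Y U" and l: "0 \<le> l" and \<alpha>: "2 < \<alpha>"
    and \<theta>: "0 < \<theta>" and s: "0 < s" "s < t"
    and pos: "measure M {x \<in> space M. (\<lambda>n. U n x) \<in> outage_set K \<alpha> \<theta> s} > 0"
  shows "measure M {x \<in> space M. (\<lambda>n. U n x) \<in> outage_set K \<alpha> \<theta> s} <
    measure M {x \<in> space M. (\<lambda>n. U n x) \<in> outage_set K \<alpha> \<theta> t}"
proof -
  interpret prob_space M by fact
  note Um = uplink_measurable(4)[OF net]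
  let ?D = "outage_set K \<alpha> \<theta> t - outage_set K \<alpha> \<theta> s"
  let ?E = "\<lambda>A. {x \<in> space M. (\<lambda>n. U n x) \<in> A}"
  have E: "?E A \<in> sets M" if "A \<in> sets seq_space" for A
  proof -
    have "?E A = (\<lambda>x n. U n x) -` A \<inter> space M" by auto
    then show ?thesis using measurable_sets[OF Um that] by simp
  qed
  have D: "?D \<in> sets seq_space" by (intro sets.Diff sets_outage_set)
  let ?h = "\<lambda>z :: (nat \<Rightarrow> point) \<times> (nat \<Rightarrow> point). indicator ?D (snd z) :: ennreal"
  have h: "?h \<in> borel_measurable (seq_space \<Otimes>\<^sub>M seq_space)"
    by (rule measurable_compose[OF measurable_snd borel_measurable_indicator[OF D]])
  \<comment> \<open>If the gain were null, resampling \<open>U 0\<close> would leave, for almost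
    every outcome, only a null set of positions in the cell that land in \<open>?D\<close>. The rest
    shows that such an outcome is not in outage at \<open>s\<close>, which contradicts
    \<open>pos\<close>.\<close>
  have "measure M (?E ?D) \<noteq> 0"
  proof
    assume "measure M (?E ?D) = 0"
    then have "emeasure M (?E ?D) = 0" by (simp add: emeasure_eq_measure)
    moreover have "emeasure M (?E ?D) = (\<integral>\<^sup>+x. ?h (\<lambda>n. Y n x, \<lambda>n. U n x) \<partial>M)"
    proof -
      have "emeasure M (?E ?D) = (\<integral>\<^sup>+x. indicator (?E ?D) x \<partial>M)"
        by (rule nn_integral_indicator[OF E[OF D], symmetric])
      also have "\<dots> = (\<integral>\<^sup>+x. ?h (\<lambda>n. Y n x, \<lambda>n. U n x) \<partial>M)"
        by (rule nn_integral_cong) (simp add: indicator_def)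
      finally show ?thesis .
    qed
    ultimately have zero: "(\<integral>\<^sup>+x. \<integral>\<^sup>+v. cell_density (\<lambda>n. Y n x) 0 v *
        ?h (\<lambda>n. Y n x, (\<lambda>n. U n x)(0 := v)) \<partial>lborel \<partial>M) = 0"
      unfolding uplink_resample[OF M net h, of 0] by simp
    have pair: "(\<lambda>z. ((\<lambda>n. Y n (fst z)), (\<lambda>n. U n (fst z))(0 := snd z)))
        \<in> M \<Otimes>\<^sub>M lborel \<rightarrow>\<^sub>M seq_space \<Otimes>\<^sub>M seq_space"
      by (intro measurable_Pair measurable_fun_upd_seq measurable_compose[OF measurable_fst Um]
          measurable_compose[OF measurable_fst uplink_measurable(3)[OF net]]
          measurable_compose[OF measurable_snd measurable_ident_sets]) simp
    have pair': "(\<lambda>z. ((\<lambda>n. Y n (fst z)), snd z)) \<in> M \<Otimes>\<^sub>M lborel \<rightarrow>\<^sub>M seq_space \<Otimes>\<^sub>M borel"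
      by (intro measurable_Pair measurable_compose[OF measurable_fst uplink_measurable(3)[OF net]]
          measurable_compose[OF measurable_snd measurable_ident_sets]) simp
    have integrand: "(\<lambda>(x, v). cell_density (\<lambda>n. Y n x) 0 v * ?h (\<lambda>n. Y n x, (\<lambda>n. U n x)(0 := v)))
        \<in> borel_measurable (M \<Otimes>\<^sub>M lborel)"
      using borel_measurable_times_ennreal[OF measurable_compose[OF pair' borel_measurable_cell_density]
          measurable_compose[OF pair h]]
      unfolding split_beta fst_conv snd_conv .
    have "(\<lambda>x. \<integral>\<^sup>+v. cell_density (\<lambda>n. Y n x) 0 v * ?h (\<lambda>n. Y n x, (\<lambda>n. U n x)(0 := v)) \<partial>lborel)
        \<in> borel_measurable M"
      by (rule lborel.borel_measurable_nn_integral[OF integrand])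
    then have inner: "AE x in M. (\<integral>\<^sup>+v. cell_density (\<lambda>n. Y n x) 0 v *
        ?h (\<lambda>n. Y n x, (\<lambda>n. U n x)(0 := v)) \<partial>lborel) = 0"
      using zero by (simp only: nn_integral_0_iff_AE)
    have ord: "AE x in M. Y 0 x = 0 \<and> strict_mono (\<lambda>n. norm (Y n x))"
      using net by (simp add: uplink_network_def)
    have "AE x in M. (\<lambda>n. U n x) \<notin> outage_set K \<alpha> \<theta> s"
      using inner ord AE_cell_volume[OF M net, of 0] AE_mobile_in_cell[OF M net, of 0]
        AE_mobile_nonzero[OF M net, of 0] AE_interference_finite[OF M net l \<alpha>, of K] AE_space
    proof eventually_elim
      case (elim x)
      let ?V = "voronoi_cell (\<lambda>n. Y n x) 0"
      let ?u = "\<lambda>n. U n x"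
      obtain r where r: "interference K \<alpha> 1 ?u = ennreal r" "0 \<le> r"
        using elim(6) by (cases "interference K \<alpha> 1 ?u") auto
      \<comment> \<open>The interference stays at the finite value \<open>r\<close> while
        \<open>v\<close> moves, so outage becomes a real condition on \<open>norm v\<close>
        alone.\<close>
      have mem: "?u(0 := v) \<in> outage_set K \<alpha> \<theta> t' \<longleftrightarrow> norm v powr (- \<alpha>) < \<theta> * (r + t')"
        if "0 < t'" for v t'
        unfolding outage_set_def mem_Collect_eq interference_fun_upd r(1)
        using that \<theta> r(2)
        by (simp add: ennreal_mult[symmetric] ennreal_plus[symmetric] ennreal_less_iff del: ennreal_plus)
      show ?case
      proof
        assume "?u \<in> outage_set K \<alpha> \<theta> s"
        then have U0: "norm (U 0 x) powr (- \<alpha>) < \<theta> * (r + s)"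
          using mem[of s "U 0 x"] s(1) fun_upd_triv[of ?u 0] by (simp only:)
        \<comment> \<open>The radii \<open>a\<close> and \<open>b\<close> are where outage begins at
          the noise levels \<open>t\<close> and \<open>s\<close>. More noise means a smaller radius,
          and the open annulus between them consists of positions in outage at \<open>t\<close> and
          not at \<open>s\<close>.\<close>
        define a where "a = (\<theta> * (r + t)) powr (- 1 / \<alpha>)"
        define b where "b = (\<theta> * (r + s)) powr (- 1 / \<alpha>)"
        have R: "0 < \<theta> * (r + s)" "\<theta> * (r + s) < \<theta> * (r + t)"
          using \<theta> r(2) s by simp_all
        have pow: "(c powr (- 1 / \<alpha>)) powr (- \<alpha>) = c" if "0 < c" for c :: real
          using that \<alpha> by (simp add: powr_powr)
        have "\<theta> * (r + t) \<noteq> 0" using R by linarith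
        then have a0: "0 < a" unfolding a_def powr_gt_zero .
        have ab: "a < b"
          unfolding a_def b_def using R \<alpha> by (intro powr_less_mono2_neg) auto
        have "b < norm (U 0 x)"
        proof (rule ccontr)
          assume "\<not> b < norm (U 0 x)"
          then have "b powr (- \<alpha>) \<le> norm (U 0 x) powr (- \<alpha>)"
            using elim(5) \<alpha> by (intro powr_mono2') auto
          then show False using U0 pow[OF R(1)] by (simp add: b_def)
        qed
        \<comment> \<open>Chosen so that \<open>w\<close> is the point on the ray towards
          \<open>U 0 x\<close> with norm \<open>(a + b) / 2\<close>, in the middle of the annulus;
          \<open>c < 1\<close> because \<open>U 0 x\<close> lies beyond \<open>b\<close>.\<close>
        define c where "c = (a + b) / (2 * norm (U 0 x))"
        define w where "w = c *\<^sub>R U 0 x"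
        have N: "0 < norm (U 0 x)" using elim(5) by simp
        have c: "0 < c" "c < 1"
        proof -
          have "0 < a + b" "a + b < 2 * norm (U 0 x)"
            using a0 ab \<open>b < norm (U 0 x)\<close> by linarith+
          then show "0 < c" "c < 1"
            using N unfolding c_def by (simp_all only: zero_less_divide_iff divide_less_eq) simp_all
        qed
        have "norm w = c * norm (U 0 x)" using c by (simp add: w_def)
        then have w: "norm w = (a + b) / 2"
          using N by (simp add: c_def)
        have "w \<in> open_segment 0 (U 0 x)"
          using c elim(5) by (auto simp: in_segment w_def intro!: exI[of _ c])
        \<comment> \<open>In a convex set, the open segment from an interior point, here the origin,
          to a point of the closure stays in the interior.\<close>
        then have "w \<in> interior ?V"
          using in_interior_closure_convex_segment[of ?V 0 "U 0 x"] elim(2,4)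
            convex_voronoi_cell[of "\<lambda>n. Y n x" 0] zero_in_interior_voronoi_cell[of "\<lambda>n. Y n x"]
            closure_subset[of ?V] by blast
        then obtain e where e: "0 < e" "ball w e \<subseteq> ?V"
          by (meson mem_interior)
        \<comment> \<open>The first bound keeps the disc inside the cell; the second keeps it inside
          the annulus, as the norm is 1-Lipschitz.\<close>
        define \<delta> where "\<delta> = min e ((b - a) / 2)"
        have \<delta>: "0 < \<delta>" using e(1) ab by (simp add: \<delta>_def)
        have hit: "?u(0 := v) \<in> ?D" "v \<in> ?V" if v: "v \<in> ball w \<delta>" for v
        proof -
          show "v \<in> ?V" using v e(2) by (auto simp: \<delta>_def)
          have "\<bar>norm v - norm w\<bar> < (b - a) / 2"
            using v norm_triangle_ineq3[of v w] by (simp add: \<delta>_def dist_norm norm_minus_commute)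
          then have "a < norm v" "norm v < b" unfolding w by (auto simp: abs_if field_simps split: if_splits)
          moreover have "0 < norm v" using a0 \<open>a < norm v\<close> by linarith
          ultimately have "norm v powr (- \<alpha>) < a powr (- \<alpha>)" "b powr (- \<alpha>) < norm v powr (- \<alpha>)"
            using a0 \<alpha> by (intro powr_less_mono2_neg; simp)+
          then show "?u(0 := v) \<in> ?D"
            using mem[of t v] mem[of s v] s pow[of "\<theta> * (r + t)"] pow[of "\<theta> * (r + s)"] R
            by (simp add: a_def b_def)
        qed
        have "AE v in lborel. cell_density (\<lambda>n. Y n x) 0 v * ?h (\<lambda>n. Y n x, ?u(0 := v)) = 0"
        proof -
          have "(\<lambda>v. cell_density (\<lambda>n. Y n x) 0 v * ?h (\<lambda>n. Y n x, ?u(0 := v))) \<in> borel_measurable lborel"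
            using measurable_compose[OF measurable_Pair1'[OF elim(7)] integrand] unfolding split .
          then show ?thesis using elim(1) by (simp only: nn_integral_0_iff_AE)
        qed
        \<comment> \<open>On the disc neither factor vanishes: the indicator is 1, and the density
          is nonzero because the cell has finite area.\<close>
        then have "AE v in lborel. v \<notin> ball w \<delta>"
        proof eventually_elim
          case (elim v)
          then show ?case
            using hit[of v] \<open>emeasure lborel ?V \<noteq> 0 \<and> emeasure lborel ?V \<noteq> \<infinity>\<close>
            by (auto simp: cell_density_def ennreal_divide_eq_0_iff)
        qed
        then have "emeasure lborel (ball w \<delta>) = 0"
          by (subst (asm) AE_iff_measurable[of "ball w \<delta>"]) auto
        then show False using \<delta> emeasure_ball[of \<delta> w] by (simp add: unit_ball_vol_2)
      qed
    qed
    then have "measure M (?E (outage_set K \<alpha> \<theta> s)) = 0"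
      using prob_eq_0[OF E[OF sets_outage_set]] by simp
    then show False using pos by simp
  qed
  moreover have "measure M (?E (outage_set K \<alpha> \<theta> t)) =
      measure M (?E (outage_set K \<alpha> \<theta> s)) + measure M (?E ?D)"
  proof -
    have "?E (outage_set K \<alpha> \<theta> t) = ?E (outage_set K \<alpha> \<theta> s) \<union> ?E ?D"
      using outage_set_mono[of s t K \<alpha> \<theta>] s by auto
    then show ?thesis
      using E[OF D] E[OF sets_outage_set] by (simp only:) (rule finite_measure_Union; auto)
  qed
  ultimately show ?thesis
    using measure_nonneg[of M "?E ?D"] by linarith
qed

section \<open>Received power\<close>

lemma (in prob_space) indep_set_mono:
  assumes "indep_set A B" "A' \<subseteq> A" "B' \<subseteq> B"
  shows "indep_set A' B'"
proof (rule indep_setI)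
  show "A' \<subseteq> events" "B' \<subseteq> events"
    using indep_setD_ev1[OF assms(1)] indep_setD_ev2[OF assms(1)] assms(2,3) by auto
  show "prob (a \<inter> b) = prob a * prob b" if "a \<in> A'" "b \<in> B'" for a b
    using that assms(2,3) by (intro indep_setD[OF assms(1)]) auto
qed

text \<open>Independence makes the joint law a product. Writing the inner integral over a copy
  \<open>x'\<close> allows the observer \<open>X x\<close> to be frozen while the mean over
  \<open>Y\<close> is taken.\<close>

lemma (in prob_space) indep_pair_nn_integral:
  assumes X: "X \<in> M \<rightarrow>\<^sub>M S" and Y: "Y \<in> M \<rightarrow>\<^sub>M T"
    and indep: "indep_set (sets (vimage_algebra (space M) X S)) (sets (vimage_algebra (space M) Y T))"
    and h: "h \<in> borel_measurable (S \<Otimes>\<^sub>M T)"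
  shows "(\<integral>\<^sup>+x. h (X x, Y x) \<partial>M) = (\<integral>\<^sup>+x. \<integral>\<^sup>+x'. h (X x, Y x') \<partial>M \<partial>M)"
proof -
  interpret Y: prob_space "distr M T Y" by (rule prob_space_distr[OF Y])
  interpret X: prob_space "distr M S X" by (rule prob_space_distr[OF X])
  have eq: "distr M S X \<Otimes>\<^sub>M distr M T Y = distr M (S \<Otimes>\<^sub>M T) (\<lambda>x. (X x, Y x))"
  proof (rule pair_measure_eqI)
    show "sigma_finite_measure (distr M S X)" "sigma_finite_measure (distr M T Y)"
      by unfold_locales
    show "sets (distr M S X \<Otimes>\<^sub>M distr M T Y) = sets (distr M (S \<Otimes>\<^sub>M T) (\<lambda>x. (X x, Y x)))"
      unfolding sets_distr by (rule sets_pair_measure_cong) simp_all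
    fix A B assume "A \<in> sets (distr M S X)" "B \<in> sets (distr M T Y)"
    then have A: "A \<in> sets S" and B: "B \<in> sets T" by simp_all
    have "prob ((X -` A \<inter> space M) \<inter> (Y -` B \<inter> space M)) =
        prob (X -` A \<inter> space M) * prob (Y -` B \<inter> space M)"
      using A B by (intro indep_setD[OF indep] in_vimage_algebra)
    moreover have "(\<lambda>x. (X x, Y x)) -` (A \<times> B) \<inter> space M = (X -` A \<inter> space M) \<inter> (Y -` B \<inter> space M)"
      by auto
    ultimately show "emeasure (distr M S X) A * emeasure (distr M T Y) B =
        emeasure (distr M (S \<Otimes>\<^sub>M T) (\<lambda>x. (X x, Y x))) (A \<times> B)"
      unfolding emeasure_distr[OF X A] emeasure_distr[OF Y B]
        emeasure_distr[OF measurable_Pair[OF X Y] pair_measureI[OF A B]]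
      by (simp add: emeasure_eq_measure ennreal_mult)
  qed
  have sets: "sets (distr M S X \<Otimes>\<^sub>M distr M T Y) = sets (S \<Otimes>\<^sub>M T)"
    by (rule sets_pair_measure_cong) simp_all
  have h': "h \<in> borel_measurable (distr M S X \<Otimes>\<^sub>M distr M T Y)"
    using h by (simp only: measurable_cong_sets[OF sets refl])
  have sect: "(\<lambda>c. h (u, c)) \<in> borel_measurable T" if "u \<in> space S" for u
    by (rule measurable_compose[OF measurable_Pair1'[OF that] h])
  have "(\<integral>\<^sup>+x. h (X x, Y x) \<partial>M) = (\<integral>\<^sup>+z. h z \<partial>(distr M S X \<Otimes>\<^sub>M distr M T Y))"
    unfolding eq by (rule nn_integral_distr[symmetric, OF measurable_Pair[OF X Y]])
      (simp only: measurable_distr_eq1 h)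
  also have "\<dots> = (\<integral>\<^sup>+u. \<integral>\<^sup>+c. h (u, c) \<partial>distr M T Y \<partial>distr M S X)"
    by (rule Y.nn_integral_fst[OF h', symmetric])
  also have "\<dots> = (\<integral>\<^sup>+x. \<integral>\<^sup>+c. h (X x, c) \<partial>distr M T Y \<partial>M)"
    by (rule nn_integral_distr[OF X]) (rule Y.borel_measurable_nn_integral_fst[OF h'])
  also have "\<dots> = (\<integral>\<^sup>+x. \<integral>\<^sup>+x'. h (X x, Y x') \<partial>M \<partial>M)"
  proof (rule nn_integral_cong)
    fix x assume x: "x \<in> space M"
    show "(\<integral>\<^sup>+c. h (X x, c) \<partial>distr M T Y) = (\<integral>\<^sup>+x'. h (X x, Y x') \<partial>M)"
      by (rule nn_integral_distr[OF Y]) (simp only: measurable_distr_eq1 sect[OF measurable_space[OF X x]])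
  qed
  finally show ?thesis .
qed

text \<open>With the mobile frozen, Campbell's formula applies around a fixed point. The path-loss
  integral is the same for every point, so the law of \<open>X\<close> drops out.\<close>

lemma (in prob_space) mean_isotropic_power:
  assumes P: "poisson_process M l N" and l: "0 \<le> l" and X: "X \<in> borel_measurable M"
    and indep: "indep_set (sets (vimage_algebra (space M) X borel)) (sets (vimage_algebra (space M) N point_configs))"
    and q: "0 \<le> q" and \<nu>: "0 < \<nu>" and \<beta>: "2 < \<beta>"
  shows "(\<integral>\<^sup>+x. isotropic_power \<nu> \<beta> q (X x) (N x) \<partial>M) =
    ennreal (q * l * (pi * \<nu> powr (2 - \<beta>) / (1 - 2 / \<beta>)))"
proof -
  let ?f = "\<lambda>(u :: point, T :: point). ennreal (max (dist T u) \<nu> powr (- \<beta>))"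
  let ?h = "\<lambda>z. ennreal q * (case z of (u, c) \<Rightarrow> \<integral>\<^sup>+T. ?f (u, T) \<partial>count_space c)"
  have "?f \<in> borel_measurable (borel \<Otimes>\<^sub>M borel)"
    by measurable
  then have h: "?h \<in> borel_measurable (borel \<Otimes>\<^sub>M point_configs)"
    by (intro borel_measurable_times_ennreal borel_measurable_const borel_measurable_config_sum)
  have loss: "0 \<le> pi * \<nu> powr (2 - \<beta>) / (1 - 2 / \<beta>)"
    using \<beta> by (intro divide_nonneg_nonneg) auto
  have "(\<integral>\<^sup>+x. isotropic_power \<nu> \<beta> q (X x) (N x) \<partial>M) = (\<integral>\<^sup>+x. ?h (X x, N x) \<partial>M)"
  proof (rule nn_integral_cong)
    fix x assume "x \<in> space M"
    then have "countable (N x)"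
      by (intro countable_config poisson_process_config[OF P])
    then show "isotropic_power \<nu> \<beta> q (X x) (N x) = ?h (X x, N x)"
      unfolding isotropic_power_def by (simp only: infsum_ennreal_eq_nn_integral split)
  qed
  also have "\<dots> = (\<integral>\<^sup>+x. \<integral>\<^sup>+x'. ?h (X x, N x') \<partial>M \<partial>M)"
    by (rule indep_pair_nn_integral[OF X poisson_process_measurable[OF P] indep h])
  also have "\<dots> = (\<integral>\<^sup>+x. ennreal (q * l * (pi * \<nu> powr (2 - \<beta>) / (1 - 2 / \<beta>))) \<partial>M)"
  proof (rule nn_integral_cong)
    fix x
    let ?g = "\<lambda>T. ennreal (max (dist T (X x)) \<nu> powr (- \<beta>))"
    have g: "?g \<in> borel_measurable borel" by measurable
    have meas: "(\<lambda>x'. \<integral>\<^sup>+T. ?g T \<partial>count_space (N x')) \<in> borel_measurable M"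
      by (rule poisson_process_measurable_sum[OF P g])
    have "(\<integral>\<^sup>+x'. ?h (X x, N x') \<partial>M) = ennreal q * (\<integral>\<^sup>+x'. \<integral>\<^sup>+T. ?g T \<partial>count_space (N x') \<partial>M)"
      unfolding split by (rule nn_integral_cmult[OF meas])
    also have "\<dots> = ennreal q * (ennreal l * ennreal (pi * \<nu> powr (2 - \<beta>) / (1 - 2 / \<beta>)))"
      by (simp only: poisson_process_Campbell[OF P l g] nn_integral_truncated_path_loss[OF \<nu> \<beta>])
    also have "\<dots> = ennreal (q * l * (pi * \<nu> powr (2 - \<beta>) / (1 - 2 / \<beta>)))"
      using q l loss by (simp only: ennreal_mult mult_nonneg_nonneg mult.assoc)
    finally show "(\<integral>\<^sup>+x'. ?h (X x, N x') \<partial>M) = ennreal (q * l * (pi * \<nu> powr (2 - \<beta>) / (1 - 2 / \<beta>)))" .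
  qed
  finally show ?thesis by (simp add: emeasure_space_1)
qed

text \<open>\<open>arg_min_on\<close> is a choice operator, informative only once a minimizer
  exists. Local finiteness reduces the search to the finitely many points no farther away than
  \<open>T\<close>.\<close>

lemma arg_min_on_config:
  assumes c: "c \<in> space point_configs" and T: "T \<in> c"
  shows "dist u (arg_min_on (\<lambda>T. dist u T) c) \<le> dist u T"
proof -
  let ?F = "c \<inter> cball u (dist u T)"
  have F: "finite ?F" "?F \<noteq> {}"
    using finite_config_Int[OF c] T by auto
  have "\<exists>m\<in>(\<lambda>T. dist u T) ` ?F. \<not> (\<exists>x\<in>(\<lambda>T. dist u T) ` ?F. x < m)"
    using F by (intro ex_min_if_finite) simp_all
  then obtain T' where T': "T' \<in> ?F" and min: "\<And>S. S \<in> ?F \<Longrightarrow> \<not> dist u S < dist u T'"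
    by blast
  have "is_arg_min (\<lambda>T. dist u T) (\<lambda>T. T \<in> c) T'"
    unfolding is_arg_min_def
  proof (intro conjI notI)
    show "T' \<in> c" using T' by simp
    assume "\<exists>S. S \<in> c \<and> dist u S < dist u T'"
    then obtain S where S: "S \<in> c" "dist u S < dist u T'" by blast
    then have "S \<in> ?F" using T' by auto
    with min S show False by blast
  qed
  then have "is_arg_min (\<lambda>T. dist u T) (\<lambda>T. T \<in> c) (arg_min_on (\<lambda>T. dist u T) c)"
    unfolding arg_min_on_def arg_min_def by (rule someI)
  then show ?thesis using T by (auto simp: is_arg_min_linorder)
qed

text \<open>Within distance \<open>\<nu>\<close> the truncation makes the main-lobe term equal to
  the stated bound; the side-lobe sum is nonnegative and is dropped.\<close>

lemma directed_power_ge: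
  assumes c: "c \<in> space point_configs" and hit: "c \<inter> cball u \<nu> \<noteq> {}"
  shows "ennreal (zm * q * \<nu> powr (- \<beta>)) \<le> directed_power zm zs \<nu> \<beta> q u c"
proof -
  obtain T where T: "T \<in> c" "dist u T \<le> \<nu>" using hit by auto
  then have "max (dist u (arg_min_on (\<lambda>T. dist u T) c)) \<nu> = \<nu>"
    using arg_min_on_config[OF c T(1), of u] by simp
  then show ?thesis
    using T(1) by (auto simp: directed_power_def Let_def)
qed

lemma (in prob_space) poisson_process_hit:
  assumes P: "poisson_process M l N" and B: "B \<in> sets borel" "bounded B"
  shows "{x \<in> space M. N x \<inter> B \<noteq> {}} \<in> events"
    and "emeasure M {x \<in> space M. N x \<inter> B \<noteq> {}} = ennreal (1 - exp (- (l * measure lborel B)))"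
proof -
  let ?Z = "{x \<in> space M. card (N x \<inter> B) = 0}"
  have Z: "?Z \<in> sets M"
  proof -
    have "?Z = (\<lambda>x. card (N x \<inter> B)) -` {0} \<inter> space M" by auto
    then show ?thesis
      using measurable_sets[OF poisson_process_measurable_card[OF P B], of "{0}"] by simp
  qed
  \<comment> \<open>Count 0 means an empty intersection only because the intersection is finite:
    \<open>card\<close> of an infinite set is 0 as well.\<close>
  have eq: "{x \<in> space M. N x \<inter> B \<noteq> {}} = space M - ?Z"
    using finite_config_Int[OF poisson_process_config[OF P] B(2)] by auto
  show "{x \<in> space M. N x \<inter> B \<noteq> {}} \<in> events"
    unfolding eq using Z by (rule sets.compl_sets)
  show "emeasure M {x \<in> space M. N x \<inter> B \<noteq> {}} = ennreal (1 - exp (- (l * measure lborel B)))"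
    unfolding eq using prob_compl[OF Z] poisson_process_card[OF P B, of 0]
    by (simp add: emeasure_eq_measure)
qed

text \<open>The disc of radius \<open>\<nu>\<close> around the mobile has the same area wherever the
  mobile is, so the void probability of the beacon process gives the same hit probability for every
  position.\<close>

lemma (in prob_space) mean_directed_power_ge:
  assumes P: "poisson_process M l N" and X: "X \<in> borel_measurable M"
    and indep: "indep_set (sets (vimage_algebra (space M) X borel)) (sets (vimage_algebra (space M) N point_configs))"
    and q: "0 \<le> zm * q" and \<nu>: "0 < \<nu>"
  shows "ennreal (zm * q * \<nu> powr (- \<beta>) * (1 - exp (- (l * (pi * \<nu>\<^sup>2)))))
    \<le> (\<integral>\<^sup>+x. directed_power zm zs \<nu> \<beta> q (X x) (N x) \<partial>M)"
proof -
  let ?c = "ennreal (zm * q * \<nu> powr (- \<beta>))"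
  \<comment> \<open>Being hit is expressed through a count, since counts are known to be jointly
    measurable in position and configuration.\<close>
  let ?n = "\<lambda>(u, c). \<integral>\<^sup>+T. indicator {z. dist (fst z) (snd z) \<le> \<nu>} (u, T) \<partial>count_space c"
  let ?h = "\<lambda>z. indicator (- {0 :: ennreal}) (?n z) :: ennreal"
  have n: "?n (u, c) = emeasure (count_space UNIV) (c \<inter> cball u \<nu>)" for u and c :: "point set"
  proof -
    have "?n (u, c) = (\<integral>\<^sup>+T. indicator (cball u \<nu>) T \<partial>count_space c)"
      unfolding split by (rule nn_integral_cong) (simp add: indicator_def)
    then show ?thesis by (simp only: nn_integral_config_indicator)
  qed
  have hit: "?h (u, c) = indicator {c. c \<inter> cball u \<nu> \<noteq> {}} c" for u and c :: "point set"
    unfolding n by (simp add: indicator_def emeasure_count_space_eq_0)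
  have "{z. dist (fst z) (snd z) \<le> \<nu>} \<in> sets (borel \<Otimes>\<^sub>M (borel :: point measure))"
  proof -
    have "closed {z :: point \<times> point. dist (fst z) (snd z) \<le> \<nu>}"
      by (intro closed_Collect_le continuous_intros)
    then show ?thesis by (simp only: borel_prod borel_closed)
  qed
  then have "?n \<in> borel_measurable (borel \<Otimes>\<^sub>M point_configs)"
    by (intro borel_measurable_config_sum borel_measurable_indicator)
  then have h: "?h \<in> borel_measurable (borel \<Otimes>\<^sub>M point_configs)"
    by (rule measurable_compose) simp
  have rv: "(\<lambda>x. (X x, N x)) \<in> M \<rightarrow>\<^sub>M borel \<Otimes>\<^sub>M point_configs"
    by (rule measurable_Pair[OF X poisson_process_measurable[OF P]])
  have "(\<integral>\<^sup>+x. ?h (X x, N x) \<partial>M) = (\<integral>\<^sup>+x. \<integral>\<^sup>+x'. ?h (X x, N x') \<partial>M \<partial>M)"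
    by (rule indep_pair_nn_integral[OF X poisson_process_measurable[OF P] indep h])
  also have "\<dots> = (\<integral>\<^sup>+x. ennreal (1 - exp (- (l * (pi * \<nu>\<^sup>2)))) \<partial>M)"
  proof (rule nn_integral_cong)
    fix x
    let ?B = "cball (X x) \<nu>"
    let ?H = "{x' \<in> space M. N x' \<inter> ?B \<noteq> {}}"
    have B: "?B \<in> sets borel" "bounded ?B" by auto
    have "(\<integral>\<^sup>+x'. ?h (X x, N x') \<partial>M) = (\<integral>\<^sup>+x'. indicator ?H x' \<partial>M)"
      unfolding hit by (rule nn_integral_cong) (simp add: indicator_def)
    also have "\<dots> = ennreal (1 - exp (- (l * measure lborel ?B)))"
      unfolding nn_integral_indicator[OF poisson_process_hit(1)[OF P B]]
      by (rule poisson_process_hit(2)[OF P B])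
    also have "measure lborel ?B = pi * \<nu>\<^sup>2"
      using emeasure_cball_point[of \<nu> "X x"] \<nu> by (simp add: measure_def)
    finally show "(\<integral>\<^sup>+x'. ?h (X x, N x') \<partial>M) = ennreal (1 - exp (- (l * (pi * \<nu>\<^sup>2))))" .
  qed
  finally have mean: "(\<integral>\<^sup>+x. ?h (X x, N x) \<partial>M) = ennreal (1 - exp (- (l * (pi * \<nu>\<^sup>2))))"
    by (simp add: emeasure_space_1)
  have "ennreal (zm * q * \<nu> powr (- \<beta>) * (1 - exp (- (l * (pi * \<nu>\<^sup>2))))) =
      ?c * (\<integral>\<^sup>+x. ?h (X x, N x) \<partial>M)"
    unfolding mean using q by (intro ennreal_mult') simp
  also have "\<dots> = (\<integral>\<^sup>+x. ?c * ?h (X x, N x) \<partial>M)"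
    by (rule nn_integral_cmult[OF measurable_compose[OF rv h], symmetric])
  \<comment> \<open>Monotonicity of \<open>nn_integral\<close> asks for no measurability, so nothing
    has to be shown about the dependence of the chosen nearest beacon on the outcome.\<close>
  also have "\<dots> \<le> (\<integral>\<^sup>+x. directed_power zm zs \<nu> \<beta> q (X x) (N x) \<partial>M)"
  proof (rule nn_integral_mono)
    fix x assume "x \<in> space M"
    from directed_power_ge[OF poisson_process_config[OF P this]]
    show "?c * ?h (X x, N x) \<le> directed_power zm zs \<nu> \<beta> q (X x) (N x)"
      unfolding hit by (simp add: indicator_def)
  qed
  finally show ?thesis .
qed

section \<open>The feasibility region\<close>

lemma hybrid_network_indep:
  assumes hyb: "hybrid_network M Y U \<Psi>" and lb: "lb > 0" and lp: "lp \<ge> 0"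
  shows "prob_space.indep_set M (sets (vimage_algebra (space M) (U lb 0) borel))
    (sets (vimage_algebra (space M) (\<Psi> lp) point_configs))"
proof -
  interpret prob_space M using hyb by (simp add: hybrid_network_def)
  let ?pair = "\<lambda>x. (\<lambda>n. Y lb n x, \<lambda>n. U lb n x)"
  have ind: "indep_set (sets (vimage_algebra (space M) (\<Psi> lp) point_configs))
      (sets (vimage_algebra (space M) ?pair (seq_space \<Otimes>\<^sub>M seq_space)))"
    using hyb lb lp by (simp add: hybrid_network_def)
  have "sets (vimage_algebra (space M) (U lb 0) borel) \<subseteq>
      sets (vimage_algebra (space M) ?pair (seq_space \<Otimes>\<^sub>M seq_space))"
    unfolding sets_vimage_algebra
  proof (rule sigma_sets_mono', clarify)
    fix A :: "point set" assume A: "A \<in> sets borel"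
    have proj: "(\<lambda>z. snd z 0) \<in> seq_space \<Otimes>\<^sub>M seq_space \<rightarrow>\<^sub>M borel"
      by (rule measurable_compose[OF measurable_snd measurable_coordinate])
    have "(\<lambda>z. snd z 0) -` A \<in> sets (seq_space \<Otimes>\<^sub>M seq_space)"
      using measurable_sets[OF proj A] by (simp add: space_pair_measure space_PiM)
    moreover have "U lb 0 -` A \<inter> space M = ?pair -` ((\<lambda>z. snd z 0) -` A) \<inter> space M"
      by auto
    ultimately show "\<exists>B. U lb 0 -` A \<inter> space M = ?pair -` B \<inter> space M \<and> B \<in> sets (seq_space \<Otimes>\<^sub>M seq_space)"
      by blast
  qed
  from indep_set_mono[OF ind subset_refl this]
  have ind': "indep_set (sets (vimage_algebra (space M) (\<Psi> lp) point_configs))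
      (sets (vimage_algebra (space M) (U lb 0) borel))" .
  show ?thesis
  proof (rule indep_setI)
    show "sets (vimage_algebra (space M) (U lb 0) borel) \<subseteq> events"
      "sets (vimage_algebra (space M) (\<Psi> lp) point_configs) \<subseteq> events"
      by (rule indep_setD_ev2[OF ind'], rule indep_setD_ev1[OF ind'])
    show "prob (a \<inter> b) = prob a * prob b"
      if "a \<in> sets (vimage_algebra (space M) (U lb 0) borel)"
        "b \<in> sets (vimage_algebra (space M) (\<Psi> lp) point_configs)" for a b
      using indep_setD[OF ind' that(2,1)] by (simp only: Int_commute mult.commute)
  qed
qed

text \<open>The given network of density \<open>lb\<close> and the dilated one of density 1 have no
  assumed relation on \<open>M\<close>, but both are networks of density \<open>lb\<close>, so their
  mobiles have the same law and their outage probabilities agree.\<close>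

lemma outage_probability_scaling:
  assumes hyb: "hybrid_network M Y U \<Psi>" and lb: "lb > 0" and p: "p > 0" and noise: "noise > 0"
    and \<theta>: "\<theta> > 0"
  shows "outage_probability M (U lb) K \<alpha> \<theta> noise p =
    measure M {x \<in> space M. (\<lambda>n. U 1 n x) \<in> outage_set K \<alpha> \<theta> (noise / (p * lb powr (\<alpha> / 2)))}"
proof -
  have M: "prob_space M" and net: "uplink_network M lb (Y lb) (U lb)" "uplink_network M 1 (Y 1) (U 1)"
    using hyb lb by (auto simp: hybrid_network_def)
  \<comment> \<open>Dilation by \<open>s\<close> takes density 1 to \<open>1 / s\<^sup>2\<close>,
    which has to be \<open>lb\<close>.\<close>
  define s where "s = lb powr (- 1 / 2)"
  have s: "s > 0" using lb by (simp add: s_def)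
  have "s\<^sup>2 = lb powr (- 1)"
    by (simp only: power2_eq_square s_def powr_add[symmetric]) simp
  then have "1 / s\<^sup>2 = lb"
    using lb by (simp add: powr_minus inverse_eq_divide)
  with uplink_network_scaleR[OF M net(2) s]
  have net': "uplink_network M lb (\<lambda>n x. s *\<^sub>R Y 1 n x) (\<lambda>n x. s *\<^sub>R U 1 n x)"
    by simp
  have "- 1 / 2 * \<alpha> = - (\<alpha> / 2)" by simp
  then have "s powr \<alpha> = lb powr (- (\<alpha> / 2))"
    by (simp only: s_def powr_powr)
  also have "\<dots> = 1 / lb powr (\<alpha> / 2)"
    by (rule powr_minus_divide)
  finally have "s powr \<alpha> = 1 / lb powr (\<alpha> / 2)" .
  then have t: "noise / p * s powr \<alpha> = noise / (p * lb powr (\<alpha> / 2))" by simp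
  have meas: "measure M {x \<in> space M. (\<lambda>n. V n x) \<in> outage_set K \<alpha> \<theta> (noise / p)} =
      measure (distr M seq_space (\<lambda>x n. V n x)) (outage_set K \<alpha> \<theta> (noise / p))"
    if "(\<lambda>x n. V n x) \<in> M \<rightarrow>\<^sub>M seq_space" for V
    by (subst measure_distr[OF that sets_outage_set]) (rule arg_cong[where f = "measure M"], auto)
  have "outage_probability M (U lb) K \<alpha> \<theta> noise p =
      measure M {x \<in> space M. (\<lambda>n. U lb n x) \<in> outage_set K \<alpha> \<theta> (noise / p)}"
    by (rule outage_probability_eq[OF p noise \<theta>])
  also have "\<dots> = measure M {x \<in> space M. (\<lambda>n. s *\<^sub>R U 1 n x) \<in> outage_set K \<alpha> \<theta> (noise / p)}"
    unfolding meas[OF uplink_measurable(4)[OF net(1)]] meas[OF uplink_measurable(4)[OF net']]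
      mobiles_distr_unique[OF M M net(1) net'] ..
  also have "\<dots> = measure M {x \<in> space M. (\<lambda>n. U 1 n x) \<in> outage_set K \<alpha> \<theta> (noise / (p * lb powr (\<alpha> / 2)))}"
    using p noise unfolding t[symmetric] by (simp add: outage_set_scaleR[OF s \<theta>])
  finally show ?thesis .
qed

lemma outage_le_iff:
  assumes hyb: "hybrid_network M Y U \<Psi>" and \<alpha>: "\<alpha> > 2" and \<theta>: "\<theta> > 0" and noise: "noise > 0"
    and \<mu>: "\<mu> > 0" and \<epsilon>: "0 < \<epsilon>"
    and crit: "measure M {x \<in> space M. (\<lambda>n. U 1 n x) \<in> outage_set K \<alpha> \<theta> \<mu>} = \<epsilon>"
    and lb: "lb > 0" and p: "p > 0"
  shows "outage_probability M (U lb) K \<alpha> \<theta> noise p \<le> \<epsilon> \<longleftrightarrow> noise / (\<mu> * lb powr (\<alpha> / 2)) \<le> p"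
proof -
  have M: "prob_space M" and net: "uplink_network M 1 (Y 1) (U 1)"
    using hyb by (auto simp: hybrid_network_def)
  interpret prob_space M by fact
  define t where "t = noise / (p * lb powr (\<alpha> / 2))"
  have t0: "0 < t" using noise p lb by (simp add: t_def)
  let ?F = "\<lambda>t. measure M {x \<in> space M. (\<lambda>n. U 1 n x) \<in> outage_set K \<alpha> \<theta> t}"
  have ev: "{x \<in> space M. (\<lambda>n. U 1 n x) \<in> outage_set K \<alpha> \<theta> s} \<in> events" for s
  proof -
    have "{x \<in> space M. (\<lambda>n. U 1 n x) \<in> outage_set K \<alpha> \<theta> s} =
        (\<lambda>x n. U 1 n x) -` outage_set K \<alpha> \<theta> s \<inter> space M" by auto
    then show ?thesis using measurable_sets[OF uplink_measurable(4)[OF net] sets_outage_set] by simp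
  qed
  have "?F t \<le> \<epsilon> \<longleftrightarrow> t \<le> \<mu>"
  proof
    assume "t \<le> \<mu>"
    then have "?F t \<le> ?F \<mu>"
      using outage_set_mono[of t \<mu> K \<alpha> \<theta>] by (intro finite_measure_mono ev) auto
    then show "?F t \<le> \<epsilon>" by (simp only: crit)
  next
    assume le: "?F t \<le> \<epsilon>"
    show "t \<le> \<mu>"
    proof (rule ccontr)
      assume "\<not> t \<le> \<mu>"
      \<comment> \<open>The value of \<open>?F\<close> at \<open>\<mu>\<close> is
        \<open>\<epsilon>\<close>, and \<open>\<epsilon> > 0\<close> is the positivity that strict
        monotonicity asks for.\<close>
      then have "?F \<mu> < ?F t"
        using \<mu> \<epsilon> crit by (intro outage_strict_mono[OF M net _ \<alpha> \<theta>]) simp_all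
      then show False using le crit by linarith
    qed
  qed
  moreover have "t \<le> \<mu> \<longleftrightarrow> noise / (\<mu> * lb powr (\<alpha> / 2)) \<le> p"
    using p \<mu> lb by (simp add: t_def field_simps)
  ultimately show ?thesis
    unfolding outage_probability_scaling[OF hyb lb p noise \<theta>] t_def by simp
qed

text \<open>The energy condition favours small \<open>p\<close>, while the outage constraint is a
  lower bound on \<open>p\<close> that is attained. Hence only the least admissible power has to be
  tested.\<close>

lemma feasibility_region_eq:
  assumes hyb: "hybrid_network M Y U \<Psi>" and \<alpha>: "\<alpha> > 2" and \<theta>: "\<theta> > 0" and noise: "noise > 0"
    and \<mu>: "\<mu> > 0" and \<epsilon>: "0 < \<epsilon>" and \<omega>: "0 < \<omega>"
    and crit: "measure M {x \<in> space M. (\<lambda>n. U 1 n x) \<in> outage_set K \<alpha> \<theta> \<mu>} = \<epsilon>"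
  shows "feasibility_region M U \<Psi> P K \<alpha> \<theta> noise \<omega> \<epsilon> =
    {(q, lb, lp). q \<ge> 0 \<and> lb > 0 \<and> lp \<ge> 0 \<and>
      ennreal (\<omega> * noise / (\<mu> * lb powr (\<alpha> / 2))) \<le> (\<integral>\<^sup>+x. P q (U lb 0 x) (\<Psi> lp x) \<partial>M)}"
proof -
  have "(\<exists>p>0. ennreal (\<omega> * p) \<le> E \<and> outage_probability M (U lb) K \<alpha> \<theta> noise p \<le> \<epsilon>) \<longleftrightarrow>
      ennreal (\<omega> * noise / (\<mu> * lb powr (\<alpha> / 2))) \<le> E" if lb: "lb > 0" for lb :: real and E
  proof -
    let ?p = "noise / (\<mu> * lb powr (\<alpha> / 2))"
    have p0: "0 < ?p" using noise \<mu> lb by simp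
    note iff = outage_le_iff[OF hyb \<alpha> \<theta> noise \<mu> \<epsilon> crit lb]
    show ?thesis
    proof
      assume "\<exists>p>0. ennreal (\<omega> * p) \<le> E \<and> outage_probability M (U lb) K \<alpha> \<theta> noise p \<le> \<epsilon>"
      then obtain p where p: "0 < p" "ennreal (\<omega> * p) \<le> E" "?p \<le> p" using iff by blast
      have "ennreal (\<omega> * ?p) \<le> ennreal (\<omega> * p)"
        using p(3) \<omega> by (intro ennreal_leI mult_left_mono) simp_all
      then show "ennreal (\<omega> * noise / (\<mu> * lb powr (\<alpha> / 2))) \<le> E"
        using p(2) by (simp only: times_divide_eq_right)
    next
      assume "ennreal (\<omega> * noise / (\<mu> * lb powr (\<alpha> / 2))) \<le> E"
      then show "\<exists>p>0. ennreal (\<omega> * p) \<le> E \<and> outage_probability M (U lb) K \<alpha> \<theta> noise p \<le> \<epsilon>"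
        using p0 iff[OF p0] by (intro exI[of _ ?p]) simp
    qed
  qed
  then show ?thesis unfolding feasibility_region_def by auto
qed

theorem proposition4:
  fixes M :: "'w measure"
    and Y U :: "real \<Rightarrow> nat \<Rightarrow> 'w \<Rightarrow> point"
    and \<Psi> :: "real \<Rightarrow> 'w \<Rightarrow> point set"
    and \<alpha> \<beta> \<nu> \<theta> \<sigma> \<epsilon> \<omega> zm zs \<mu> \<kappa> :: real
    and K :: nat
  assumes "\<alpha> > 2" and "\<beta> > 2" and "\<nu> > 1" and "\<theta> > 0" and "\<sigma>\<^sup>2 > 0"
    and "0 < \<epsilon>" and "\<epsilon> < 1" and "0 < \<omega>" and "\<omega> \<le> 1" and "zm > 0" and "zs > 0"
    and "hybrid_network M Y U \<Psi>"
    and "\<mu> > 0"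
    and "measure M {x \<in> space M.
           (\<Sum>\<^sub>\<infinity>n\<in>UNIV.
              norm (U 1 n x) powr (- \<alpha>) * indicator (- ({0} \<union> cancelled K (\<lambda>m. U 1 m x))) n
              - inverse \<theta> * norm (U 1 0 x) powr (- \<alpha>) * indicator {0} n) + \<mu> > 0} = \<epsilon>"
    and "\<kappa> = \<omega> * \<sigma>\<^sup>2 * \<nu> powr \<beta> / \<mu>"
  shows "feasibility_region M U \<Psi> (isotropic_power \<nu> \<beta>) K \<alpha> \<theta> (\<sigma>\<^sup>2) \<omega> \<epsilon> =
           {(q, lb, lp). q \<ge> 0 \<and> lb \<ge> 0 \<and> lp \<ge> 0 \<and>
              q * lp * lb powr (\<alpha> / 2) \<ge>
                (1 - 2 / \<beta>) * (\<sigma>\<^sup>2 * \<omega> * \<nu> powr (\<beta> - 2) / (pi * \<mu>))}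
       \<and> {(q, lb, lp). q \<ge> 0 \<and> lb \<ge> 0 \<and> lp \<ge> 0 \<and>
              ereal lp \<ge> ereal (1 / (pi * \<nu>\<^sup>2)) *
                (if zm * q * lb powr (\<alpha> / 2) - \<kappa> = 0 then \<infinity>
                 else ereal (ln (zm * q * lb powr (\<alpha> / 2) / (zm * q * lb powr (\<alpha> / 2) - \<kappa>)))) \<and>
              (zm * q) powr (2 / \<alpha>) * lb \<ge> \<kappa> powr (2 / \<alpha>)}
         \<subseteq> feasibility_region M U \<Psi> (directed_power zm zs \<nu> \<beta>) K \<alpha> \<theta> (\<sigma>\<^sup>2) \<omega> \<epsilon>"
proof
  note \<alpha> = assms(1) and \<beta> = assms(2) and \<nu> = assms(3) and \<theta> = assms(4) and \<sigma> = assms(5)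
    and \<epsilon> = assms(6) and \<omega> = assms(8) and zm = assms(10) and hyb = assms(12) and \<mu> = assms(13)
  interpret prob_space M using hyb by (simp add: hybrid_network_def)
  have crit: "measure M {x \<in> space M. (\<lambda>n. U 1 n x) \<in> outage_set K \<alpha> \<theta> \<mu>} = \<epsilon>"
    using assms(14) unfolding infsum_margin_pos_iff[OF \<theta> \<mu>, of "\<lambda>n. U 1 n x" for x] .
  note region = feasibility_region_eq[OF hyb \<alpha> \<theta> \<sigma> \<mu> \<epsilon> \<omega> crit]
  have P: "poisson_process M lp (\<Psi> lp)" if "lp \<ge> 0" for lp
    using hyb that by (simp add: hybrid_network_def)
  have U0: "U lb 0 \<in> borel_measurable M" if "lb > 0" for lb
  proof -
    have "uplink_network M lb (Y lb) (U lb)" using hyb that by (simp add: hybrid_network_def)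
    then show ?thesis by (rule uplink_measurable(2))
  qed
  have \<nu>0: "0 < \<nu>" using \<nu> by simp
  let ?c = "(1 - 2 / \<beta>) * (\<sigma>\<^sup>2 * \<omega> * \<nu> powr (\<beta> - 2) / (pi * \<mu>))"
  have \<beta>': "0 < 1 - 2 / \<beta>" using \<beta> by simp
  have c: "0 < ?c" using \<beta>' \<sigma> \<omega> \<nu>0 \<mu> by (intro mult_pos_pos divide_pos_pos) auto
  have iso: "ennreal (\<omega> * \<sigma>\<^sup>2 / (\<mu> * lb powr (\<alpha> / 2))) \<le>
      (\<integral>\<^sup>+x. isotropic_power \<nu> \<beta> q (U lb 0 x) (\<Psi> lp x) \<partial>M) \<longleftrightarrow> ?c \<le> q * lp * lb powr (\<alpha> / 2)"
    if q: "0 \<le> q" and lb: "0 < lb" and lp: "0 \<le> lp" for q lb lp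
  proof -
    let ?L = "lb powr (\<alpha> / 2)" and ?N = "\<nu> powr (\<beta> - 2)"
    have L: "0 < ?L" and N: "0 < ?N" using lb \<nu>0 by simp_all
    have "\<nu> powr (2 - \<beta>) = 1 / ?N"
      using powr_minus_divide[of \<nu> "\<beta> - 2"] by simp
    then have mean: "(\<integral>\<^sup>+x. isotropic_power \<nu> \<beta> q (U lb 0 x) (\<Psi> lp x) \<partial>M) =
        ennreal (q * lp * (pi * (1 / ?N) / (1 - 2 / \<beta>)))"
      by (simp only: mean_isotropic_power[OF P[OF lp] lp U0[OF lb] hybrid_network_indep[OF hyb lb lp] q \<nu>0 \<beta>])
    have nonneg: "0 \<le> q * lp * (pi * (1 / ?N) / (1 - 2 / \<beta>))"
      using q lp \<beta>' N by (intro mult_nonneg_nonneg divide_nonneg_pos) auto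
    define D where "D = 1 - 2 / \<beta>"
    have D: "0 < D" using \<beta>' by (simp add: D_def)
    have "\<omega> * \<sigma>\<^sup>2 / (\<mu> * ?L) \<le> q * lp * (pi * (1 / ?N) / D) \<longleftrightarrow>
        D * (\<sigma>\<^sup>2 * \<omega> * ?N / (pi * \<mu>)) \<le> q * lp * ?L"
    proof -
      have "\<omega> * \<sigma>\<^sup>2 / (\<mu> * ?L) \<le> q * lp * (pi * (1 / ?N) / D) \<longleftrightarrow>
          \<omega> * \<sigma>\<^sup>2 * (?N * D) \<le> q * lp * pi * (\<mu> * ?L)"
        using L N D \<mu> by (simp add: divide_le_eq le_divide_eq mult_ac)
      also have "\<dots> \<longleftrightarrow> D * (\<sigma>\<^sup>2 * \<omega> * ?N / (pi * \<mu>)) \<le> q * lp * ?L"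
        using \<mu> by (simp add: divide_le_eq mult_ac)
      finally show ?thesis .
    qed
    then show ?thesis
      unfolding mean ennreal_le_iff[OF nonneg] D_def .
  qed
  show "feasibility_region M U \<Psi> (isotropic_power \<nu> \<beta>) K \<alpha> \<theta> (\<sigma>\<^sup>2) \<omega> \<epsilon> =
      {(q, lb, lp). q \<ge> 0 \<and> lb \<ge> 0 \<and> lp \<ge> 0 \<and> q * lp * lb powr (\<alpha> / 2) \<ge> ?c}"
  proof -
    \<comment> \<open>The described set formally admits \<open>lb = 0\<close>, but
      \<open>0 powr (\<alpha> / 2)\<close> is 0 and the threshold is positive, so both sets require
      \<open>lb > 0\<close>.\<close>
    have "lb \<noteq> 0" if "?c \<le> q * lp * lb powr (\<alpha> / 2)" for q lb lp :: real
      using that c by auto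
    then show ?thesis
      unfolding region using iso by (auto simp: less_le)
  qed
  show "{(q, lb, lp). q \<ge> 0 \<and> lb \<ge> 0 \<and> lp \<ge> 0 \<and>
      ereal lp \<ge> ereal (1 / (pi * \<nu>\<^sup>2)) *
        (if zm * q * lb powr (\<alpha> / 2) - \<kappa> = 0 then \<infinity>
         else ereal (ln (zm * q * lb powr (\<alpha> / 2) / (zm * q * lb powr (\<alpha> / 2) - \<kappa>)))) \<and>
      (zm * q) powr (2 / \<alpha>) * lb \<ge> \<kappa> powr (2 / \<alpha>)}
    \<subseteq> feasibility_region M U \<Psi> (directed_power zm zs \<nu> \<beta>) K \<alpha> \<theta> (\<sigma>\<^sup>2) \<omega> \<epsilon>"
  proof clarify
    fix q lb lp :: real
    assume q: "0 \<le> q" and lb0: "0 \<le> lb" and lp: "0 \<le> lp"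
    define x where "x = zm * q * lb powr (\<alpha> / 2)"
    assume lp_ge: "ereal (1 / (pi * \<nu>\<^sup>2)) * (if zm * q * lb powr (\<alpha> / 2) - \<kappa> = 0 then \<infinity>
         else ereal (ln (zm * q * lb powr (\<alpha> / 2) / (zm * q * lb powr (\<alpha> / 2) - \<kappa>)))) \<le> ereal lp"
      and q_ge: "\<kappa> powr (2 / \<alpha>) \<le> (zm * q) powr (2 / \<alpha>) * lb"
    have \<kappa>: "0 < \<kappa>" using \<omega> \<sigma> \<nu>0 \<mu> by (simp add: assms(15))
    \<comment> \<open>The second constraint thereby excludes \<open>lb = 0\<close> and
      \<open>q = 0\<close>.\<close>
    have "0 < (zm * q) powr (2 / \<alpha>) * lb" using q_ge \<kappa> by (intro less_le_trans[OF _ q_ge]) simp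
    then have lb: "0 < lb" and zq: "zm * q \<noteq> 0" using lb0 by (auto simp: zero_less_mult_iff)
    have zq: "0 < zm * q" using zq zm q by (simp add: less_le)
    \<comment> \<open>Raised to the power \<open>\<alpha> / 2\<close>, the second constraint reads
      \<open>\<kappa> \<le> x\<close>, so the denominator \<open>x - \<kappa>\<close> is never
      negative.\<close>
    have "(\<kappa> powr (2 / \<alpha>)) powr (\<alpha> / 2) \<le> ((zm * q) powr (2 / \<alpha>) * lb) powr (\<alpha> / 2)"
      using \<alpha> q_ge by (intro powr_mono2) simp_all
    then have "\<kappa> \<le> x"
      using \<alpha> \<kappa> zm q lb by (simp add: powr_powr powr_mult x_def)
    \<comment> \<open>At equality the logarithm is read as infinite, and no real \<open>lp\<close>
      satisfies the first constraint.\<close>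
    have "x \<noteq> \<kappa>"
    proof
      assume "x = \<kappa>"
      then have "ereal (1 / (pi * \<nu>\<^sup>2)) * \<infinity> \<le> ereal lp" using lp_ge by (simp add: x_def)
      then show False using \<nu>0 by simp
    qed
    with \<open>\<kappa> \<le> x\<close> have x: "\<kappa> < x" by simp
    have x0: "0 < x" using x \<kappa> by simp
    have "1 / (pi * \<nu>\<^sup>2) * ln (x / (x - \<kappa>)) \<le> lp"
      using lp_ge \<open>x \<noteq> \<kappa>\<close> unfolding x_def[symmetric] by simp
    then have "ln (x / (x - \<kappa>)) \<le> lp * (pi * \<nu>\<^sup>2)"
      using \<nu>0 by (simp add: divide_le_eq)
    \<comment> \<open>The first constraint is, in logarithmic form, the lower bound
      \<open>\<kappa> / x\<close> on the hit probability; exponentiating recovers it.\<close>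
    then have "exp (- (lp * (pi * \<nu>\<^sup>2))) \<le> exp (- ln (x / (x - \<kappa>)))"
      by simp
    also have "\<dots> = (x - \<kappa>) / x"
      using x x0 by (simp add: exp_minus)
    also have "\<dots> = 1 - \<kappa> / x" using x0 by (simp add: field_simps)
    finally have hit: "\<kappa> / x \<le> 1 - exp (- (lp * (pi * \<nu>\<^sup>2)))" by simp
    \<comment> \<open>This is what \<open>\<kappa>\<close> is made for: its factor
      \<open>\<nu> powr \<beta>\<close> cancels the truncated path loss and \<open>zm * q\<close>
      cancels within \<open>x\<close>, so the required mean is the main-lobe power times
      \<open>\<kappa> / x\<close>.\<close>
    have "\<omega> * \<sigma>\<^sup>2 / (\<mu> * lb powr (\<alpha> / 2)) = zm * q * \<nu> powr (- \<beta>) * (\<kappa> / x)"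
    proof -
      have scale: "zm * q / x = 1 / lb powr (\<alpha> / 2)"
        unfolding x_def using zq by (intro nonzero_divide_mult_cancel_left) linarith
      have "\<nu> powr (- \<beta>) * \<kappa> = \<omega> * \<sigma>\<^sup>2 / \<mu>"
        using \<nu>0 by (simp add: assms(15) powr_minus field_simps)
      moreover have "zm * q * \<nu> powr (- \<beta>) * (\<kappa> / x) = (zm * q / x) * (\<nu> powr (- \<beta>) * \<kappa>)"
        by simp
      ultimately show ?thesis unfolding scale by simp
    qed
    also have "\<dots> \<le> zm * q * \<nu> powr (- \<beta>) * (1 - exp (- (lp * (pi * \<nu>\<^sup>2))))"
      using hit zq by (intro mult_left_mono) simp_all
    finally have "ennreal (\<omega> * \<sigma>\<^sup>2 / (\<mu> * lb powr (\<alpha> / 2))) \<le>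
        ennreal (zm * q * \<nu> powr (- \<beta>) * (1 - exp (- (lp * (pi * \<nu>\<^sup>2)))))"
      by (rule ennreal_leI)
    also have "\<dots> \<le> (\<integral>\<^sup>+x. directed_power zm zs \<nu> \<beta> q (U lb 0 x) (\<Psi> lp x) \<partial>M)"
      using zq by (intro mean_directed_power_ge[OF P[OF lp] U0[OF lb] hybrid_network_indep[OF hyb lb lp] _ \<nu>0]) simp
    finally show "(q, lb, lp) \<in> feasibility_region M U \<Psi> (directed_power zm zs \<nu> \<beta>) K \<alpha> \<theta> (\<sigma>\<^sup>2) \<omega> \<epsilon>"
      unfolding region using q lb lp by simp
  qed
qed

end
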